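(* Let $k$ be a commutative ring, $S=k[x_1,\ldots,x_n]$, let $\Delta$ and $\Pi$ be standard sets in $\mathbb{N}^n$ of the same finite size $d\ge1$, and let $\Delta\subset N$ and $\Pi\subset M$ with $N,M\subset\mathbb{N}^n$ standard sets. With the matrices $T$, $U$ and their blocks as in the context: (i) ${\rm Hilb}^{\Delta}_{S/k}\cap{\rm Hilb}^{\Pi}_{S/k}$ is the open subscheme ${\rm Spec}\,R^\Delta-\mathbb{V}(\det(T_{32}))$ of ${\rm Hilb}^{\Delta}_{S/k}={\rm Spec}\,R^\Delta$. (ii) The gluing morphism $\psi_{\Delta,\Pi}$ which identifies the intersection as an open subscheme of ${\rm Hilb}^{\Delta}_{S/k}$ with an open subscheme of ${\rm Hilb}^{\Pi}_{S/k}$ is given by the homomorphism between the coordinate rings determined by $$T=U\cdot\begin{pmatrix}E&0\\ T_{31}&T_{32}\end{pmatrix},$$ that is, $U\mapsto T\cdot\begin{pmatrix}E&0\\ T_{31}&T_{32}\end{pmatrix}^{-1}$.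
   Context: All rings are commutative with $1$; $x^\alpha=x_1^{\alpha_1}\cdots x_n^{\alpha_n}$ for $\alpha\in\mathbb{N}^n$, $B[x]=B[x_1,\ldots,x_n]$; $e_i$ is the $i$-th standard basis vector, $\delta$ the Kronecker delta. A standard set is a subset $P\subset\mathbb{N}^n$ with $(\mathbb{N}^n-P)+\mathbb{N}^n\subset\mathbb{N}^n-P$; its border is $\mathscr{B}(P)=\bigcup_{i}(P+e_i)-P$; $P^{(1)}=\mathscr{B}(P)$, $P^{(2)}=\mathscr{B}(P\cup P^{(1)})$. ${\rm Hilb}^d_{S/k}$ is the $k$-scheme representing the functor sending a $k$-algebra $B$ to the set of ideals $I\subset B[x]$ with $B[x]/I$ locally free of rank $d$. For a standard set $\Delta$ of size $d$, ${\rm Hilb}^\Delta_{S/k}$ is its open subscheme representing the subfunctor of those $I$ for which $(x^\beta+I)_{\beta\in\Delta}$ is a $B$-basis of $B[x]/I$; it is affine. Put $P=N\cup M$, a standard set containing $\Delta$ and $\Pi$. Write ${\rm Hilb}^\Delta_{S/k}={\rm Spec}\,R^\Delta$ with $R^\Delta=k[T_{\alpha,\beta};\alpha\in P\cup P^{(1)},\beta\in\Delta]/I^\Delta$, where $T_{\alpha,\beta}$ are the coordinates characterized by $x^\alpha\equiv\sum_{\beta\in\Delta}T_{\alpha,\beta}x^\beta$ in the universal quotient, and $I^\Delta$ is generated by: $T_{\alpha,\beta}-\delta_{\alpha,\beta}$ ($\alpha,\beta\in\Delta$); $T_{\alpha+\lambda,\beta}-\sum_{\gamma\in\Delta}T_{\alpha,\gamma}T_{\gamma+\lambda,\beta}$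 ($\alpha,\alpha+\lambda\in P\cup P^{(1)}$, $\lambda\in\{e_1,\ldots,e_n\}$, $\beta\in\Delta$); $\sum_{\gamma\in\Delta}T_{\alpha,\gamma}T_{\gamma+\lambda,\beta}-\sum_{\gamma\in\Delta}T_{\alpha',\gamma}T_{\gamma+\lambda',\beta}$ ($\alpha,\alpha'\in P^{(1)}$, $\lambda,\lambda'\in\{e_1,\ldots,e_n\}$, $\alpha+\lambda=\alpha'+\lambda'\in P^{(2)}$, $\beta\in\Delta$). Analogously ${\rm Hilb}^\Pi_{S/k}={\rm Spec}\,R^\Pi$ with $R^\Pi=k[U_{\alpha,\xi};\alpha\in P\cup P^{(1)},\xi\in\Pi]/I^\Pi$. Let $\rho$ be the complement of $\Delta\cup\Pi$ in $P\cup P^{(1)}$. Decompose the row index set as $(\Delta\cap\Pi)\coprod(\Delta-\Pi)\coprod(\Pi-\Delta)\coprod\rho$ (row blocks $1,2,3,4$), the columns of $T=(T_{\alpha,\beta})$ as $(\Delta\cap\Pi)\coprod(\Delta-\Pi)$, and the columns of $U=(U_{\alpha,\xi})$ as $(\Delta\cap\Pi)\coprod(\Pi-\Delta)$ (column blocks $1,2$). Over the respective coordinate rings, $$T=\begin{pmatrix} E & 0 \\ 0 & E \\ T_{31} & T_{32} \\ T_{41} & T_{42} \end{pmatrix},\qquad U=\begin{pmatrix} E & 0 \\ U_{21} & U_{22} \\ 0 & E \\ U_{41} & U_{42} \end{pmatrix},$$ with $E$ identity matrices. $\mathbb{V}(f)$ denotes the closed subset where $f$ vanishes. In the block matrix of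 (ii), rows are indexed by $(\Delta\cap\Pi)\coprod(\Pi-\Delta)$ and columns by $(\Delta\cap\Pi)\coprod(\Delta-\Pi)$. *)

theory Defs
  imports
    "HOL-Algebra.QuotRing"
    "HOL-Algebra.Module"
    "HOL-Library.Poly_Mapping"
    "HOL-Library.FuncSet"
    "HOL-Combinatorics.Permutations"
begin

section \<open>Standard sets\<close>

text \<open>The monoid of exponents in \<open>n\<close> variables consists of the finitely supported functions
  on \<^typ>\<open>nat\<close> whose support lies in \<open>{..<n}\<close>; thus \<open>n = 0\<close> is included.\<close>

type_synonym expo = "nat \<Rightarrow>\<^sub>0 nat"

definition exponents :: "nat \<Rightarrow> expo set" where
  "exponents n = {\<alpha>. Poly_Mapping.keys \<alpha> \<subseteq> {..<n}}"

definition unit_vec :: "nat \<Rightarrow> expo" where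
  "unit_vec i = Poly_Mapping.single i 1"

definition standard_set :: "nat \<Rightarrow> expo set \<Rightarrow> bool" where
  "standard_set n P \<longleftrightarrow> P \<subseteq> exponents n \<and>
     (\<forall>\<alpha>\<in>exponents n - P. \<forall>\<beta>\<in>exponents n. \<alpha> + \<beta> \<in> exponents n - P)"

definition border :: "nat \<Rightarrow> expo set \<Rightarrow> expo set" where
  "border n P = (\<Union>i<n. (\<lambda>\<alpha>. \<alpha> + unit_vec i) ` P) - P"

definition border2 :: "nat \<Rightarrow> expo set \<Rightarrow> expo set" where
  "border2 n P = border n (P \<union> border n P)"


section \<open>Polynomial rings in arbitrary sets of variables\<close>

text \<open>Polynomials over a ring \<open>R\<close> in the variables \<open>V\<close> are their coefficient functions, as for
  \<open>UP\<close> in one variable. The library's indexed polynomials come without a multiplication.\<close>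

definition mpoly_ring ::
  "('a, 'm) ring_scheme \<Rightarrow> 'v set \<Rightarrow> (('v \<Rightarrow>\<^sub>0 nat) \<Rightarrow> 'a) ring" where
  "mpoly_ring R V =
    \<lparr>carrier = {p. (\<forall>m. p m \<in> carrier R) \<and> finite {m. p m \<noteq> \<zero>\<^bsub>R\<^esub>} \<and>
                   (\<forall>m. p m \<noteq> \<zero>\<^bsub>R\<^esub> \<longrightarrow> Poly_Mapping.keys m \<subseteq> V)},
     monoid.mult = (\<lambda>p q m. \<Oplus>\<^bsub>R\<^esub>s\<in>{s. fst s + snd s = m}. p (fst s) \<otimes>\<^bsub>R\<^esub> q (snd s)),
     one = (\<lambda>m. if m = 0 then \<one>\<^bsub>R\<^esub> else \<zero>\<^bsub>R\<^esub>),
     zero = (\<lambda>m. \<zero>\<^bsub>R\<^esub>),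
     add = (\<lambda>p q m. p m \<oplus>\<^bsub>R\<^esub> q m)\<rparr>"

definition mpoly_const :: "('a, 'm) ring_scheme \<Rightarrow> 'a \<Rightarrow> ('v \<Rightarrow>\<^sub>0 nat) \<Rightarrow> 'a" where
  "mpoly_const R a = (\<lambda>m. if m = 0 then a else \<zero>\<^bsub>R\<^esub>)"

definition mpoly_monom :: "('a, 'm) ring_scheme \<Rightarrow> ('v \<Rightarrow>\<^sub>0 nat) \<Rightarrow> ('v \<Rightarrow>\<^sub>0 nat) \<Rightarrow> 'a" where
  "mpoly_monom R \<alpha> = (\<lambda>m. if m = \<alpha> then \<one>\<^bsub>R\<^esub> else \<zero>\<^bsub>R\<^esub>)"

definition mpoly_var :: "('a, 'm) ring_scheme \<Rightarrow> 'v \<Rightarrow> ('v \<Rightarrow>\<^sub>0 nat) \<Rightarrow> 'a" where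
  "mpoly_var R v = mpoly_monom R (Poly_Mapping.single v 1)"


section \<open>Algebras, modules, bases\<close>

definition with_scalars :: "('a, 'm) ring_scheme \<Rightarrow> ('r \<Rightarrow> 'a) \<Rightarrow> ('r, 'a) module" where
  "with_scalars A \<iota> =
    \<lparr>carrier = carrier A, monoid.mult = monoid.mult A, one = one A, zero = zero A, add = add A,
     smult = (\<lambda>r x. \<iota> r \<otimes>\<^bsub>A\<^esub> x)\<rparr>"

text \<open>The quotient of a polynomial ring by an ideal, as an algebra over the ring of
  coefficients.\<close>

definition mpoly_quot ::
  "('a, 'm) ring_scheme \<Rightarrow> 'v set \<Rightarrow> (('v \<Rightarrow>\<^sub>0 nat) \<Rightarrow> 'a) set
    \<Rightarrow> ('a, (('v \<Rightarrow>\<^sub>0 nat) \<Rightarrow> 'a) set) module" where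
  "mpoly_quot R V I =
     with_scalars (mpoly_ring R V Quot I) (\<lambda>a. I +>\<^bsub>mpoly_ring R V\<^esub> mpoly_const R a)"

text \<open>Homomorphisms are extensional, so that equality of functions is equality of
  homomorphisms.\<close>

definition alg_hom ::
  "('k, 'm) ring_scheme \<Rightarrow> ('k, 'a, 'p) module_scheme \<Rightarrow> ('k, 'b, 'q) module_scheme
    \<Rightarrow> ('a \<Rightarrow> 'b) set" where
  "alg_hom k A B = {\<phi> \<in> ring_hom A B \<inter> extensional (carrier A).
     \<forall>c\<in>carrier k. \<forall>a\<in>carrier A. \<phi> (c \<odot>\<^bsub>A\<^esub> a) = c \<odot>\<^bsub>B\<^esub> \<phi> a}"

definition is_basis ::
  "('r, 'm) ring_scheme \<Rightarrow> ('r, 'a, 'p) module_scheme \<Rightarrow> 'i set \<Rightarrow> ('i \<Rightarrow> 'a) \<Rightarrow> bool" where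
  "is_basis R M J b \<longleftrightarrow> b \<in> J \<rightarrow> carrier M \<and>
     (\<forall>v\<in>carrier M. \<exists>!c. c \<in> J \<rightarrow>\<^sub>E carrier R \<and> v = (\<Oplus>\<^bsub>M\<^esub>j\<in>J. c j \<odot>\<^bsub>M\<^esub> b j))"

text \<open>Freeness of rank \<open>d\<close> of the localization of \<open>M\<close> at a ring element \<open>f\<close>, written out on
  \<open>M\<close>: as \<open>f\<close> becomes a unit, a basis of the localization can be chosen in the image of \<open>M\<close>,
  and an equation holds in the localization iff it holds after multiplication by a power
  of \<open>f\<close>.\<close>

definition free_away ::
  "('r, 'm) ring_scheme \<Rightarrow> ('r, 'a, 'p) module_scheme \<Rightarrow> 'r \<Rightarrow> nat \<Rightarrow> bool" where
  "free_away R M f d \<longleftrightarrow> (\<exists>b \<in> {..<d} \<rightarrow> carrier M.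
     (\<forall>v\<in>carrier M. \<exists>s::nat. \<exists>c \<in> {..<d} \<rightarrow> carrier R.
        (f [^]\<^bsub>R\<^esub> s) \<odot>\<^bsub>M\<^esub> v = (\<Oplus>\<^bsub>M\<^esub>j\<in>{..<d}. c j \<odot>\<^bsub>M\<^esub> b j)) \<and>
     (\<forall>c \<in> {..<d} \<rightarrow> carrier R. (\<Oplus>\<^bsub>M\<^esub>j\<in>{..<d}. c j \<odot>\<^bsub>M\<^esub> b j) = \<zero>\<^bsub>M\<^esub> \<longrightarrow>
        (\<forall>j<d. \<exists>s::nat. (f [^]\<^bsub>R\<^esub> s) \<otimes>\<^bsub>R\<^esub> c j = \<zero>\<^bsub>R\<^esub>)))"

definition locally_free_of_rank ::
  "('r, 'm) ring_scheme \<Rightarrow> ('r, 'a, 'p) module_scheme \<Rightarrow> nat \<Rightarrow> bool" where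
  "locally_free_of_rank R M d \<longleftrightarrow>
     (\<forall>\<pp>. primeideal \<pp> R \<longrightarrow> (\<exists>f\<in>carrier R - \<pp>. free_away R M f d))"


section \<open>Hilbert functors\<close>

definition hilbert_points :: "nat \<Rightarrow> nat \<Rightarrow> ('b, 'm) ring_scheme \<Rightarrow> (expo \<Rightarrow> 'b) set set" where
  "hilbert_points n d B = {I. ideal I (mpoly_ring B {..<n}) \<and>
     locally_free_of_rank B (mpoly_quot B {..<n} I) d}"

definition monom_class :: "nat \<Rightarrow> ('b, 'm) ring_scheme \<Rightarrow> (expo \<Rightarrow> 'b) set \<Rightarrow> expo
    \<Rightarrow> (expo \<Rightarrow> 'b) set" where
  "monom_class n B I \<alpha> = I +>\<^bsub>mpoly_ring B {..<n}\<^esub> mpoly_monom B \<alpha>"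

text \<open>The open subfunctor of a standard set \<open>\<Delta>\<close>.\<close>

definition hilbert_points_on ::
  "nat \<Rightarrow> expo set \<Rightarrow> ('b, 'm) ring_scheme \<Rightarrow> (expo \<Rightarrow> 'b) set set" where
  "hilbert_points_on n \<Delta> B = {I \<in> hilbert_points n (card \<Delta>) B.
     is_basis B (mpoly_quot B {..<n} I) \<Delta> (monom_class n B I)}"


section \<open>Coordinate rings\<close>

definition coord_vars :: "nat \<Rightarrow> expo set \<Rightarrow> expo set \<Rightarrow> (expo \<times> expo) set" where
  "coord_vars n P \<Delta> = (P \<union> border n P) \<times> \<Delta>"

definition coord_poly_ring ::
  "('k, 'm) ring_scheme \<Rightarrow> nat \<Rightarrow> expo set \<Rightarrow> expo set \<Rightarrow> ((expo \<times> expo \<Rightarrow>\<^sub>0 nat) \<Rightarrow> 'k) ring" where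
  "coord_poly_ring k n P \<Delta> = mpoly_ring k (coord_vars n P \<Delta>)"

definition coord_relations ::
  "('k, 'm) ring_scheme \<Rightarrow> nat \<Rightarrow> expo set \<Rightarrow> expo set \<Rightarrow> ((expo \<times> expo \<Rightarrow>\<^sub>0 nat) \<Rightarrow> 'k) set" where
  "coord_relations k n P \<Delta> =
    (let A = coord_poly_ring k n P \<Delta>; T = (\<lambda>\<alpha> \<beta>. mpoly_var k (\<alpha>, \<beta>)); e = unit_vec;
         P1 = border n P; P2 = border2 n P in
      {T \<alpha> \<beta> \<ominus>\<^bsub>A\<^esub> (if \<alpha> = \<beta> then \<one>\<^bsub>A\<^esub> else \<zero>\<^bsub>A\<^esub>) | \<alpha> \<beta>. \<alpha> \<in> \<Delta> \<and> \<beta> \<in> \<Delta>} \<union>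
      {T (\<alpha> + e i) \<beta> \<ominus>\<^bsub>A\<^esub> (\<Oplus>\<^bsub>A\<^esub>\<gamma>\<in>\<Delta>. T \<alpha> \<gamma> \<otimes>\<^bsub>A\<^esub> T (\<gamma> + e i) \<beta>) | \<alpha> i \<beta>.
         \<alpha> \<in> P \<union> P1 \<and> i < n \<and> \<alpha> + e i \<in> P \<union> P1 \<and> \<beta> \<in> \<Delta>} \<union>
      {(\<Oplus>\<^bsub>A\<^esub>\<gamma>\<in>\<Delta>. T \<alpha> \<gamma> \<otimes>\<^bsub>A\<^esub> T (\<gamma> + e i) \<beta>) \<ominus>\<^bsub>A\<^esub>
         (\<Oplus>\<^bsub>A\<^esub>\<gamma>\<in>\<Delta>. T \<alpha>' \<gamma> \<otimes>\<^bsub>A\<^esub> T (\<gamma> + e j) \<beta>) | \<alpha> \<alpha>' i j \<beta>.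
         \<alpha> \<in> P1 \<and> \<alpha>' \<in> P1 \<and> i < n \<and> j < n \<and> \<alpha> + e i = \<alpha>' + e j \<and> \<alpha> + e i \<in> P2 \<and> \<beta> \<in> \<Delta>})"

definition coord_ideal ::
  "('k, 'm) ring_scheme \<Rightarrow> nat \<Rightarrow> expo set \<Rightarrow> expo set \<Rightarrow> ((expo \<times> expo \<Rightarrow>\<^sub>0 nat) \<Rightarrow> 'k) set" where
  "coord_ideal k n P \<Delta> = Idl\<^bsub>coord_poly_ring k n P \<Delta>\<^esub> (coord_relations k n P \<Delta>)"

definition coord_alg ::
  "('k, 'm) ring_scheme \<Rightarrow> nat \<Rightarrow> expo set \<Rightarrow> expo set
    \<Rightarrow> ('k, ((expo \<times> expo \<Rightarrow>\<^sub>0 nat) \<Rightarrow> 'k) set) module" where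
  "coord_alg k n P \<Delta> = mpoly_quot k (coord_vars n P \<Delta>) (coord_ideal k n P \<Delta>)"

definition coord_entry ::
  "('k, 'm) ring_scheme \<Rightarrow> nat \<Rightarrow> expo set \<Rightarrow> expo set \<Rightarrow> expo \<Rightarrow> expo
    \<Rightarrow> ((expo \<times> expo \<Rightarrow>\<^sub>0 nat) \<Rightarrow> 'k) set" where
  "coord_entry k n P \<Delta> \<alpha> \<beta> =
     coord_ideal k n P \<Delta> +>\<^bsub>coord_poly_ring k n P \<Delta>\<^esub> mpoly_var k (\<alpha>, \<beta>)"

text \<open>The identification of a point \<open>I\<close> over \<open>B\<close> of the Hilbert functor of \<open>\<Delta>\<close> with a
  homomorphism from the coordinate algebra: the value of the coordinate at \<open>(\<alpha>, \<beta>)\<close> is the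
  coefficient of \<open>x\<^sup>\<beta>\<close> in the expansion of \<open>x\<^sup>\<alpha>\<close> modulo \<open>I\<close>.\<close>

definition hilbert_chart ::
  "('k, 'm) ring_scheme \<Rightarrow> nat \<Rightarrow> expo set \<Rightarrow> expo set \<Rightarrow> ('k, 'b) module \<Rightarrow> (expo \<Rightarrow> 'b) set
    \<Rightarrow> ((expo \<times> expo \<Rightarrow>\<^sub>0 nat) \<Rightarrow> 'k) set \<Rightarrow> 'b" where
  "hilbert_chart k n P \<Delta> B I = (THE \<phi>. \<phi> \<in> alg_hom k (coord_alg k n P \<Delta>) B \<and>
     (\<forall>\<alpha>\<in>P \<union> border n P. monom_class n B I \<alpha> =
        (\<Oplus>\<^bsub>mpoly_quot B {..<n} I\<^esub>\<beta>\<in>\<Delta>.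
           \<phi> (coord_entry k n P \<Delta> \<alpha> \<beta>) \<odot>\<^bsub>mpoly_quot B {..<n} I\<^esub> monom_class n B I \<beta>)))"

text \<open>The change of charts on the points over \<open>B\<close>, from the chart of \<open>\<Delta>\<close> to the chart
  of \<open>\<Xi>\<close>.\<close>

definition gluing_map ::
  "('k, 'm) ring_scheme \<Rightarrow> nat \<Rightarrow> expo set \<Rightarrow> expo set \<Rightarrow> expo set \<Rightarrow> ('k, 'b) module
    \<Rightarrow> (((expo \<times> expo \<Rightarrow>\<^sub>0 nat) \<Rightarrow> 'k) set \<Rightarrow> 'b) \<Rightarrow> ((expo \<times> expo \<Rightarrow>\<^sub>0 nat) \<Rightarrow> 'k) set \<Rightarrow> 'b" where
  "gluing_map k n P \<Delta> \<Xi> B \<chi> = hilbert_chart k n P \<Xi> B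
     (inv_into (hilbert_points_on n \<Delta> B \<inter> hilbert_points_on n \<Xi> B)
        (hilbert_chart k n P \<Delta> B) \<chi>)"


section \<open>Open subschemes of affine schemes\<close>

definition prime_spectrum :: "('a, 'm) ring_scheme \<Rightarrow> 'a set set" where
  "prime_spectrum A = {\<pp>. primeideal \<pp> A}"

definition vanishing_set :: "('a, 'm) ring_scheme \<Rightarrow> 'a \<Rightarrow> 'a set set" where
  "vanishing_set A f = {\<pp> \<in> prime_spectrum A. f \<in> \<pp>}"

text \<open>For an open subset \<open>W\<close> of the spectrum of \<open>A\<close>, the points over \<open>B\<close> of the open subscheme
  \<open>W\<close>: the morphisms between the spectra of \<open>B\<close> and \<open>A\<close> whose underlying continuous map has
  image in \<open>W\<close>.\<close>

definition open_subscheme_points ::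
  "('k, 'm) ring_scheme \<Rightarrow> ('k, 'a, 'p) module_scheme \<Rightarrow> 'a set set \<Rightarrow> ('k, 'b, 'q) module_scheme
    \<Rightarrow> ('a \<Rightarrow> 'b) set" where
  "open_subscheme_points k A W B = {\<phi> \<in> alg_hom k A B.
     \<forall>\<qq>\<in>prime_spectrum B. {a \<in> carrier A. \<phi> a \<in> \<qq>} \<in> W}"

text \<open>\<open>l\<close> exhibits \<open>L\<close> as the localization of \<open>A\<close> at the powers of \<open>f\<close>, i.e. as the coordinate
  ring of the complement of the vanishing set of \<open>f\<close>.\<close>

definition localization_away ::
  "('k, 'm) ring_scheme \<Rightarrow> ('k, 'a, 'p) module_scheme \<Rightarrow> 'a \<Rightarrow> ('k, 'l, 'q) module_scheme
    \<Rightarrow> ('a \<Rightarrow> 'l) \<Rightarrow> bool" where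
  "localization_away k A f L l \<longleftrightarrow> algebra k L \<and> l \<in> alg_hom k A L \<and> l f \<in> Units L \<and>
     (\<forall>y\<in>carrier L. \<exists>a\<in>carrier A. \<exists>s::nat. y \<otimes>\<^bsub>L\<^esub> (l f [^]\<^bsub>L\<^esub> s) = l a) \<and>
     (\<forall>a\<in>carrier A. l a = \<zero>\<^bsub>L\<^esub> \<longrightarrow> (\<exists>s::nat. (f [^]\<^bsub>A\<^esub> s) \<otimes>\<^bsub>A\<^esub> a = \<zero>\<^bsub>A\<^esub>))"


section \<open>Matrices\<close>

definition mat_det :: "('a, 'm) ring_scheme \<Rightarrow> nat \<Rightarrow> (nat \<Rightarrow> nat \<Rightarrow> 'a) \<Rightarrow> 'a" where
  "mat_det R m X = (\<Oplus>\<^bsub>R\<^esub>p\<in>{p. p permutes {..<m}}.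
     (if evenperm p then \<Otimes>\<^bsub>R\<^esub>i\<in>{..<m}. X i (p i) else \<ominus>\<^bsub>R\<^esub> (\<Otimes>\<^bsub>R\<^esub>i\<in>{..<m}. X i (p i))))"

text \<open>The determinant of the block of the coordinate matrix for \<open>\<Delta>\<close> with rows \<open>\<Xi> - \<Delta>\<close> and
  columns \<open>\<Delta> - \<Xi>\<close>, where the rows are enumerated by \<open>r\<close> and the columns by \<open>c\<close>. Changing the
  enumerations only changes the sign.\<close>

definition block_det ::
  "('k, 'm) ring_scheme \<Rightarrow> nat \<Rightarrow> expo set \<Rightarrow> expo set \<Rightarrow> nat \<Rightarrow> (nat \<Rightarrow> expo) \<Rightarrow> (nat \<Rightarrow> expo)
    \<Rightarrow> ((expo \<times> expo \<Rightarrow>\<^sub>0 nat) \<Rightarrow> 'k) set" where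
  "block_det k n P \<Delta> m r c =
     mat_det (coord_alg k n P \<Delta>) m (\<lambda>i j. coord_entry k n P \<Delta> (r i) (c j))"

text \<open>The matrix with row blocks \<open>(E, 0)\<close> and \<open>(T\<^sub>3\<^sub>1, T\<^sub>3\<^sub>2)\<close>, with rows indexed by \<open>\<Xi>\<close> and
  columns indexed by \<open>\<Delta>\<close>.\<close>

definition transition_entry ::
  "('k, 'm) ring_scheme \<Rightarrow> nat \<Rightarrow> expo set \<Rightarrow> expo set \<Rightarrow> expo set \<Rightarrow> expo \<Rightarrow> expo
    \<Rightarrow> ((expo \<times> expo \<Rightarrow>\<^sub>0 nat) \<Rightarrow> 'k) set" where
  "transition_entry k n P \<Delta> \<Xi> \<xi> \<beta> =
     (if \<xi> \<in> \<Delta> \<inter> \<Xi>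
      then (if \<xi> = \<beta> then \<one>\<^bsub>coord_alg k n P \<Delta>\<^esub> else \<zero>\<^bsub>coord_alg k n P \<Delta>\<^esub>)
      else coord_entry k n P \<Delta> \<xi> \<beta>)"

definition inverse_matrix ::
  "('a, 'm) ring_scheme \<Rightarrow> 'i set \<Rightarrow> 'j set \<Rightarrow> ('i \<Rightarrow> 'j \<Rightarrow> 'a) \<Rightarrow> ('j \<Rightarrow> 'i \<Rightarrow> 'a) \<Rightarrow> bool" where
  "inverse_matrix R I J X Y \<longleftrightarrow>
     (\<forall>i\<in>I. \<forall>j\<in>J. X i j \<in> carrier R \<and> Y j i \<in> carrier R) \<and>
     (\<forall>i\<in>I. \<forall>i'\<in>I. (\<Oplus>\<^bsub>R\<^esub>j\<in>J. X i j \<otimes>\<^bsub>R\<^esub> Y j i') = (if i = i' then \<one>\<^bsub>R\<^esub> else \<zero>\<^bsub>R\<^esub>)) \<and>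
     (\<forall>j\<in>J. \<forall>j'\<in>J. (\<Oplus>\<^bsub>R\<^esub>i\<in>I. Y j i \<otimes>\<^bsub>R\<^esub> X i j') = (if j = j' then \<one>\<^bsub>R\<^esub> else \<zero>\<^bsub>R\<^esub>))"

end

theory Submission
  imports Defs "Jordan_Normal_Form.Determinant" "HOL-Algebra.Ring_Divisibility"
begin

text \<open>
  A point of the chart of \<open>\<Delta>\<close> over \<open>B\<close> is the same as a table of coefficients expanding every
  monomial \<open>x\<^sup>\<alpha>\<close> in the basis \<open>(x\<^sup>\<beta>)\<close>, \<open>\<beta> \<in> \<Delta>\<close>. The relations of the coordinate ring say
  that multiplication by the variables acts on the rows of such a table by commuting matrices, so
  that the rows indexed by \<open>P\<close> and its border determine all others; the ideal is recovered as the
  set of polynomials all of whose coordinates vanish. For such an ideal, the monomials in \<open>\<Xi>\<close> also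
  form a basis iff the square matrix \<open>(T\<^sub>\<xi>\<^sub>\<beta>)\<close> is invertible. Its rows in \<open>\<Delta> \<inter> \<Xi>\<close> are unit vectors,
  hence this means that \<open>det T\<^sub>3\<^sub>2\<close> is a unit, i.e. lies in no prime ideal. The change of basis
  then yields the gluing formula, which is natural in \<open>B\<close>; applied to the localization maps, which
  are themselves points, it gives mutually inverse isomorphisms of the two localizations.
\<close>

section \<open>Transfer of identities from type classes to carrier-based rings\<close>

text \<open>The coordinates record rows only for \<open>P\<close> and its border, while the ideal of
  a point lives in all of B[x]. Extending the rows by repeated multiplication with variables
  requires that the order of the factors be irrelevant; the relations over the second border supply
  the commutation in the cases where two steps leave \<open>P\<close> and its border. No division
  algorithm is involved, since the ideal is the kernel of a linear map into B^\<Delta>. Points over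
  different algebras have elements of different types, and extending an ideal along a homomorphism
  is avoided: naturality of the gluing is read off the matrix formula, because homomorphisms
  preserve inverse matrices and a homomorphism from a coordinate ring is determined by its values on
  the entries. Local freeness in the definition of the points follows from the basis condition, and
  the topological description of an open subscheme becomes an algebraic one because a nonunit lies
  in some maximal ideal.\<close>

text \<open>The product of \<^typ>\<open>int\<close> and of all commutative rings with elements of type \<open>'b\<close> belongs to
  the class \<^class>\<open>comm_ring_1\<close> (the factor \<^typ>\<open>int\<close> provides \<open>0 \<noteq> 1\<close>) and projects onto each
  of these rings. Polynomial identities can thus be proved in a type class and projected.\<close>

typedef 'b cring_prod =
  "{F :: ('b ring \<Rightarrow> 'b) \<times> int. \<forall>R. if cring R then fst F R \<in> carrier R else fst F R = undefined}"
  by (rule exI[of _ "(\<lambda>R. if cring R then \<zero>\<^bsub>R\<^esub> else undefined, 0)"])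
     (simp add: cring.cring_simprules(2))

setup_lifting type_definition_cring_prod

instantiation cring_prod :: (type) comm_ring_1
begin

lift_definition zero_cring_prod :: "'a cring_prod" is
  "(\<lambda>R. if cring R then \<zero>\<^bsub>R\<^esub> else undefined, 0)"
  by (simp add: cring.cring_simprules)
lift_definition one_cring_prod :: "'a cring_prod" is
  "(\<lambda>R. if cring R then \<one>\<^bsub>R\<^esub> else undefined, 1)"
  by (simp add: cring.cring_simprules)
lift_definition plus_cring_prod :: "'a cring_prod \<Rightarrow> 'a cring_prod \<Rightarrow> 'a cring_prod" is
  "\<lambda>F G. (\<lambda>R. if cring R then fst F R \<oplus>\<^bsub>R\<^esub> fst G R else undefined, snd F + snd G)"
  by (simp add: cring.cring_simprules)
lift_definition times_cring_prod :: "'a cring_prod \<Rightarrow> 'a cring_prod \<Rightarrow> 'a cring_prod" is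
  "\<lambda>F G. (\<lambda>R. if cring R then fst F R \<otimes>\<^bsub>R\<^esub> fst G R else undefined, snd F * snd G)"
  by (simp add: cring.cring_simprules)
lift_definition uminus_cring_prod :: "'a cring_prod \<Rightarrow> 'a cring_prod" is
  "\<lambda>F. (\<lambda>R. if cring R then \<ominus>\<^bsub>R\<^esub> fst F R else undefined, - snd F)"
  by (simp add: cring.cring_simprules)
lift_definition minus_cring_prod :: "'a cring_prod \<Rightarrow> 'a cring_prod \<Rightarrow> 'a cring_prod" is
  "\<lambda>F G. (\<lambda>R. if cring R then fst F R \<oplus>\<^bsub>R\<^esub> \<ominus>\<^bsub>R\<^esub> fst G R else undefined, snd F - snd G)"
  by (simp add: cring.cring_simprules)

instance
proof
  fix a b c :: "'a cring_prod"
  note [simp] = cring.cring_simprules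
  show "a * b * c = a * (b * c)" by transfer (auto simp: fun_eq_iff)
  show "a * b = b * a" by transfer (auto simp: fun_eq_iff)
  show "1 * a = a" by transfer (auto simp: fun_eq_iff prod_eq_iff)
  show "a + b + c = a + (b + c)" by transfer (auto simp: fun_eq_iff)
  show "a + b = b + a" by transfer (auto simp: fun_eq_iff)
  show "0 + a = a" by transfer (auto simp: fun_eq_iff prod_eq_iff)
  show "- a + a = 0" by transfer (auto simp: fun_eq_iff)
  show "a - b = a + - b" by transfer (auto simp: fun_eq_iff)
  show "(a + b) * c = a * c + b * c" by transfer (auto simp: fun_eq_iff algebra_simps)
  show "(0::'a cring_prod) \<noteq> 1" by transfer auto
qed

end

text \<open>Surjectivity allows statements about arbitrary elements of \<open>R\<close> to be pulled
  back: every element, matrix or polynomial over \<open>R\<close> is the image of one over the type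
  class ring, and an equation proved there is pushed forward by \<open>h\<close>.\<close>

locale surj_hom =
  fixes R :: "('b, 'm) ring_scheme" (structure) and h :: "'c::comm_ring_1 \<Rightarrow> 'b"
  assumes cring: "cring R"
    and closed [simp]: "h x \<in> carrier R"
    and add: "h (x + y) = h x \<oplus> h y"
    and mult: "h (x * y) = h x \<otimes> h y"
    and zero [simp]: "h 0 = \<zero>"
    and one [simp]: "h 1 = \<one>"
    and surj: "b \<in> carrier R \<Longrightarrow> \<exists>x. h x = b"
begin

sublocale cring R by (rule cring)

lemma uminus: "h (- x) = \<ominus> h x"
  using add[of "- x" x] by (simp add: minus_equality)

text \<open>Zero is singled out because a chosen preimage of zero could be nonzero; with this choice
  a lifted coefficient function keeps finite support.\<close>

definition lift :: "'b \<Rightarrow> 'c" where "lift b = (if b = \<zero> then 0 else SOME x. h x = b)"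

lemma h_lift [simp]: "b \<in> carrier R \<Longrightarrow> h (lift b) = b"
  unfolding lift_def using someI_ex[OF surj] by auto

lemma lift_zero [simp]: "lift \<zero> = 0" by (simp add: lift_def)

lemma hsum: "h (sum f A) = finsum R (\<lambda>a. h (f a)) A"
  by (induction A rule: infinite_finite_induct) (auto simp: add)

lemma hprod: "h (prod f A) = finprod R (\<lambda>a. h (f a)) A"
  by (induction A rule: infinite_finite_induct) (auto simp: mult)

end

text \<open>The homomorphism is the projection to one factor. The factors are indexed by plain ring
  records, so \<open>R\<close> is replaced by its truncation \<open>R0\<close>, which has the same
  carrier and operations.\<close>

lemma ex_surj_hom:
  fixes R :: "('b, 'm) ring_scheme"
  assumes "cring R"
  shows "\<exists>h :: 'b cring_prod \<Rightarrow> 'b. surj_hom R h"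
proof -
  interpret cring R by (rule assms)
  define R0 :: "'b ring" where "R0 = \<lparr>carrier = carrier R, monoid.mult = monoid.mult R, one = one R, zero = zero R, add = add R\<rparr>"
  have [simp]: "carrier R0 = carrier R" "monoid.mult R0 = monoid.mult R" "one R0 = one R" "zero R0 = zero R" "add R0 = add R"
    by (simp_all add: R0_def)
  have R0: "cring R0"
    by (intro cringI abelian_groupI comm_monoidI)
       (auto simp: m_ac a_ac r_distr intro: bexI[OF _ a_inv_closed] l_neg)
  define h :: "'b cring_prod \<Rightarrow> 'b" where "h F = fst (Rep_cring_prod F) R0" for F
  show ?thesis
  proof (intro exI[of _ h] surj_hom.intro)
    fix x y
    show "h x \<in> carrier R" using Rep_cring_prod[of x] R0 unfolding h_def mem_Collect_eq
      by (elim allE[of _ R0]) simp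
    show "h (x + y) = h x \<oplus>\<^bsub>R\<^esub> h y" by (simp add: h_def plus_cring_prod.rep_eq R0)
    show "h (x * y) = h x \<otimes>\<^bsub>R\<^esub> h y" by (simp add: h_def times_cring_prod.rep_eq R0)
    show "h 0 = \<zero>\<^bsub>R\<^esub>" by (simp add: h_def zero_cring_prod.rep_eq R0)
    show "h 1 = \<one>\<^bsub>R\<^esub>" by (simp add: h_def one_cring_prod.rep_eq R0)
  next
    fix b assume b: "b \<in> carrier R"
    \<comment> \<open>A preimage of \<open>b\<close>: the tuple with \<open>b\<close> at the index
      \<open>R0\<close> and zero at all other rings.\<close>
    let ?F = "(\<lambda>R'. if R' = R0 then b else if cring R' then \<zero>\<^bsub>R'\<^esub> else undefined, 0 :: int)"
    have "h (Abs_cring_prod ?F) = b"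
      unfolding h_def by (subst Abs_cring_prod_inverse) (auto simp: R0 b cring.cring_simprules)
    then show "\<exists>x. h x = b" ..
  qed (rule assms)
qed

section \<open>Determinants\<close>

context surj_hom begin

lemma h_det:
  assumes "X \<in> carrier_mat m m"
  shows "h (det X) = mat_det R m (\<lambda>i j. h (X $$ (i, j)))"
proof -
  have *: "h (signof p * (\<Prod>i = 0..<m. X $$ (i, p i))) =
     (if evenperm p then \<Otimes>i\<in>{..<m}. h (X $$ (i, p i)) else \<ominus> (\<Otimes>i\<in>{..<m}. h (X $$ (i, p i))))" for p
    by (auto simp: mult sign_def uminus hprod l_minus lessThan_atLeast0)
  show ?thesis
    unfolding det_def'[OF assms] mat_det_def hsum * by (simp add: lessThan_atLeast0)
qed

end

lemma mat_det_cong: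
  assumes "cring R" "\<And>i j. i < m \<Longrightarrow> j < m \<Longrightarrow> X i j = Y i j" "\<And>i j. i < m \<Longrightarrow> j < m \<Longrightarrow> Y i j \<in> carrier R"
  shows "mat_det R m X = mat_det R m Y"
proof -
  interpret cring R by fact
  have c: "(\<Otimes>\<^bsub>R\<^esub>i\<in>{..<m}. Y i (p i)) \<in> carrier R" if "p permutes {..<m}" for p
    using that assms(3) permutes_in_image[OF that] by (intro finprod_closed) auto
  have e: "(\<Otimes>\<^bsub>R\<^esub>i\<in>{..<m}. X i (p i)) = (\<Otimes>\<^bsub>R\<^esub>i\<in>{..<m}. Y i (p i))" if "p permutes {..<m}" for p
    using that assms(2,3) permutes_in_image[OF that] by (intro finprod_cong') auto
  show ?thesis unfolding mat_det_def
    by (intro finsum_cong') (auto simp: e c)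
qed

lemma mat_det_closed:
  assumes "cring R" "\<And>i j. i < m \<Longrightarrow> j < m \<Longrightarrow> X i j \<in> carrier R"
  shows "mat_det R m X \<in> carrier R"
proof -
  interpret cring R by fact
  have c: "(\<Otimes>\<^bsub>R\<^esub>i\<in>{..<m}. X i (p i)) \<in> carrier R" if "p permutes {..<m}" for p
    using that assms(2) permutes_in_image[OF that] by (intro finprod_closed) auto
  show ?thesis unfolding mat_det_def
    by (intro finsum_closed) (auto simp: c)
qed

text \<open>A unit determinant gives an inverse through the adjugate; the converse is
  multiplicativity of determinants. Both are applied to lifted matrices. The product of lifts of
  mutually inverse matrices need not be the identity, only its image under \<open>h\<close> is, so
  the projection comes before the comparison with the identity.\<close>

lemma det_unit_iff:
  fixes R :: "('b, 'm) ring_scheme" (structure)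
  assumes "cring R" and X: "\<And>i j. i < m \<Longrightarrow> j < m \<Longrightarrow> X i j \<in> carrier R"
  shows "mat_det R m X \<in> Units R \<longleftrightarrow> (\<exists>Y. inverse_matrix R {..<m} {..<m} X Y)"
proof -
  obtain h :: "'b cring_prod \<Rightarrow> 'b" where "surj_hom R h" using ex_surj_hom[OF assms(1)] by auto
  then interpret surj_hom R h .
  define L where "L Z = mat m m (\<lambda>(i, j). lift (Z i j))" for Z
  have L [simp]: "L Z \<in> carrier_mat m m" for Z by (simp add: L_def)
  have det: "h (det (L Z)) = mat_det R m Z" if "\<And>i j. i < m \<Longrightarrow> j < m \<Longrightarrow> Z i j \<in> carrier R" for Z
    unfolding h_det[OF L] by (rule mat_det_cong[OF assms(1)]) (auto simp: L_def that)
  have h_mult: "h ((P * Q) $$ (i, j)) = (\<Oplus>k\<in>{..<m}. h (P $$ (i, k)) \<otimes> h (Q $$ (k, j)))"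
    if "P \<in> carrier_mat m m" "Q \<in> carrier_mat m m" "i < m" "j < m" for P Q i j
    using that by (simp add: scalar_prod_def hsum mult lessThan_atLeast0)
  show ?thesis
  proof
    assume u: "mat_det R m X \<in> Units R"
    let ?u = "inv (mat_det R m X)"
    have uc: "?u \<in> carrier R" "mat_det R m X \<otimes> ?u = \<one>" "?u \<otimes> mat_det R m X = \<one>" using u by auto
    have A: "adj_mat (L X) \<in> carrier_mat m m" "L X * adj_mat (L X) = det (L X) \<cdot>\<^sub>m 1\<^sub>m m"
      "adj_mat (L X) * L X = det (L X) \<cdot>\<^sub>m 1\<^sub>m m" using adj_mat[OF L] by auto
    \<comment> \<open>The determinant of the lift need not be invertible, so the division by it
      happens in \<open>R\<close>, after projecting the adjugate.\<close>
    define Y where "Y i j = ?u \<otimes> h (adj_mat (L X) $$ (i, j))" for i j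
    have Yc: "Y i j \<in> carrier R" for i j using uc by (simp add: Y_def)
    have e: "h ((det (L X) \<cdot>\<^sub>m 1\<^sub>m m) $$ (i, j)) = (if i = j then mat_det R m X else \<zero>)" if "i < m" "j < m" for i j
      using that mat_det_closed[OF assms(1) X] by (auto simp: mult det X)
    have 1: "(\<Oplus>k\<in>{..<m}. X i k \<otimes> Y k j) = (if i = j then \<one> else \<zero>)" if ij: "i < m" "j < m" for i j
    proof -
      have "(\<Oplus>k\<in>{..<m}. X i k \<otimes> Y k j) = (\<Oplus>k\<in>{..<m}. ?u \<otimes> (h (L X $$ (i, k)) \<otimes> h (adj_mat (L X) $$ (k, j))))"
        using ij by (intro finsum_cong') (auto simp: Y_def L_def X uc m_lcomm)
      also have "\<dots> = ?u \<otimes> h ((L X * adj_mat (L X)) $$ (i, j))"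
        using uc by (simp add: h_mult[OF L A(1) ij] finsum_rdistr)
      also have "\<dots> = (if i = j then \<one> else \<zero>)" using A(2) e[OF ij] uc by simp
      finally show ?thesis .
    qed
    have 2: "(\<Oplus>k\<in>{..<m}. Y i k \<otimes> X k j) = (if i = j then \<one> else \<zero>)" if ij: "i < m" "j < m" for i j
    proof -
      have "(\<Oplus>k\<in>{..<m}. Y i k \<otimes> X k j) = (\<Oplus>k\<in>{..<m}. ?u \<otimes> (h (adj_mat (L X) $$ (i, k)) \<otimes> h (L X $$ (k, j))))"
        using ij by (intro finsum_cong') (auto simp: Y_def L_def X uc m_assoc)
      also have "\<dots> = ?u \<otimes> h ((adj_mat (L X) * L X) $$ (i, j))"
        using uc by (simp add: h_mult[OF A(1) L ij] finsum_rdistr)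
      also have "\<dots> = (if i = j then \<one> else \<zero>)" using A(3) e[OF ij] uc by simp
      finally show ?thesis .
    qed
    show "\<exists>Y. inverse_matrix R {..<m} {..<m} X Y"
      unfolding inverse_matrix_def using 1 2 X Yc by (intro exI[of _ Y]) auto
  next
    assume "\<exists>Y. inverse_matrix R {..<m} {..<m} X Y"
    then obtain Y where Y': "inverse_matrix R {..<m} {..<m} X Y" by blast
    have Y: "\<And>i j. i < m \<Longrightarrow> j < m \<Longrightarrow> Y i j \<in> carrier R"
       "\<And>i j. i < m \<Longrightarrow> j < m \<Longrightarrow> (\<Oplus>k\<in>{..<m}. X i k \<otimes> Y k j) = (if i = j then \<one> else \<zero>)"
      using Y' unfolding inverse_matrix_def by auto
    have "mat_det R m X \<otimes> mat_det R m Y = h (det (L X * L Y))"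
      by (simp add: det_mult[of _ m] mult det X Y)
    also have "\<dots> = mat_det R m (\<lambda>i j. h ((L X * L Y) $$ (i, j)))" by (rule h_det) (simp add: mult_carrier_mat[of _ m m])
    also have "\<dots> = mat_det R m (\<lambda>i j. h ((1\<^sub>m m :: 'b cring_prod mat) $$ (i, j)))"
    proof (rule mat_det_cong[OF assms(1)])
      fix i j assume ij: "i < m" "j < m"
      have "h ((L X * L Y) $$ (i, j)) = (\<Oplus>k\<in>{..<m}. X i k \<otimes> Y k j)"
        unfolding h_mult[OF L L ij] using ij by (intro finsum_cong') (auto simp: L_def X Y)
      then show "h ((L X * L Y) $$ (i, j)) = h ((1\<^sub>m m :: 'b cring_prod mat) $$ (i, j))" using ij Y by simp
    qed simp
    also have "\<dots> = h (det (1\<^sub>m m :: 'b cring_prod mat))" by (rule h_det[symmetric]) simp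
    finally have "mat_det R m X \<otimes> mat_det R m Y = \<one>" by simp
    then show "mat_det R m X \<in> Units R"
      using mat_det_closed[OF assms(1) X] mat_det_closed[OF assms(1) Y(1)]
      unfolding Units_def by (auto simp: m_comm intro!: bexI[of _ "mat_det R m Y"])
  qed
qed

section \<open>Polynomial rings\<close>

text \<open>The first summand of a decomposition of \<open>m\<close> is bounded by \<open>m\<close>
  in each variable, and it determines the second by cancellation.\<close>

lemma finite_sum_pairs: "finite {s :: ('v \<Rightarrow>\<^sub>0 nat) \<times> ('v \<Rightarrow>\<^sub>0 nat). fst s + snd s = m}"
proof -
  have "finite {f :: 'v \<Rightarrow> nat. \<forall>v. (v \<in> Poly_Mapping.keys m \<longrightarrow> f v \<in> {..Poly_Mapping.lookup m v}) \<and> (v \<notin> Poly_Mapping.keys m \<longrightarrow> f v = 0)}" (is "finite ?F")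
    by (rule finite_subset[OF _ finite_set_of_finite_funs[of "Poly_Mapping.keys m" "\<Union>v\<in>Poly_Mapping.keys m. {..Poly_Mapping.lookup m v}" 0]]) auto
  moreover have "Poly_Mapping.lookup ` fst ` {s. fst s + snd s = m} \<subseteq> ?F"
    by (auto simp: lookup_add in_keys_iff)
  ultimately have "finite (Poly_Mapping.lookup ` fst ` {s :: ('v \<Rightarrow>\<^sub>0 nat) \<times> _. fst s + snd s = m})"
    using finite_subset by blast
  then have "finite (fst ` {s :: ('v \<Rightarrow>\<^sub>0 nat) \<times> _. fst s + snd s = m})"
    by (rule finite_imageD) (rule inj_onI, simp only: poly_mapping.lookup_inject)
  then show ?thesis
    by (rule finite_imageD) (rule inj_onI, metis (mono_tags, lifting) add_left_cancel mem_Collect_eq prod_eqI)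
qed

lemma poly_mapping_expand: "P = (\<Sum>a\<in>Poly_Mapping.keys P. Poly_Mapping.single a (Poly_Mapping.lookup P a))"
  by (rule poly_mapping_eqI) (auto simp: lookup_sum lookup_single when_def in_keys_iff)

text \<open>Expanding both factors into monomials gives a sum over pairs of keys; filtering by the
  total exponent and adding vanishing terms produces the convolution used in
  \<open>mpoly_ring\<close>.\<close>

lemma lookup_times:
  fixes P Q :: "('v \<Rightarrow>\<^sub>0 nat) \<Rightarrow>\<^sub>0 'c::comm_ring_1"
  shows "Poly_Mapping.lookup (P * Q) m = (\<Sum>s\<in>{s. fst s + snd s = m}. Poly_Mapping.lookup P (fst s) * Poly_Mapping.lookup Q (snd s))"
proof -
  let ?K = "Poly_Mapping.keys P" and ?L = "Poly_Mapping.keys Q"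
  have "P * Q = (\<Sum>a\<in>?K. \<Sum>b\<in>?L. Poly_Mapping.single (a + b) (Poly_Mapping.lookup P a * Poly_Mapping.lookup Q b))"
    by (subst (1) poly_mapping_expand[of P], subst (1) poly_mapping_expand[of Q])
       (simp add: sum_product mult_single)
  then have "Poly_Mapping.lookup (P * Q) m = (\<Sum>s\<in>?K \<times> ?L. if fst s + snd s = m then Poly_Mapping.lookup P (fst s) * Poly_Mapping.lookup Q (snd s) else 0)"
    by (simp add: lookup_sum lookup_single when_def sum.cartesian_product case_prod_beta)
  also have "\<dots> = (\<Sum>s\<in>{s \<in> ?K \<times> ?L. fst s + snd s = m}. Poly_Mapping.lookup P (fst s) * Poly_Mapping.lookup Q (snd s))"
    by (rule sum.inter_filter[symmetric]) simp
  also have "\<dots> = (\<Sum>s\<in>{s. fst s + snd s = m}. Poly_Mapping.lookup P (fst s) * Poly_Mapping.lookup Q (snd s))"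
    by (rule sum.mono_neutral_left) (auto simp: finite_sum_pairs in_keys_iff)
  finally show ?thesis .
qed

text \<open>The value at \<open>p\<close> of the linear functional that sends x^a to
  \<open>g a\<close>. For \<open>g\<close> a column of a table it reads off a coordinate; for
  multiplicative \<open>g\<close> it is evaluation of polynomials.\<close>

definition lin_ev :: "('a, 'm) ring_scheme \<Rightarrow> ('e \<Rightarrow> 'a) \<Rightarrow> ('e \<Rightarrow> 'a) \<Rightarrow> 'a" where
  "lin_ev R p g = (\<Oplus>\<^bsub>R\<^esub>a\<in>{a. p a \<noteq> \<zero>\<^bsub>R\<^esub>}. p a \<otimes>\<^bsub>R\<^esub> g a)"

lemma (in cring) lin_ev_superset:
  assumes "finite S" "{a. p a \<noteq> \<zero>} \<subseteq> S" "\<And>a. p a \<in> carrier R" "\<And>a. g a \<in> carrier R"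
  shows "lin_ev R p g = (\<Oplus>a\<in>S. p a \<otimes> g a)"
  unfolding lin_ev_def using assms
  by (intro add.finprod_mono_neutral_cong_left) auto

definition mterm :: "('a, 'm) ring_scheme \<Rightarrow> 'a \<Rightarrow> ('v \<Rightarrow>\<^sub>0 nat) \<Rightarrow> ('v \<Rightarrow>\<^sub>0 nat) \<Rightarrow> 'a" where
  "mterm R c a = (\<lambda>m. if m = a then c else \<zero>\<^bsub>R\<^esub>)"

lemma mpoly_carrier: "p \<in> carrier (mpoly_ring R V) \<longleftrightarrow> (\<forall>m. p m \<in> carrier R) \<and> finite {m. p m \<noteq> \<zero>\<^bsub>R\<^esub>} \<and>
                   (\<forall>m. p m \<noteq> \<zero>\<^bsub>R\<^esub> \<longrightarrow> Poly_Mapping.keys m \<subseteq> V)"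
  by (simp add: mpoly_ring_def)

lemma mpoly_add: "(p \<oplus>\<^bsub>mpoly_ring R V\<^esub> q) = (\<lambda>m. p m \<oplus>\<^bsub>R\<^esub> q m)"
  and mpoly_zero: "\<zero>\<^bsub>mpoly_ring R V\<^esub> = (\<lambda>m. \<zero>\<^bsub>R\<^esub>)"
  and mpoly_one: "\<one>\<^bsub>mpoly_ring R V\<^esub> = (\<lambda>m. if m = 0 then \<one>\<^bsub>R\<^esub> else \<zero>\<^bsub>R\<^esub>)"
  and mpoly_mult: "(p \<otimes>\<^bsub>mpoly_ring R V\<^esub> q) = (\<lambda>m. \<Oplus>\<^bsub>R\<^esub>s\<in>{s. fst s + snd s = m}. p (fst s) \<otimes>\<^bsub>R\<^esub> q (snd s))"
  by (simp_all add: mpoly_ring_def)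

section \<open>Transport of polynomial arithmetic to coefficient functions\<close>

context surj_hom begin

definition down :: "('v \<Rightarrow>\<^sub>0 'c) \<Rightarrow> 'v \<Rightarrow> 'b" where "down P = (\<lambda>m. h (Poly_Mapping.lookup P m))"

definition up :: "('v \<Rightarrow> 'b) \<Rightarrow> 'v \<Rightarrow>\<^sub>0 'c" where "up p = Abs_poly_mapping (\<lambda>m. lift (p m))"

lemma lookup_up: "finite {m. p m \<noteq> \<zero>} \<Longrightarrow> Poly_Mapping.lookup (up p) = (\<lambda>m. lift (p m))"
  unfolding up_def
  by (rule Abs_poly_mapping_inverse, simp, erule finite_subset[rotated]) auto

lemma down_up: "p \<in> carrier (mpoly_ring R V) \<Longrightarrow> down (up p) = p"
  by (auto simp: down_def lookup_up mpoly_carrier)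

lemma keys_up: "p \<in> carrier (mpoly_ring R V) \<Longrightarrow> m \<in> Poly_Mapping.keys (up p) \<Longrightarrow> p m \<noteq> \<zero>"
  by (auto simp: in_keys_iff lookup_up mpoly_carrier)

lemma supp_down: "{m. down P m \<noteq> \<zero>} \<subseteq> Poly_Mapping.keys P"
  by (auto simp: down_def in_keys_iff)

lemma down_carrier:
  "(\<And>m. m \<in> Poly_Mapping.keys P \<Longrightarrow> Poly_Mapping.keys m \<subseteq> V) \<Longrightarrow> down P \<in> carrier (mpoly_ring R V)"
  using supp_down[of P] finite_subset[OF supp_down finite_keys, of P]
  by (auto simp: mpoly_carrier) (auto simp: down_def)

lemma down_add: "down (P + Q) = down P \<oplus>\<^bsub>mpoly_ring R V\<^esub> down Q"
  and down_mult: "down (P * Q) = down P \<otimes>\<^bsub>mpoly_ring R V\<^esub> down Q"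
  and down_zero: "down 0 = \<zero>\<^bsub>mpoly_ring R V\<^esub>"
  and down_one: "down 1 = \<one>\<^bsub>mpoly_ring R V\<^esub>"
  by (auto simp: down_def lookup_add add mult mpoly_add mpoly_mult mpoly_zero mpoly_one lookup_times hsum
      lookup_one when_def fun_eq_iff)

text \<open>The ring laws descend along \<open>down\<close>, which respects the operations and
  reaches every polynomial. Membership in the carrier does not come for free, as the variables are
  confined to \<open>V\<close>; closure and negatives are checked on supports.\<close>

lemma mpoly_cring: "cring (mpoly_ring R V)" (is "cring ?P")
proof -
  note d = down_add[of _ _ V, symmetric] down_mult[of _ _ V, symmetric] down_zero[of V, symmetric] down_one[of V, symmetric]
  have mult_closed: "p \<otimes>\<^bsub>?P\<^esub> q \<in> carrier ?P" if "p \<in> carrier ?P" "q \<in> carrier ?P" for p q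
  proof -
    have "down (up p * up q) \<in> carrier ?P"
    proof (rule down_carrier)
      fix m assume "m \<in> Poly_Mapping.keys (up p * up q)"
      then obtain a b where "m = a + b" "a \<in> Poly_Mapping.keys (up p)" "b \<in> Poly_Mapping.keys (up q)"
        using keys_mult[of "up p" "up q"] by auto
      then show "Poly_Mapping.keys m \<subseteq> V"
        using keys_up[OF that(1)] keys_up[OF that(2)] that Poly_Mapping.keys_add[of a b] unfolding mpoly_carrier by blast
    qed
    then show ?thesis using that by (simp add: down_mult[of _ _ V] down_up)
  qed
  have add_closed: "p \<oplus>\<^bsub>?P\<^esub> q \<in> carrier ?P" if "p \<in> carrier ?P" "q \<in> carrier ?P" for p q
  proof -
    have "{m. p m \<oplus> q m \<noteq> \<zero>} \<subseteq> {m. p m \<noteq> \<zero>} \<union> {m. q m \<noteq> \<zero>}" by auto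
    moreover from this have "finite {m. p m \<oplus> q m \<noteq> \<zero>}"
      by (rule finite_subset) (use that in \<open>auto simp: mpoly_carrier\<close>)
    ultimately show ?thesis using that by (auto simp: mpoly_carrier mpoly_add subset_iff)
  qed
  have *: "\<exists>P. p = down P" if "p \<in> carrier ?P" for p using down_up[OF that] by metis
  show ?thesis
  proof (intro cringI abelian_groupI comm_monoidI)
    show "\<zero>\<^bsub>?P\<^esub> \<in> carrier ?P" by (simp add: mpoly_carrier mpoly_zero)
    show "\<one>\<^bsub>?P\<^esub> \<in> carrier ?P" by (simp add: mpoly_carrier mpoly_one)
    fix x y z assume x: "x \<in> carrier ?P" and y: "y \<in> carrier ?P" and z: "z \<in> carrier ?P"
    then obtain X Y Z where [simp]: "x = down X" "y = down Y" "z = down Z" using * by blast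
    show "x \<oplus>\<^bsub>?P\<^esub> y \<oplus>\<^bsub>?P\<^esub> z = x \<oplus>\<^bsub>?P\<^esub> (y \<oplus>\<^bsub>?P\<^esub> z)" by (simp add: d add.assoc)
    show "x \<otimes>\<^bsub>?P\<^esub> y \<otimes>\<^bsub>?P\<^esub> z = x \<otimes>\<^bsub>?P\<^esub> (y \<otimes>\<^bsub>?P\<^esub> z)" by (simp add: d mult.assoc)
    show "(x \<oplus>\<^bsub>?P\<^esub> y) \<otimes>\<^bsub>?P\<^esub> z = x \<otimes>\<^bsub>?P\<^esub> z \<oplus>\<^bsub>?P\<^esub> y \<otimes>\<^bsub>?P\<^esub> z" by (simp add: d distrib_right)
  next
    fix x y assume x: "x \<in> carrier ?P" and y: "y \<in> carrier ?P"
    then obtain X Y where [simp]: "x = down X" "y = down Y" using * by blast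
    show "x \<oplus>\<^bsub>?P\<^esub> y = y \<oplus>\<^bsub>?P\<^esub> x" by (simp add: d add.commute)
    show "x \<otimes>\<^bsub>?P\<^esub> y = y \<otimes>\<^bsub>?P\<^esub> x" by (simp add: d mult.commute)
  next
    fix x assume x: "x \<in> carrier ?P"
    then obtain X where [simp]: "x = down X" using * by blast
    show "\<zero>\<^bsub>?P\<^esub> \<oplus>\<^bsub>?P\<^esub> x = x" by (simp add: d)
    show "\<one>\<^bsub>?P\<^esub> \<otimes>\<^bsub>?P\<^esub> x = x" by (simp add: d)
    show "\<exists>y\<in>carrier ?P. y \<oplus>\<^bsub>?P\<^esub> x = \<zero>\<^bsub>?P\<^esub>"
    proof (intro bexI[of _ "\<lambda>m. \<ominus> x m"])
      have "{m. \<ominus> x m \<noteq> \<zero>} \<subseteq> {m. x m \<noteq> \<zero>}" by auto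
      moreover from this have "finite {m. \<ominus> x m \<noteq> \<zero>}"
        by (rule finite_subset) (use x in \<open>auto simp: mpoly_carrier\<close>)
      ultimately show "(\<lambda>m. \<ominus> x m) \<in> carrier ?P" using x by (auto simp: mpoly_carrier subset_iff)
      show "(\<lambda>m. \<ominus> x m) \<oplus>\<^bsub>?P\<^esub> x = \<zero>\<^bsub>?P\<^esub>" using x by (auto simp: mpoly_add mpoly_zero l_neg mpoly_carrier)
    qed
  qed (auto simp: mult_closed add_closed)
qed

lemma lin_ev_down:
  "lin_ev R (down P) (\<lambda>a. h (G a)) = h (\<Sum>a\<in>Poly_Mapping.keys P. Poly_Mapping.lookup P a * G a)"
  by (subst lin_ev_superset[OF _ supp_down]) (auto simp: hsum mult down_def)

end

text \<open>Both sides are the sum of P_a Q_b G(a + b) over pairs of keys. The left side groups the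
  pairs by the exponent of the product, the right side runs through one factor at a time.\<close>

lemma pair_times:
  fixes P Q :: "('v \<Rightarrow>\<^sub>0 nat) \<Rightarrow>\<^sub>0 'c::comm_ring_1"
  shows "(\<Sum>m\<in>Poly_Mapping.keys (P * Q). Poly_Mapping.lookup (P * Q) m * G m) =
    (\<Sum>a\<in>Poly_Mapping.keys P. Poly_Mapping.lookup P a * (\<Sum>b\<in>Poly_Mapping.keys Q. Poly_Mapping.lookup Q b * G (a + b)))"
proof -
  let ?K = "Poly_Mapping.keys P" and ?L = "Poly_Mapping.keys Q"
  let ?S = "(\<lambda>(a, b). a + b) ` (?K \<times> ?L)"
  have S: "finite ?S" by simp
  have "(\<Sum>m\<in>Poly_Mapping.keys (P * Q). Poly_Mapping.lookup (P * Q) m * G m) = (\<Sum>m\<in>?S. Poly_Mapping.lookup (P * Q) m * G m)"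
  proof (rule sum.mono_neutral_left)
    show "Poly_Mapping.keys (P * Q) \<subseteq> ?S" using keys_mult[of P Q] by (auto simp del: keys_mult)
  qed (auto simp: in_keys_iff)
  also have "\<dots> = (\<Sum>m\<in>?S. \<Sum>s\<in>{s. s \<in> ?K \<times> ?L \<and> fst s + snd s = m}. Poly_Mapping.lookup P (fst s) * Poly_Mapping.lookup Q (snd s) * G (fst s + snd s))"
  proof (rule sum.cong[OF refl])
    fix m
    have "Poly_Mapping.lookup (P * Q) m = (\<Sum>s\<in>{s. s \<in> ?K \<times> ?L \<and> fst s + snd s = m}. Poly_Mapping.lookup P (fst s) * Poly_Mapping.lookup Q (snd s))"
      unfolding lookup_times by (rule sum.mono_neutral_right) (auto simp: finite_sum_pairs in_keys_iff)
    then show "Poly_Mapping.lookup (P * Q) m * G m =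
      (\<Sum>s\<in>{s. s \<in> ?K \<times> ?L \<and> fst s + snd s = m}. Poly_Mapping.lookup P (fst s) * Poly_Mapping.lookup Q (snd s) * G (fst s + snd s))"
      by (simp add: sum_distrib_right)
  qed
  also have "\<dots> = (\<Sum>s\<in>?K \<times> ?L. Poly_Mapping.lookup P (fst s) * Poly_Mapping.lookup Q (snd s) * G (fst s + snd s))"
    by (rule sum.group) auto
  finally show ?thesis by (simp add: sum.cartesian_product case_prod_beta sum_distrib_left mult.assoc)
qed

lemma mpoly_cring: "cring R \<Longrightarrow> cring (mpoly_ring R V)"
  using ex_surj_hom surj_hom.mpoly_cring by blast

text \<open>Projected form of \<open>pair_times\<close>. It underlies both the ideal property of
  \<open>table_ideal\<close> and the multiplicativity of evaluation in \<open>mpoly_eval\<close>: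
  each follows from the behaviour of \<open>g\<close> under translation of exponents.\<close>

lemma lin_ev_mult:
  fixes R :: "('b, 'm) ring_scheme"
  assumes "cring R" "p \<in> carrier (mpoly_ring R V)" "q \<in> carrier (mpoly_ring R V)" and g: "\<And>a. g a \<in> carrier R"
  shows "lin_ev R (p \<otimes>\<^bsub>mpoly_ring R V\<^esub> q) g = lin_ev R p (\<lambda>a. lin_ev R q (\<lambda>b. g (a + b)))"
proof -
  obtain h :: "'b cring_prod \<Rightarrow> 'b" where "surj_hom R h" using ex_surj_hom[OF assms(1)] by auto
  then interpret surj_hom R h .
  define G where "G a = lift (g a)" for a
  have g: "g = (\<lambda>a. h (G a))" by (simp add: G_def g)
  have p: "p = down (up p)" "q = down (up q)" using assms by (simp_all add: down_up)
  show ?thesis unfolding g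
    by (subst (1 2) p(1), subst (1 2) p(2))
       (simp add: down_mult[symmetric] lin_ev_down pair_times)
qed

section \<open>Linear functionals on polynomials and induction over terms\<close>

context
  fixes R :: "('b, 'm) ring_scheme" (structure)
  assumes R: "cring R"
begin

interpretation cring R by (rule R)

lemma lin_ev_closed:
  "(\<And>a. p a \<in> carrier R) \<Longrightarrow> (\<And>a. g a \<in> carrier R) \<Longrightarrow> lin_ev R p g \<in> carrier R"
  unfolding lin_ev_def by (intro finsum_closed) auto

lemma lin_ev_add:
  assumes "p \<in> carrier (mpoly_ring R V)" "q \<in> carrier (mpoly_ring R V)" "\<And>a. g a \<in> carrier R"
  shows "lin_ev R (p \<oplus>\<^bsub>mpoly_ring R V\<^esub> q) g = lin_ev R p g \<oplus> lin_ev R q g"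
proof -
  let ?S = "{a. p a \<noteq> \<zero>} \<union> {a. q a \<noteq> \<zero>}"
  have S: "finite ?S" "{a. (p \<oplus>\<^bsub>mpoly_ring R V\<^esub> q) a \<noteq> \<zero>} \<subseteq> ?S"
    using assms by (auto simp: mpoly_carrier mpoly_add)
  have c: "p a \<in> carrier R" "q a \<in> carrier R" for a using assms by (auto simp: mpoly_carrier)
  have *: "(\<Oplus>a\<in>?S. p a \<otimes> g a \<oplus> q a \<otimes> g a) = (\<Oplus>a\<in>?S. p a \<otimes> g a) \<oplus> (\<Oplus>a\<in>?S. q a \<otimes> g a)"
    by (rule finsum_addf) (auto simp: c assms)
  show ?thesis
    by (subst (1 2 3) lin_ev_superset[where S = ?S])
       (use S assms c in \<open>auto simp: mpoly_add l_distr * simp del: finsum_addf\<close>)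
qed

lemma lin_ev_mterm:
  assumes "c \<in> carrier R" "\<And>a. g a \<in> carrier R"
  shows "lin_ev R (mterm R c a) g = c \<otimes> g a"
  by (subst lin_ev_superset[where S = "{a}"]) (auto simp: mterm_def assms)

lemma lin_ev_cong:
  assumes "p \<in> carrier (mpoly_ring R V)" "\<And>a. g a \<in> carrier R"
    and "\<And>a. Poly_Mapping.keys a \<subseteq> V \<Longrightarrow> f a = g a"
  shows "lin_ev R p f = lin_ev R p g"
  unfolding lin_ev_def using assms by (intro finsum_cong') (auto simp: mpoly_carrier)

lemma mterm_closed: "c \<in> carrier R \<Longrightarrow> Poly_Mapping.keys a \<subseteq> V \<Longrightarrow> mterm R c a \<in> carrier (mpoly_ring R V)"
  by (auto simp: mpoly_carrier mterm_def)

lemma mterm_mult: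
  assumes "c \<in> carrier R" "d \<in> carrier R"
  shows "mterm R c a \<otimes>\<^bsub>mpoly_ring R V\<^esub> mterm R d b = mterm R (c \<otimes> d) (a + b)"
proof
  fix m
  have "(mterm R c a \<otimes>\<^bsub>mpoly_ring R V\<^esub> mterm R d b) m =
    (\<Oplus>s\<in>{s. fst s + snd s = m}. if (a, b) = s then c \<otimes> d else \<zero>)"
    unfolding mpoly_mult mterm_def using assms by (intro finsum_cong') auto
  also have "\<dots> = mterm R (c \<otimes> d) (a + b) m"
  proof (cases "a + b = m")
    case True
    then show ?thesis using assms finsum_singleton[of "(a, b)" "{s. fst s + snd s = m}" "\<lambda>_. c \<otimes> d"]
      by (simp add: finite_sum_pairs mterm_def)
  next
    case False
    then have "(\<Oplus>s\<in>{s. fst s + snd s = m}. if (a, b) = s then c \<otimes> d else \<zero>) = (\<Oplus>s\<in>{s. fst s + snd s = m}. \<zero>)"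
      by (intro finsum_cong') auto
    then show ?thesis using False by (auto simp: mterm_def)
  qed
  finally show "(mterm R c a \<otimes>\<^bsub>mpoly_ring R V\<^esub> mterm R d b) m = mterm R (c \<otimes> d) (a + b) m" .
qed

lemma mpoly_add_induct [consumes 2, case_names zero add]:
  assumes "p \<in> carrier (mpoly_ring R V)"
    and "Q (\<zero>\<^bsub>mpoly_ring R V\<^esub>)"
    and step: "\<And>c a q. c \<in> carrier R \<Longrightarrow> Poly_Mapping.keys a \<subseteq> V \<Longrightarrow> q \<in> carrier (mpoly_ring R V) \<Longrightarrow> Q q
      \<Longrightarrow> Q (mterm R c a \<oplus>\<^bsub>mpoly_ring R V\<^esub> q)"
  shows "Q p"
proof -
  have "finite {m. p m \<noteq> \<zero>}" using assms by (simp add: mpoly_carrier)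
  then show ?thesis using assms(1)
  proof (induction "{m. p m \<noteq> \<zero>}" arbitrary: p rule: finite_induct)
    case empty
    then have "p = \<zero>\<^bsub>mpoly_ring R V\<^esub>" by (auto simp: mpoly_zero)
    then show ?case using assms by simp
  next
    case (insert a F)
    define q where "q = p(a := \<zero>)"
    have F: "F = {m. q m \<noteq> \<zero>}" using insert(2,4) by (auto simp: q_def)
    have q: "q \<in> carrier (mpoly_ring R V)" using insert(1,5) F by (auto simp: mpoly_carrier q_def)
    have "p = mterm R (p a) a \<oplus>\<^bsub>mpoly_ring R V\<^esub> q"
      using insert(5) by (auto simp: mpoly_add mterm_def q_def mpoly_carrier)
    moreover have "p a \<in> carrier R" "Poly_Mapping.keys a \<subseteq> V" using insert(4,5) by (auto simp: mpoly_carrier)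
    ultimately show ?case using step[OF _ _ q insert(3)[OF F q]] by metis
  qed
qed

end

lemma keys_add_nat: "Poly_Mapping.keys (a + b :: 'v \<Rightarrow>\<^sub>0 nat) = Poly_Mapping.keys a \<union> Poly_Mapping.keys b"
  by (auto simp: in_keys_iff lookup_add)

text \<open>Induction on the total degree: one variable of the support is removed at a time, so all
  intermediate exponents keep their support in \<open>V\<close>.\<close>

lemma monom_induct [consumes 1, case_names zero add]:
  fixes m :: "'v \<Rightarrow>\<^sub>0 nat"
  assumes "Poly_Mapping.keys m \<subseteq> V" "Q 0"
    and step: "\<And>m v. Poly_Mapping.keys m \<subseteq> V \<Longrightarrow> v \<in> V \<Longrightarrow> Q m \<Longrightarrow> Q (m + Poly_Mapping.single v 1)"
  shows "Q m"
  using assms(1)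
proof (induction "\<Sum>v\<in>Poly_Mapping.keys m. Poly_Mapping.lookup m v" arbitrary: m rule: less_induct)
  case less
  show ?case
  proof (cases "m = 0")
    case False
    then obtain v where v: "v \<in> Poly_Mapping.keys m" by (metis all_not_in_conv keys_eq_empty)
    define m' where "m' = m - Poly_Mapping.single v 1"
    have m: "m = m' + Poly_Mapping.single v 1"
      using v by (intro poly_mapping_eqI) (auto simp: m'_def lookup_add lookup_minus lookup_single when_def in_keys_iff)
    have k: "Poly_Mapping.keys m' \<subseteq> Poly_Mapping.keys m" unfolding m keys_add_nat by auto
    have "(\<Sum>v\<in>Poly_Mapping.keys m'. Poly_Mapping.lookup m' v) = (\<Sum>v\<in>Poly_Mapping.keys m. Poly_Mapping.lookup m' v)"
      using k by (intro sum.mono_neutral_left) (auto simp: in_keys_iff)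
    also have "\<dots> < (\<Sum>v\<in>Poly_Mapping.keys m. Poly_Mapping.lookup m v)"
      using v by (intro sum_strict_mono_ex1) (auto simp: m'_def lookup_minus lookup_single when_def in_keys_iff intro!: bexI[of _ v])
    finally have "Q m'" using less k by blast
    then show ?thesis using step[of m' v] m v k less(2) by auto
  qed (use assms in simp)
qed

section \<open>Matrices and bases\<close>

lemma (in abelian_monoid) finsum_swap:
  assumes "finite I" "finite J" "\<And>i j. i \<in> I \<Longrightarrow> j \<in> J \<Longrightarrow> f i j \<in> carrier G"
  shows "(\<Oplus>i\<in>I. \<Oplus>j\<in>J. f i j) = (\<Oplus>j\<in>J. \<Oplus>i\<in>I. f i j)"
  using assms(1,3)
proof (induction I rule: finite_induct)
  case (insert x F)
  have "(\<Oplus>j\<in>J. \<Oplus>i\<in>insert x F. f i j) = (\<Oplus>j\<in>J. f x j \<oplus> (\<Oplus>i\<in>F. f i j))"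
    using insert by (intro finsum_cong') (auto intro!: finsum_insert)
  also have "\<dots> = (\<Oplus>j\<in>J. f x j) \<oplus> (\<Oplus>j\<in>J. \<Oplus>i\<in>F. f i j)"
    using insert by (intro finsum_addf) auto
  finally show ?case using insert by (simp add: Pi_def)
qed simp

text \<open>Interchange of two finite sums. Read as (v X) y = v (X y) for a row, a matrix and a
  column, it carries most of the matrix computations below, with unordered index sets.\<close>

lemma (in semiring) vec_assoc:
  assumes "finite I" "finite J" "\<And>i. i \<in> I \<Longrightarrow> v i \<in> carrier R"
    "\<And>i j. i \<in> I \<Longrightarrow> j \<in> J \<Longrightarrow> X i j \<in> carrier R" "\<And>j. j \<in> J \<Longrightarrow> y j \<in> carrier R"
  shows "(\<Oplus>j\<in>J. (\<Oplus>i\<in>I. v i \<otimes> X i j) \<otimes> y j) = (\<Oplus>i\<in>I. v i \<otimes> (\<Oplus>j\<in>J. X i j \<otimes> y j))"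
proof -
  have "(\<Oplus>j\<in>J. (\<Oplus>i\<in>I. v i \<otimes> X i j) \<otimes> y j) = (\<Oplus>j\<in>J. \<Oplus>i\<in>I. v i \<otimes> (X i j \<otimes> y j))"
    using assms by (intro finsum_cong') (auto simp: finsum_ldistr m_assoc intro!: finsum_cong')
  also have "\<dots> = (\<Oplus>i\<in>I. \<Oplus>j\<in>J. v i \<otimes> (X i j \<otimes> y j))"
    using assms by (intro finsum_swap) auto
  also have "\<dots> = (\<Oplus>i\<in>I. v i \<otimes> (\<Oplus>j\<in>J. X i j \<otimes> y j))"
    using assms by (intro finsum_cong') (auto simp: finsum_rdistr)
  finally show ?thesis .
qed

lemma (in semiring) sum_delta:
  assumes "finite I" "\<And>i. i \<in> I \<Longrightarrow> v i \<in> carrier R" "j \<in> I"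
  shows "(\<Oplus>i\<in>I. v i \<otimes> (if i = j then \<one> else \<zero>)) = v j"
    and "(\<Oplus>i\<in>I. (if j = i then \<one> else \<zero>) \<otimes> v i) = v j"
proof -
  have "(\<Oplus>i\<in>I. v i \<otimes> (if i = j then \<one> else \<zero>)) = (\<Oplus>i\<in>I. if j = i then v i else \<zero>)"
    "(\<Oplus>i\<in>I. (if j = i then \<one> else \<zero>) \<otimes> v i) = (\<Oplus>i\<in>I. if j = i then v i else \<zero>)"
    using assms by (auto intro!: finsum_cong')
  then show "(\<Oplus>i\<in>I. v i \<otimes> (if i = j then \<one> else \<zero>)) = v j"
    "(\<Oplus>i\<in>I. (if j = i then \<one> else \<zero>) \<otimes> v i) = v j"
    using assms finsum_singleton[of j I v] by auto
qed

text \<open>The associativity of \<open>vec_assoc\<close> for a column of module elements, so that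
  matrices can act on a family of vectors such as a basis.\<close>

lemma (in Module.module) vec_assoc_smult:
  assumes "finite I" "finite J" "\<And>i. i \<in> I \<Longrightarrow> v i \<in> carrier R"
    "\<And>i j. i \<in> I \<Longrightarrow> j \<in> J \<Longrightarrow> X i j \<in> carrier R" "\<And>j. j \<in> J \<Longrightarrow> b j \<in> carrier M"
  shows "(\<Oplus>\<^bsub>M\<^esub>j\<in>J. (\<Oplus>i\<in>I. v i \<otimes> X i j) \<odot>\<^bsub>M\<^esub> b j) = (\<Oplus>\<^bsub>M\<^esub>i\<in>I. v i \<odot>\<^bsub>M\<^esub> (\<Oplus>\<^bsub>M\<^esub>j\<in>J. X i j \<odot>\<^bsub>M\<^esub> b j))"
proof -
  have ld: "(\<Oplus>i\<in>I. f i) \<odot>\<^bsub>M\<^esub> x = (\<Oplus>\<^bsub>M\<^esub>i\<in>I. f i \<odot>\<^bsub>M\<^esub> x)" if "\<And>i. i \<in> I \<Longrightarrow> f i \<in> carrier R" "x \<in> carrier M" for f x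
    using assms(1) that
  proof (induction I rule: finite_induct)
    case empty then show ?case by (simp add: smult_l_null)
  next
    case (insert a F)
    then show ?case by (simp add: Pi_def smult_l_distr)
  qed
  have rd: "a \<odot>\<^bsub>M\<^esub> (\<Oplus>\<^bsub>M\<^esub>j\<in>J. f j) = (\<Oplus>\<^bsub>M\<^esub>j\<in>J. a \<odot>\<^bsub>M\<^esub> f j)" if "\<And>j. j \<in> J \<Longrightarrow> f j \<in> carrier M" "a \<in> carrier R" for f a
    using assms(2) that
  proof (induction J rule: finite_induct)
    case empty then show ?case by (simp add: smult_r_null)
  next
    case (insert a F)
    then show ?case by (simp add: Pi_def smult_r_distr)
  qed
  have "(\<Oplus>\<^bsub>M\<^esub>j\<in>J. (\<Oplus>i\<in>I. v i \<otimes> X i j) \<odot>\<^bsub>M\<^esub> b j) = (\<Oplus>\<^bsub>M\<^esub>j\<in>J. \<Oplus>\<^bsub>M\<^esub>i\<in>I. v i \<odot>\<^bsub>M\<^esub> (X i j \<odot>\<^bsub>M\<^esub> b j))"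
    using assms by (intro M.finsum_cong') (auto simp: ld smult_assoc1 intro!: M.finsum_cong')
  also have "\<dots> = (\<Oplus>\<^bsub>M\<^esub>i\<in>I. \<Oplus>\<^bsub>M\<^esub>j\<in>J. v i \<odot>\<^bsub>M\<^esub> (X i j \<odot>\<^bsub>M\<^esub> b j))"
    using assms by (intro M.finsum_swap) auto
  also have "\<dots> = (\<Oplus>\<^bsub>M\<^esub>i\<in>I. v i \<odot>\<^bsub>M\<^esub> (\<Oplus>\<^bsub>M\<^esub>j\<in>J. X i j \<odot>\<^bsub>M\<^esub> b j))"
    using assms by (intro M.finsum_cong') (auto simp: rd)
  finally show ?thesis .
qed

lemma (in Module.module) sum_delta_smult:
  assumes "finite J" "\<And>i. i \<in> J \<Longrightarrow> b i \<in> carrier M" "j \<in> J"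
  shows "(\<Oplus>\<^bsub>M\<^esub>i\<in>J. (if j = i then \<one> else \<zero>) \<odot>\<^bsub>M\<^esub> b i) = b j"
proof -
  have "(\<Oplus>\<^bsub>M\<^esub>i\<in>J. (if j = i then \<one> else \<zero>) \<odot>\<^bsub>M\<^esub> b i) = (\<Oplus>\<^bsub>M\<^esub>i\<in>J. if j = i then b i else \<zero>\<^bsub>M\<^esub>)"
    using assms by (auto intro!: M.finsum_cong' simp: smult_l_null)
  then show ?thesis using assms M.finsum_singleton[of j J b] by auto
qed

section \<open>Coordinates and change of basis\<close>

definition coords ::
  "('r, 'm) ring_scheme \<Rightarrow> ('r, 'a, 'p) module_scheme \<Rightarrow> 'i set \<Rightarrow> ('i \<Rightarrow> 'a) \<Rightarrow> 'a \<Rightarrow> 'i \<Rightarrow> 'r" where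
  "coords R M J b v = (THE c. c \<in> J \<rightarrow>\<^sub>E carrier R \<and> v = (\<Oplus>\<^bsub>M\<^esub>j\<in>J. c j \<odot>\<^bsub>M\<^esub> b j))"

lemma is_basis_coords:
  assumes "is_basis R M J b" "v \<in> carrier M"
  shows "j \<in> J \<Longrightarrow> coords R M J b v j \<in> carrier R"
    and "v = (\<Oplus>\<^bsub>M\<^esub>j\<in>J. coords R M J b v j \<odot>\<^bsub>M\<^esub> b j)"
proof -
  have "\<exists>!c. c \<in> J \<rightarrow>\<^sub>E carrier R \<and> v = (\<Oplus>\<^bsub>M\<^esub>j\<in>J. c j \<odot>\<^bsub>M\<^esub> b j)" using assms unfolding is_basis_def by blast
  from theI'[OF this] show "j \<in> J \<Longrightarrow> coords R M J b v j \<in> carrier R"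
    "v = (\<Oplus>\<^bsub>M\<^esub>j\<in>J. coords R M J b v j \<odot>\<^bsub>M\<^esub> b j)" unfolding coords_def by (auto simp: PiE_def Pi_def)
qed

lemma ex1_uniq: "\<exists>!x. P x \<Longrightarrow> P x \<Longrightarrow> P y \<Longrightarrow> x = y"
  by blast

text \<open>Uniqueness in \<open>is_basis\<close> concerns extensional coefficient functions;
  restricting both families to \<open>J\<close> brings them into that form.\<close>

lemma (in Module.module) is_basis_unique:
  assumes "is_basis R M J b" "\<And>j. j \<in> J \<Longrightarrow> c j \<in> carrier R" "\<And>j. j \<in> J \<Longrightarrow> d j \<in> carrier R"
    and eq: "(\<Oplus>\<^bsub>M\<^esub>j\<in>J. c j \<odot>\<^bsub>M\<^esub> b j) = (\<Oplus>\<^bsub>M\<^esub>j\<in>J. d j \<odot>\<^bsub>M\<^esub> b j)" and "j \<in> J"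
  shows "c j = d j"
proof -
  have b: "b j \<in> carrier M" if "j \<in> J" for j using assms(1) that by (auto simp: is_basis_def)
  let ?v = "\<Oplus>\<^bsub>M\<^esub>j\<in>J. c j \<odot>\<^bsub>M\<^esub> b j"
  have v: "?v \<in> carrier M" by (intro M.finsum_closed) (auto simp: b assms)
  have u: "\<exists>!e. e \<in> J \<rightarrow>\<^sub>E carrier R \<and> ?v = (\<Oplus>\<^bsub>M\<^esub>j\<in>J. e j \<odot>\<^bsub>M\<^esub> b j)"
    using assms(1) v unfolding is_basis_def by blast
  have "(\<Oplus>\<^bsub>M\<^esub>j\<in>J. restrict c J j \<odot>\<^bsub>M\<^esub> b j) = ?v"
    by (intro M.finsum_cong') (auto simp: b assms)
  moreover have "(\<Oplus>\<^bsub>M\<^esub>j\<in>J. restrict d J j \<odot>\<^bsub>M\<^esub> b j) = (\<Oplus>\<^bsub>M\<^esub>j\<in>J. d j \<odot>\<^bsub>M\<^esub> b j)"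
    by (intro M.finsum_cong') (auto simp: b assms)
  ultimately have "restrict c J = restrict d J"
    using eq assms(2,3) by (intro ex1_uniq[OF u]) auto
  then show ?thesis using assms(5) by (metis restrict_apply)
qed

lemma (in Module.module) coords_unique:
  assumes "is_basis R M J b" "v \<in> carrier M" "\<And>j. j \<in> J \<Longrightarrow> c j \<in> carrier R"
    "v = (\<Oplus>\<^bsub>M\<^esub>j\<in>J. c j \<odot>\<^bsub>M\<^esub> b j)" "j \<in> J"
  shows "coords R M J b v j = c j"
  using assms is_basis_coords[OF assms(1,2)] by (intro is_basis_unique[OF assms(1)]) auto

lemma (in Module.module) is_basisI:
  assumes b: "\<And>j. j \<in> J \<Longrightarrow> b j \<in> carrier M"
    and ex: "\<And>v. v \<in> carrier M \<Longrightarrow> \<exists>c. (\<forall>j\<in>J. c j \<in> carrier R) \<and> v = (\<Oplus>\<^bsub>M\<^esub>j\<in>J. c j \<odot>\<^bsub>M\<^esub> b j)"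
    and uniq: "\<And>c d j. (\<And>j. j \<in> J \<Longrightarrow> c j \<in> carrier R) \<Longrightarrow> (\<And>j. j \<in> J \<Longrightarrow> d j \<in> carrier R) \<Longrightarrow>
      (\<Oplus>\<^bsub>M\<^esub>j\<in>J. c j \<odot>\<^bsub>M\<^esub> b j) = (\<Oplus>\<^bsub>M\<^esub>j\<in>J. d j \<odot>\<^bsub>M\<^esub> b j) \<Longrightarrow> j \<in> J \<Longrightarrow> c j = d j"
  shows "is_basis R M J b"
  unfolding is_basis_def
proof (intro conjI ballI ex_ex1I)
  show "b \<in> J \<rightarrow> carrier M" using b by auto
  fix v assume "v \<in> carrier M"
  then obtain c where c: "\<forall>j\<in>J. c j \<in> carrier R" "v = (\<Oplus>\<^bsub>M\<^esub>j\<in>J. c j \<odot>\<^bsub>M\<^esub> b j)" using ex by blast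
  have "(\<Oplus>\<^bsub>M\<^esub>j\<in>J. restrict c J j \<odot>\<^bsub>M\<^esub> b j) = v"
    unfolding c(2) using c(1) b by (intro M.finsum_cong') auto
  then show "\<exists>c. c \<in> J \<rightarrow>\<^sub>E carrier R \<and> v = (\<Oplus>\<^bsub>M\<^esub>j\<in>J. c j \<odot>\<^bsub>M\<^esub> b j)" using c by (intro exI[of _ "restrict c J"]) auto
next
  fix v c d assume c: "c \<in> J \<rightarrow>\<^sub>E carrier R \<and> v = (\<Oplus>\<^bsub>M\<^esub>j\<in>J. c j \<odot>\<^bsub>M\<^esub> b j)"
    and d: "d \<in> J \<rightarrow>\<^sub>E carrier R \<and> v = (\<Oplus>\<^bsub>M\<^esub>j\<in>J. d j \<odot>\<^bsub>M\<^esub> b j)"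
  have "c j = d j" if "j \<in> J" for j
    by (rule uniq[OF _ _ _ that]) (use c d in auto)
  with c d show "c = d" by (intro PiE_ext[of c J "\<lambda>_. carrier R" d]) auto
qed

text \<open>In matrix form b' = A b, so v = c b = (c Y) b' when \<open>Y\<close> inverts
  \<open>A\<close>, and the new coordinates are c Y. Independence of b' holds because c = (c A) Y is
  recovered from c A. Inverses are two-sided between the index sets \<open>K\<close> and
  \<open>J\<close>, so no count of basis elements enters.\<close>

lemma (in Module.module) basis_change:
  assumes fin: "finite J" "finite K" and basis: "is_basis R M J b"
    and A: "\<And>k j. k \<in> K \<Longrightarrow> j \<in> J \<Longrightarrow> A k j \<in> carrier R"
    and b': "\<And>k. k \<in> K \<Longrightarrow> b' k = (\<Oplus>\<^bsub>M\<^esub>j\<in>J. A k j \<odot>\<^bsub>M\<^esub> b j)"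
  shows "is_basis R M K b' \<longleftrightarrow> (\<exists>Y. inverse_matrix R K J A Y)"
    and "inverse_matrix R K J A Y \<Longrightarrow> v \<in> carrier M \<Longrightarrow> k \<in> K \<Longrightarrow>
      coords R M K b' v k = (\<Oplus>j\<in>J. coords R M J b v j \<otimes> Y j k)"
proof -
  have b: "b j \<in> carrier M" if "j \<in> J" for j using basis that by (auto simp: is_basis_def)
  have b'_closed: "b' k \<in> carrier M" if "k \<in> K" for k
    unfolding b'[OF that] by (intro M.finsum_closed) (auto simp: A b that)
  have comb: "(\<Oplus>\<^bsub>M\<^esub>k\<in>K. d k \<odot>\<^bsub>M\<^esub> b' k) = (\<Oplus>\<^bsub>M\<^esub>j\<in>J. (\<Oplus>k\<in>K. d k \<otimes> A k j) \<odot>\<^bsub>M\<^esub> b j)"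
    if "\<And>k. k \<in> K \<Longrightarrow> d k \<in> carrier R" for d
  proof -
    have "(\<Oplus>\<^bsub>M\<^esub>k\<in>K. d k \<odot>\<^bsub>M\<^esub> b' k) = (\<Oplus>\<^bsub>M\<^esub>k\<in>K. d k \<odot>\<^bsub>M\<^esub> (\<Oplus>\<^bsub>M\<^esub>j\<in>J. A k j \<odot>\<^bsub>M\<^esub> b j))"
      using that b'_closed b' by (intro M.finsum_cong') auto
    then show ?thesis using vec_assoc_smult[of K J d A b] fin that A b by simp
  qed
  have expand: "v = (\<Oplus>\<^bsub>M\<^esub>k\<in>K. (\<Oplus>j\<in>J. coords R M J b v j \<otimes> Y j k) \<odot>\<^bsub>M\<^esub> b' k)"
    if Y: "inverse_matrix R K J A Y" and v: "v \<in> carrier M" for Y v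
  proof -
    have Yc: "Y j k \<in> carrier R" if "j \<in> J" "k \<in> K" for j k using that Y by (auto simp: inverse_matrix_def)
    let ?c = "coords R M J b v"
    have c: "?c j \<in> carrier R" if "j \<in> J" for j using is_basis_coords[OF basis v] that by auto
    have "(\<Oplus>\<^bsub>M\<^esub>k\<in>K. (\<Oplus>j\<in>J. ?c j \<otimes> Y j k) \<odot>\<^bsub>M\<^esub> b' k)
      = (\<Oplus>\<^bsub>M\<^esub>i\<in>J. (\<Oplus>k\<in>K. (\<Oplus>j\<in>J. ?c j \<otimes> Y j k) \<otimes> A k i) \<odot>\<^bsub>M\<^esub> b i)"
      using Yc c by (intro comb) auto
    also have "\<dots> = (\<Oplus>\<^bsub>M\<^esub>i\<in>J. ?c i \<odot>\<^bsub>M\<^esub> b i)"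
    proof (intro M.finsum_cong' refl)
      fix i assume i: "i \<in> J"
      have "(\<Oplus>k\<in>K. (\<Oplus>j\<in>J. ?c j \<otimes> Y j k) \<otimes> A k i) = (\<Oplus>j\<in>J. ?c j \<otimes> (\<Oplus>k\<in>K. Y j k \<otimes> A k i))"
        using fin Yc c A i by (intro vec_assoc) auto
      also have "\<dots> = (\<Oplus>j\<in>J. ?c j \<otimes> (if j = i then \<one> else \<zero>))"
        using Y i c by (intro R.finsum_cong') (auto simp: inverse_matrix_def)
      also have "\<dots> = ?c i" using fin c i by (intro sum_delta(1)) auto
      finally show "(\<Oplus>k\<in>K. (\<Oplus>j\<in>J. ?c j \<otimes> Y j k) \<otimes> A k i) \<odot>\<^bsub>M\<^esub> b i = ?c i \<odot>\<^bsub>M\<^esub> b i" by simp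
    qed (use c b in auto)
    also have "\<dots> = v" using is_basis_coords(2)[OF basis v] by simp
    finally show ?thesis by simp
  qed
  have inv_basis: "is_basis R M K b'" if Y: "inverse_matrix R K J A Y" for Y
  proof (rule is_basisI)
    have Yc: "Y j k \<in> carrier R" if "j \<in> J" "k \<in> K" for j k using that Y by (auto simp: inverse_matrix_def)
    fix v assume v: "v \<in> carrier M"
    show "\<exists>c. (\<forall>j\<in>K. c j \<in> carrier R) \<and> v = (\<Oplus>\<^bsub>M\<^esub>j\<in>K. c j \<odot>\<^bsub>M\<^esub> b' j)"
      using expand[OF Y v] Yc is_basis_coords(1)[OF basis v]
      by (intro exI[of _ "\<lambda>k. \<Oplus>j\<in>J. coords R M J b v j \<otimes> Y j k"]) auto
  next
    have Yc: "Y j k \<in> carrier R" if "j \<in> J" "k \<in> K" for j k using that Y by (auto simp: inverse_matrix_def)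
    fix c d k assume c: "\<And>j. j \<in> K \<Longrightarrow> c j \<in> carrier R" and d: "\<And>j. j \<in> K \<Longrightarrow> d j \<in> carrier R"
      and eq: "(\<Oplus>\<^bsub>M\<^esub>j\<in>K. c j \<odot>\<^bsub>M\<^esub> b' j) = (\<Oplus>\<^bsub>M\<^esub>j\<in>K. d j \<odot>\<^bsub>M\<^esub> b' j)" and k: "k \<in> K"
    have e: "(\<Oplus>k\<in>K. c k \<otimes> A k j) = (\<Oplus>k\<in>K. d k \<otimes> A k j)" if "j \<in> J" for j
      using eq that by (intro is_basis_unique[OF basis]) (auto simp: comb c d A)
    have r: "c k = (\<Oplus>j\<in>J. (\<Oplus>k\<in>K. c k \<otimes> A k j) \<otimes> Y j k)" if c: "\<And>j. j \<in> K \<Longrightarrow> c j \<in> carrier R" for c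
    proof -
      have "(\<Oplus>j\<in>J. (\<Oplus>k\<in>K. c k \<otimes> A k j) \<otimes> Y j k) = (\<Oplus>l\<in>K. c l \<otimes> (\<Oplus>j\<in>J. A l j \<otimes> Y j k))"
        using fin k A c Yc by (intro vec_assoc) auto
      also have "\<dots> = (\<Oplus>l\<in>K. c l \<otimes> (if l = k then \<one> else \<zero>))"
        using Y k c by (intro R.finsum_cong') (auto simp: inverse_matrix_def)
      also have "\<dots> = c k" using fin c k by (intro sum_delta(1)) auto
      finally show ?thesis by simp
    qed
    have "(\<Oplus>j\<in>J. (\<Oplus>k\<in>K. c k \<otimes> A k j) \<otimes> Y j k) = (\<Oplus>j\<in>J. (\<Oplus>k\<in>K. d k \<otimes> A k j) \<otimes> Y j k)"
      using d A Yc k by (intro R.finsum_cong') (auto simp: e)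
    then show "c k = d k" using r[of c] r[of d] c d by simp
  qed (rule b'_closed)
  show "coords R M K b' v k = (\<Oplus>j\<in>J. coords R M J b v j \<otimes> Y j k)"
    if Y: "inverse_matrix R K J A Y" and v: "v \<in> carrier M" and "k \<in> K"
    using expand[OF Y v] is_basis_coords(1)[OF basis v] Y that(3)
    by (intro coords_unique[OF inv_basis[OF Y] v]) (auto simp: inverse_matrix_def intro!: R.finsum_closed)
  show "is_basis R M K b' \<longleftrightarrow> (\<exists>Y. inverse_matrix R K J A Y)"
  proof
    assume basis': "is_basis R M K b'"
    \<comment> \<open>The rows of the inverse are the coordinates of the old basis in the new one;
      expanding each basis in the other gives the two products.\<close>
    define Y where "Y j k = coords R M K b' (b j) k" for j k
    have Yc: "Y j k \<in> carrier R" if "j \<in> J" "k \<in> K" for j k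
      unfolding Y_def using is_basis_coords(1)[OF basis' b] that by auto
    have bY: "b j = (\<Oplus>\<^bsub>M\<^esub>k\<in>K. Y j k \<odot>\<^bsub>M\<^esub> b' k)" if "j \<in> J" for j
      unfolding Y_def using is_basis_coords(2)[OF basis' b] that by auto
    have "(\<Oplus>k\<in>K. Y j k \<otimes> A k i) = (if j = i then \<one> else \<zero>)" if ji: "j \<in> J" "i \<in> J" for i j
    proof (rule is_basis_unique[OF basis _ _ _ ji(2)])
      show "(\<Oplus>\<^bsub>M\<^esub>i\<in>J. (\<Oplus>k\<in>K. Y j k \<otimes> A k i) \<odot>\<^bsub>M\<^esub> b i) = (\<Oplus>\<^bsub>M\<^esub>i\<in>J. (if j = i then \<one> else \<zero>) \<odot>\<^bsub>M\<^esub> b i)"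
        using comb[of "Y j"] bY[OF ji(1)] Yc[OF ji(1)] sum_delta_smult[of J b j] fin b ji by simp
    qed (use Yc ji A in auto)
    moreover have "(\<Oplus>j\<in>J. A k j \<otimes> Y j l) = (if k = l then \<one> else \<zero>)" if kl: "k \<in> K" "l \<in> K" for k l
    proof (rule is_basis_unique[OF basis' _ _ _ kl(2)])
      have "(\<Oplus>\<^bsub>M\<^esub>l\<in>K. (\<Oplus>j\<in>J. A k j \<otimes> Y j l) \<odot>\<^bsub>M\<^esub> b' l) = (\<Oplus>\<^bsub>M\<^esub>j\<in>J. A k j \<odot>\<^bsub>M\<^esub> (\<Oplus>\<^bsub>M\<^esub>l\<in>K. Y j l \<odot>\<^bsub>M\<^esub> b' l))"
        using fin A Yc b'_closed kl by (intro vec_assoc_smult) auto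
      also have "\<dots> = b' k"
        unfolding b'[OF kl(1)] using A b kl bY by (intro M.finsum_cong') auto
      finally show "(\<Oplus>\<^bsub>M\<^esub>l\<in>K. (\<Oplus>j\<in>J. A k j \<otimes> Y j l) \<odot>\<^bsub>M\<^esub> b' l) = (\<Oplus>\<^bsub>M\<^esub>l\<in>K. (if k = l then \<one> else \<zero>) \<odot>\<^bsub>M\<^esub> b' l)"
        using sum_delta_smult[of K b' k] fin b'_closed kl by simp
    qed (use Yc kl A in auto)
    ultimately show "\<exists>Y. inverse_matrix R K J A Y"
      using A Yc unfolding inverse_matrix_def by blast
  qed (use inv_basis in blast)
qed

section \<open>Relabelled and block triangular matrices\<close>

lemma (in cring) inverse_matrix_reindex:
  assumes r: "bij_betw r I' I" and c: "bij_betw c J' J"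
  shows "(\<exists>Y. inverse_matrix R I' J' (\<lambda>i j. X (r i) (c j)) Y) \<longleftrightarrow> (\<exists>Y. inverse_matrix R I J X Y)"
proof -
  have I [simp]: "I = r ` I'" "J = c ` J'" and inj: "inj_on r I'" "inj_on c J'"
    using r c by (auto simp: bij_betw_def)
  have eq: "inverse_matrix R I' J' (\<lambda>i j. X (r i) (c j)) (\<lambda>j i. Y (c j) (r i)) \<longleftrightarrow> inverse_matrix R I J X Y" for Y
  proof -
    have "(\<Oplus>j\<in>c ` J'. X (r i) j \<otimes> Y j (r i')) = (\<Oplus>j\<in>J'. X (r i) (c j) \<otimes> Y (c j) (r i'))"
      if "\<forall>i\<in>I'. \<forall>j\<in>J'. X (r i) (c j) \<in> carrier R \<and> Y (c j) (r i) \<in> carrier R" "i \<in> I'" "i' \<in> I'" for i i'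
      using that inj by (intro finsum_reindex) auto
    moreover have "(\<Oplus>i\<in>r ` I'. Y (c j) i \<otimes> X i (c j')) = (\<Oplus>i\<in>I'. Y (c j) (r i) \<otimes> X (r i) (c j'))"
      if "\<forall>i\<in>I'. \<forall>j\<in>J'. X (r i) (c j) \<in> carrier R \<and> Y (c j) (r i) \<in> carrier R" "j \<in> J'" "j' \<in> J'" for j j'
      using that inj by (intro finsum_reindex) auto
    moreover have "r i = r i' \<longleftrightarrow> i = i'" if "i \<in> I'" "i' \<in> I'" for i i' using inj that by (auto simp: inj_on_def)
    moreover have "c i = c i' \<longleftrightarrow> i = i'" if "i \<in> J'" "i' \<in> J'" for i i' using inj that by (auto simp: inj_on_def)
    ultimately show ?thesis
      unfolding inverse_matrix_def by (simp cong: conj_cong)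
  qed
  show ?thesis
  proof
    assume "\<exists>Y. inverse_matrix R I' J' (\<lambda>i j. X (r i) (c j)) Y"
    then obtain Y where Y: "inverse_matrix R I' J' (\<lambda>i j. X (r i) (c j)) Y" ..
    \<comment> \<open>The inverse is transported along the inverse enumerations; composed again with
      \<open>c\<close> and \<open>r\<close> it agrees with \<open>Y\<close>, so that
      \<open>eq\<close> applies.\<close>
    then have "inverse_matrix R I' J' (\<lambda>i j. X (r i) (c j)) (\<lambda>j i. (\<lambda>j i. Y (inv_into J' c j) (inv_into I' r i)) (c j) (r i))"
      using Y inj unfolding inverse_matrix_def by (simp cong: finsum_cong conj_cong)
    have Z: "inverse_matrix R I J X (\<lambda>j i. Y (inv_into J' c j) (inv_into I' r i))"
      by (rule iffD1[OF eq]) fact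
    show "\<exists>Y. inverse_matrix R I J X Y" by (intro exI) (rule Z)
  qed (use eq in blast)
qed

lemma ring_hom_cringI: "cring R \<Longrightarrow> cring S \<Longrightarrow> h \<in> Ring.ring_hom R S \<Longrightarrow> ring_hom_cring R S h"
  by (intro ring_hom_cring.intro ring_hom_cring_axioms.intro)


lemma (in abelian_monoid) finsum_Int_Diff:
  assumes "finite J" "\<And>j. j \<in> J \<Longrightarrow> f j \<in> carrier G"
  shows "finsum G f J = finsum G f (J \<inter> K) \<oplus> finsum G f (J - K)"
proof -
  have "finsum G f ((J \<inter> K) \<union> (J - K)) = finsum G f (J \<inter> K) \<oplus> finsum G f (J - K)"
    using assms by (intro finsum_Un_disjoint) auto
  then show ?thesis by (simp add: Int_Diff_Un)
qed

lemma (in abelian_monoid) finsum_neutral: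
  assumes "\<And>j. j \<in> J \<Longrightarrow> f j = \<zero>"
  shows "finsum G f J = \<zero>"
  using assms by (rule add.finprod_one_eqI)

text \<open>With the indices in \<open>K \<inter> J\<close> listed first, \<open>A\<close> has the
  block form (E, 0; A1, A2), and its inverse is (E, 0; -Z A1, Z) with \<open>Z\<close> inverse to
  A2.\<close>

lemma (in cring) block_inverse:
  assumes fin: "finite K" "finite J" and A: "\<And>i j. i \<in> K \<Longrightarrow> j \<in> J \<Longrightarrow> A i j \<in> carrier R"
    and rows: "\<And>i j. i \<in> K \<inter> J \<Longrightarrow> j \<in> J \<Longrightarrow> A i j = (if i = j then \<one> else \<zero>)"
  shows "(\<exists>Y. inverse_matrix R K J A Y) \<longleftrightarrow> (\<exists>Z. inverse_matrix R (K - J) (J - K) A Z)"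
proof
  assume "\<exists>Y. inverse_matrix R K J A Y"
  then obtain Y where "inverse_matrix R K J A Y" ..
  then have Y: "\<And>i j. i \<in> K \<Longrightarrow> j \<in> J \<Longrightarrow> Y j i \<in> carrier R"
    "\<And>i i'. i \<in> K \<Longrightarrow> i' \<in> K \<Longrightarrow> (\<Oplus>j\<in>J. A i j \<otimes> Y j i') = (if i = i' then \<one> else \<zero>)"
    "\<And>j j'. j \<in> J \<Longrightarrow> j' \<in> J \<Longrightarrow> (\<Oplus>i\<in>K. Y j i \<otimes> A i j') = (if j = j' then \<one> else \<zero>)"
    unfolding inverse_matrix_def by auto
  \<comment> \<open>A unit row \<open>j\<close> of \<open>A\<close> copies row \<open>j\<close> of
    \<open>Y\<close> into the product, which is the identity; so this row of \<open>Y\<close> is a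
    unit row too.\<close>
  have Y0: "Y j i = (if j = i then \<one> else \<zero>)" if "j \<in> J \<inter> K" "i \<in> K" for i j
  proof -
    have "(if j = i then \<one> else \<zero>) = (\<Oplus>l\<in>J. A j l \<otimes> Y l i)" using Y(2) that by simp
    also have "\<dots> = (\<Oplus>l\<in>J. (if j = l then \<one> else \<zero>) \<otimes> Y l i)"
      using that Y by (intro finsum_cong') (auto simp: rows)
    also have "\<dots> = Y j i" using fin that Y by (intro sum_delta(2)) auto
    finally show ?thesis by simp
  qed
  have "(\<Oplus>j\<in>J - K. A i j \<otimes> Y j i') = (if i = i' then \<one> else \<zero>)" if "i \<in> K - J" "i' \<in> K - J" for i i'
  proof -
    have "(\<Oplus>j\<in>J - K. A i j \<otimes> Y j i') = (\<Oplus>j\<in>J. A i j \<otimes> Y j i')"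
      using that fin A Y by (intro add.finprod_mono_neutral_cong_left) (auto simp: Y0)
    then show ?thesis using Y(2) that by simp
  qed
  moreover have "(\<Oplus>i\<in>K - J. Y j i \<otimes> A i j') = (if j = j' then \<one> else \<zero>)" if "j \<in> J - K" "j' \<in> J - K" for j j'
  proof -
    have "(\<Oplus>i\<in>K - J. Y j i \<otimes> A i j') = (\<Oplus>i\<in>K. Y j i \<otimes> A i j')"
      using that fin A Y by (intro add.finprod_mono_neutral_cong_left) (auto simp: rows)
    then show ?thesis using Y(3) that by simp
  qed
  ultimately show "\<exists>Z. inverse_matrix R (K - J) (J - K) A Z"
    using A Y(1) unfolding inverse_matrix_def by (intro exI[of _ Y]) auto
next
  assume "\<exists>Z. inverse_matrix R (K - J) (J - K) A Z"
  then obtain Z where "inverse_matrix R (K - J) (J - K) A Z" ..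
  then have Z: "\<And>i j. i \<in> K - J \<Longrightarrow> j \<in> J - K \<Longrightarrow> Z j i \<in> carrier R"
    "\<And>i i'. i \<in> K - J \<Longrightarrow> i' \<in> K - J \<Longrightarrow> (\<Oplus>j\<in>J - K. A i j \<otimes> Z j i') = (if i = i' then \<one> else \<zero>)"
    "\<And>j j'. j \<in> J - K \<Longrightarrow> j' \<in> J - K \<Longrightarrow> (\<Oplus>i\<in>K - J. Z j i \<otimes> A i j') = (if j = j' then \<one> else \<zero>)"
    unfolding inverse_matrix_def by auto
  \<comment> \<open>The lower left block -Z A1 of the inverse, which cancels the contribution of A1
    to both products.\<close>
  define W where "W j i = \<ominus> (\<Oplus>l\<in>K - J. Z j l \<otimes> A l i)" for j i
  have W: "W j i \<in> carrier R" if "j \<in> J - K" "i \<in> J \<inter> K" for i j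
    unfolding W_def using that Z(1) A by (intro a_inv_closed finsum_closed) auto
  define Y where "Y j i = (if j \<in> K then if j = i then \<one> else \<zero> else if i \<in> J then W j i else Z j i)" for j i
  have Y: "Y j i \<in> carrier R" if "j \<in> J" "i \<in> K" for i j
    using that Z(1) W by (auto simp: Y_def)
  have 1: "(\<Oplus>j\<in>J. A i j \<otimes> Y j i') = (if i = i' then \<one> else \<zero>)" if i: "i \<in> K" "i' \<in> K" for i i'
  proof (cases "i \<in> J")
    case True
    have "(\<Oplus>j\<in>J. A i j \<otimes> Y j i') = (\<Oplus>j\<in>J. (if i = j then \<one> else \<zero>) \<otimes> Y j i')"
      using i True Y by (intro finsum_cong') (auto simp: rows)
    also have "\<dots> = Y i i'" using fin i True Y by (intro sum_delta(2)) auto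
    finally show ?thesis using i by (simp add: Y_def)
  next
    case False
    have s: "(\<Oplus>j\<in>J. A i j \<otimes> Y j i') = (\<Oplus>j\<in>J \<inter> K. A i j \<otimes> (if j = i' then \<one> else \<zero>)) \<oplus> (\<Oplus>j\<in>J - K. A i j \<otimes> Y j i')"
      using i fin A Y by (subst finsum_Int_Diff[where K = K]) (auto simp: Y_def intro!: arg_cong2[where f = "(\<oplus>)"] finsum_cong')
    show ?thesis
    proof (cases "i' \<in> J")
      case True
      have "(\<Oplus>j\<in>J - K. A i j \<otimes> Y j i') = (\<Oplus>j\<in>J - K. \<ominus> (A i j \<otimes> (\<Oplus>l\<in>K - J. Z j l \<otimes> A l i')))"
        using i True A Z(1) W by (intro finsum_cong') (auto simp: Y_def W_def r_minus Pi_def)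
      also have "\<dots> = \<ominus> (\<Oplus>j\<in>J - K. A i j \<otimes> (\<Oplus>l\<in>K - J. Z j l \<otimes> A l i'))"
        using finsum_rdistr[of "J - K" "\<ominus> \<one>" "\<lambda>j. A i j \<otimes> (\<Oplus>l\<in>K - J. Z j l \<otimes> A l i')"] i True fin A Z(1)
        by (simp add: Pi_def l_minus cong: finsum_cong)
      also have "(\<Oplus>j\<in>J - K. A i j \<otimes> (\<Oplus>l\<in>K - J. Z j l \<otimes> A l i')) = (\<Oplus>l\<in>K - J. (\<Oplus>j\<in>J - K. A i j \<otimes> Z j l) \<otimes> A l i')"
        using i True fin A Z(1) by (intro vec_assoc[symmetric]) auto
      also have "\<dots> = (\<Oplus>l\<in>K - J. (if i = l then \<one> else \<zero>) \<otimes> A l i')"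
        using i True False fin A Z(2) by (intro finsum_cong') auto
      also have "\<dots> = A i i'" using i True False fin A by (intro sum_delta(2)) auto
      finally have "(\<Oplus>j\<in>J - K. A i j \<otimes> Y j i') = \<ominus> A i i'" .
      moreover have "(\<Oplus>j\<in>J \<inter> K. A i j \<otimes> (if j = i' then \<one> else \<zero>)) = A i i'"
        using i True fin A by (intro sum_delta(1)) auto
      ultimately show ?thesis using s i True False A by (auto simp: r_neg)
    next
      case F: False
      have "(\<Oplus>j\<in>J - K. A i j \<otimes> Y j i') = (\<Oplus>j\<in>J - K. A i j \<otimes> Z j i')"
        using i F False A Z(1) by (intro finsum_cong') (auto simp: Y_def)
      moreover have "(\<Oplus>j\<in>J \<inter> K. A i j \<otimes> (if j = i' then \<one> else \<zero>)) = \<zero>"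
        using i F A by (intro finsum_neutral) auto
      ultimately show ?thesis using s i F False Z(2) by auto
    qed
  qed
  have 2: "(\<Oplus>i\<in>K. Y j i \<otimes> A i j') = (if j = j' then \<one> else \<zero>)" if j: "j \<in> J" "j' \<in> J" for j j'
  proof (cases "j \<in> K")
    case True
    have "(\<Oplus>i\<in>K. Y j i \<otimes> A i j') = (\<Oplus>i\<in>K. (if j = i then \<one> else \<zero>) \<otimes> A i j')"
      using j True A by (intro finsum_cong') (auto simp: Y_def)
    also have "\<dots> = A j j'" using fin j True A by (intro sum_delta(2)) auto
    finally show ?thesis using j True by (simp add: rows)
  next
    case False
    have s: "(\<Oplus>i\<in>K. Y j i \<otimes> A i j') = (\<Oplus>i\<in>K \<inter> J. W j i \<otimes> (if i = j' then \<one> else \<zero>)) \<oplus> (\<Oplus>i\<in>K - J. Z j i \<otimes> A i j')"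
      using j fin A Y False W Z(1)
      by (subst finsum_Int_Diff[where K = J]) (auto simp: Y_def rows intro!: arg_cong2[where f = "(\<oplus>)"] finsum_cong')
    show ?thesis
    proof (cases "j' \<in> K")
      case True
      have "(\<Oplus>i\<in>K \<inter> J. W j i \<otimes> (if i = j' then \<one> else \<zero>)) = W j j'"
        using j True False fin W by (intro sum_delta(1)) auto
      moreover have "(\<Oplus>i\<in>K - J. Z j i \<otimes> A i j') \<in> carrier R"
        using j True False A Z(1) by (intro finsum_closed) auto
      ultimately show ?thesis using s j True False by (auto simp: W_def l_neg)
    next
      case F: False
      have "(\<Oplus>i\<in>K \<inter> J. W j i \<otimes> (if i = j' then \<one> else \<zero>)) = \<zero>"
        using j F False W by (intro finsum_neutral) auto
      then show ?thesis using s j F False Z(3) by auto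
    qed
  qed
  show "\<exists>Y. inverse_matrix R K J A Y"
    using A Y 1 2 unfolding inverse_matrix_def by (intro exI[of _ Y]) auto
qed

lemma (in cring) invertible_iff_block_det:
  assumes fin: "finite K" "finite J" and A: "\<And>i j. i \<in> K \<Longrightarrow> j \<in> J \<Longrightarrow> A i j \<in> carrier R"
    and rows: "\<And>i j. i \<in> K \<inter> J \<Longrightarrow> j \<in> J \<Longrightarrow> A i j = (if i = j then \<one> else \<zero>)"
    and r: "bij_betw r {..<m} (K - J)" and c: "bij_betw c {..<m} (J - K)"
  shows "(\<exists>Y. inverse_matrix R K J A Y) \<longleftrightarrow> mat_det R m (\<lambda>i j. A (r i) (c j)) \<in> Units R"
proof -
  have "r i \<in> K - J" if "i < m" for i using r that by (auto simp: bij_betw_def)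
  moreover have "c i \<in> J - K" if "i < m" for i using c that by (auto simp: bij_betw_def)
  ultimately have "mat_det R m (\<lambda>i j. A (r i) (c j)) \<in> Units R \<longleftrightarrow> (\<exists>Y. inverse_matrix R {..<m} {..<m} (\<lambda>i j. A (r i) (c j)) Y)"
    using A by (intro det_unit_iff cring_axioms) auto
  also have "\<dots> \<longleftrightarrow> (\<exists>Y. inverse_matrix R K J A Y)"
    unfolding inverse_matrix_reindex[OF r c] using block_inverse[OF fin A rows] by simp
  finally show ?thesis ..
qed

text \<open>A nonunit lies in a prime ideal: Zorn's lemma yields a maximal member among the ideals
  that contain \<open>x\<close> and miss \<open>\<one>\<close>. The zero ring fits in, having no
  prime ideals and only units.\<close>

lemma (in cring) unit_iff_not_in_prime:
  assumes x: "x \<in> carrier R"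
  shows "x \<in> Units R \<longleftrightarrow> (\<forall>\<qq>. primeideal \<qq> R \<longrightarrow> x \<notin> \<qq>)"
proof (intro iffI allI impI notI)
  fix \<qq> assume u: "x \<in> Units R" and p: "primeideal \<qq> R" and xq: "x \<in> \<qq>"
  interpret primeideal \<qq> R by (rule p)
  have "inv x \<otimes> x \<in> \<qq>" using u xq by (intro I_l_closed) auto
  then have "\<one> \<in> \<qq>" using u by simp
  then show False using one_imp_carrier I_notcarr by auto
next
  assume h: "\<forall>\<qq>. primeideal \<qq> R \<longrightarrow> x \<notin> \<qq>"
  show "x \<in> Units R"
  proof (rule ccontr)
    assume nu: "x \<notin> Units R"
    define \<A> where "\<A> = {I. ideal I R \<and> x \<in> I \<and> \<one> \<notin> I}"
    have "\<one> \<notin> PIdl x"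
    proof
      assume "\<one> \<in> PIdl x"
      then obtain y where "y \<in> carrier R" "\<one> = y \<otimes> x" unfolding cgenideal_def by auto
      then have "x \<in> Units R" using x unfolding Units_def by (auto intro!: bexI[of _ y] simp: m_comm)
      with nu show False ..
    qed
    then have "PIdl x \<in> \<A>" using x by (auto simp: \<A>_def cgenideal_ideal cgenideal_self)
    then have "\<A> \<noteq> {}" by blast
    moreover have "\<Union>C \<in> \<A>" if "C \<noteq> {}" "subset.chain \<A> C" for C
    proof -
      have "subset.chain {I. ideal I R} C" using that unfolding pred_on.chain_def \<A>_def by auto
      from chain_Union_is_ideal[OF this] show ?thesis
        using that unfolding \<A>_def pred_on.chain_def by auto
    qed
    ultimately have "\<exists>M\<in>\<A>. \<forall>X\<in>\<A>. M \<subseteq> X \<longrightarrow> X = M" by (rule subset_Zorn_nonempty)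
    then obtain M where M: "M \<in> \<A>" "\<And>X. X \<in> \<A> \<Longrightarrow> M \<subseteq> X \<Longrightarrow> X = M" by blast
    have "maximalideal M R"
    proof (rule maximalidealI)
      show "ideal M R" "carrier R \<noteq> M" using M(1) by (auto simp: \<A>_def)
      fix J assume J: "ideal J R" "M \<subseteq> J" "J \<subseteq> carrier R"
      show "J = M \<or> J = carrier R"
      proof (cases "\<one> \<in> J")
        case True then show ?thesis using ideal.one_imp_carrier[OF J(1)] by simp
      next
        case False
        then have "J \<in> \<A>" using J M(1) by (auto simp: \<A>_def)
        then show ?thesis using M(2) J by blast
      qed
    qed
    then have "primeideal M R" by (rule maximalideal_prime)
    then show False using h M(1) by (auto simp: \<A>_def)
  qed
qed

lemma (in ring_hom_cring) hom_mat_det: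
  assumes "\<And>i j. i < m \<Longrightarrow> j < m \<Longrightarrow> X i j \<in> carrier R"
  shows "h (mat_det R m X) = mat_det S m (\<lambda>i j. h (X i j))"
proof -
  have p: "p i < m" if "p permutes {..<m}" "i < m" for p i using permutes_in_image[OF that(1), of i] that by simp
  have c: "(\<Otimes>i\<in>{..<m}. X i (p i)) \<in> carrier R" if "p permutes {..<m}" for p
    using that assms p by (intro R.finprod_closed) auto
  have f: "h (\<Otimes>i\<in>{..<m}. X i (p i)) = (\<Otimes>\<^bsub>S\<^esub>i\<in>{..<m}. h (X i (p i)))" if "p permutes {..<m}" for p
    using that assms p by (subst hom_finprod) (auto simp: comp_def)
  show ?thesis unfolding mat_det_def
    by (subst hom_finsum) (auto simp: c f[symmetric] comp_def intro!: S.finsum_cong')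
qed

lemma (in ring_hom_cring) hom_inverse_matrix:
  assumes Y: "inverse_matrix R I J X Y"
  shows "inverse_matrix S I J (\<lambda>i j. h (X i j)) (\<lambda>j i. h (Y j i))"
proof -
  have c: "X i j \<in> carrier R" "Y j i \<in> carrier R" if "i \<in> I" "j \<in> J" for i j
    using Y that by (auto simp: inverse_matrix_def)
  have 1: "(\<Oplus>\<^bsub>S\<^esub>j\<in>J. h (X i j) \<otimes>\<^bsub>S\<^esub> h (Y j i')) = h (\<Oplus>j\<in>J. X i j \<otimes> Y j i')" if "i \<in> I" "i' \<in> I" for i i'
    using that c by (subst hom_finsum) (auto simp: comp_def intro!: S.finsum_cong')
  have 2: "(\<Oplus>\<^bsub>S\<^esub>i\<in>I. h (Y j i) \<otimes>\<^bsub>S\<^esub> h (X i j')) = h (\<Oplus>i\<in>I. Y j i \<otimes> X i j')" if "j \<in> J" "j' \<in> J" for j j'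
    using that c by (subst hom_finsum) (auto simp: comp_def intro!: S.finsum_cong')
  show ?thesis using Y unfolding inverse_matrix_def by (auto simp: 1 2)
qed

section \<open>Quotients of polynomial rings\<close>

lemma with_scalars_simps [simp]:
  "carrier (with_scalars A s) = carrier A" "monoid.mult (with_scalars A s) = monoid.mult A"
  "one (with_scalars A s) = one A" "zero (with_scalars A s) = zero A" "add (with_scalars A s) = add A"
  "r \<odot>\<^bsub>with_scalars A s\<^esub> x = s r \<otimes>\<^bsub>A\<^esub> x"
  by (simp_all add: with_scalars_def)

lemma algebra_with_scalars:
  assumes R: "cring R" and A: "cring A" and s: "s \<in> Ring.ring_hom R A"
  shows "algebra R (with_scalars A s)"
proof -
  interpret R: cring R by fact
  interpret A: cring A by fact
  interpret ring_hom_cring R A s using s by unfold_locales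
  have "cring (with_scalars A s)"
    by (intro cringI abelian_groupI comm_monoidI)
       (auto simp: A.m_ac A.a_ac A.r_distr intro: bexI[OF _ A.a_inv_closed] A.l_neg)
  then show ?thesis
    by (intro algebraI) (auto simp: R A.l_distr A.r_distr A.m_assoc)
qed

lemma mterm_zero_hom:
  assumes "cring k"
  shows "(\<lambda>c. mterm k c 0) \<in> Ring.ring_hom k (mpoly_ring k V)"
  using assms by (intro ring_hom_memI)
    (auto simp: mterm_closed mterm_mult mpoly_one, auto simp: mterm_def mpoly_add cring.cring_simprules fun_eq_iff)

lemma mpoly_const_eq: "mpoly_const k c = mterm k c 0" by (simp add: mpoly_const_def mterm_def)
lemma mpoly_monom_eq: "mpoly_monom k a = mterm k \<one>\<^bsub>k\<^esub> a" by (simp add: mpoly_monom_def mterm_def)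
lemma mpoly_var_eq: "mpoly_var k v = mterm k \<one>\<^bsub>k\<^esub> (Poly_Mapping.single v 1)"
  by (simp add: mpoly_var_def mpoly_monom_eq)

text \<open>\<open>P\<close>, \<open>Q\<close> and \<open>\<pi>\<close> are parameters pinned down
  by equations, so that each instance can use its own names: the locale serves for the quotients
  B[x]/I as well as for the coordinate algebras.\<close>

locale mpoly_quotient =
  fixes k :: "('k, 'm) ring_scheme" and V :: "'v set" and I P Q \<pi>
  assumes k: "cring k" and I: "ideal I (mpoly_ring k V)"
    and P_eq: "P = mpoly_ring k V"
    and Q_eq: "Q = mpoly_quot k V I"
    and \<pi>_eq: "\<pi> = a_r_coset (mpoly_ring k V) I"
begin

sublocale k: cring k by (rule k)
sublocale P: cring P unfolding P_eq by (rule mpoly_cring[OF k])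
sublocale I: ideal I P using I by (simp add: P_eq)

lemma rcos_hom: "\<pi> \<in> Ring.ring_hom P (P Quot I)"
  using I.rcos_ring_hom by (simp add: P_eq \<pi>_eq)

lemma algebra_Q: "algebra k Q"
  unfolding Q_eq mpoly_quot_def mpoly_const_eq
proof (rule algebra_with_scalars[OF k])
  show "cring (mpoly_ring k V Quot I)" using I.quotient_is_cring[OF P.cring_axioms] by (simp add: P_eq)
  show "(\<lambda>a. I +>\<^bsub>mpoly_ring k V\<^esub> mterm k a 0) \<in> Ring.ring_hom k (mpoly_ring k V Quot I)"
    using ring_hom_trans[OF mterm_zero_hom[OF k, of V], of \<pi> "P Quot I"] rcos_hom by (simp add: P_eq \<pi>_eq comp_def)
qed

sublocale Q: algebra k Q by (rule algebra_Q)

lemma \<pi>_hom: "\<pi> \<in> Ring.ring_hom P Q"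
  using rcos_hom by (auto simp: Ring.ring_hom_def Q_eq mpoly_quot_def P_eq)

sublocale \<pi>: ring_hom_cring P Q \<pi>
  by (rule ring_hom_cringI[OF P.cring_axioms Q.cring_axioms \<pi>_hom])

lemma \<pi>_surj: "v \<in> carrier Q \<Longrightarrow> \<exists>p\<in>carrier P. v = \<pi> p"
  by (auto simp: Q_eq mpoly_quot_def P_eq \<pi>_eq FactRing_def A_RCOSETS_def')

lemma \<pi>_zero_iff: "p \<in> carrier P \<Longrightarrow> \<pi> p = \<zero>\<^bsub>Q\<^esub> \<longleftrightarrow> p \<in> I"
  using P.quotient_eq_iff_same_a_r_cos[OF I.ideal_axioms, of p "\<zero>\<^bsub>P\<^esub>"] \<pi>.hom_zero
  by (auto simp: \<pi>_eq P_eq[symmetric] P.minus_eq)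

lemma smult_\<pi>: "c \<in> carrier k \<Longrightarrow> p \<in> carrier P \<Longrightarrow> c \<odot>\<^bsub>Q\<^esub> \<pi> p = \<pi> (mterm k c 0 \<otimes>\<^bsub>P\<^esub> p)"
  using mterm_closed[OF k, of c 0 V]
  by (subst \<pi>.hom_mult) (auto simp: Q_eq mpoly_quot_def P_eq \<pi>_eq mpoly_const_eq)

lemma mterm_P: "c \<in> carrier k \<Longrightarrow> Poly_Mapping.keys a \<subseteq> V \<Longrightarrow> mterm k c a \<in> carrier P"
  unfolding P_eq by (rule mterm_closed[OF k])

lemma \<pi>_mterm: "c \<in> carrier k \<Longrightarrow> Poly_Mapping.keys a \<subseteq> V \<Longrightarrow> \<pi> (mterm k c a) = c \<odot>\<^bsub>Q\<^esub> \<pi> (mpoly_monom k a)"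
  using smult_\<pi>[of c "mpoly_monom k a"] mterm_P[of "\<one>\<^bsub>k\<^esub>" a]
  by (simp add: mpoly_monom_eq P_eq mterm_mult[OF k])

text \<open>Factorization through the quotient: two representatives of a class differ by an element
  of \<open>I\<close>, which \<open>ev\<close> kills. The map is cut off outside the carrier because
  \<open>alg_hom\<close> consists of extensional functions.\<close>

lemma lift_hom:
  assumes B: "algebra k B" and ev: "ev \<in> Ring.ring_hom P B"
    and const: "\<And>c. c \<in> carrier k \<Longrightarrow> ev (mterm k c 0) = c \<odot>\<^bsub>B\<^esub> \<one>\<^bsub>B\<^esub>"
    and ker: "\<And>p. p \<in> I \<Longrightarrow> ev p = \<zero>\<^bsub>B\<^esub>"
  shows "\<exists>\<phi>\<in>alg_hom k Q B. \<forall>p\<in>carrier P. \<phi> (\<pi> p) = ev p"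
proof -
  interpret C: cring B using B by (simp add: algebra_def)
  interpret B: algebra k B by (rule B)
  interpret ev: ring_hom_cring P B ev by (rule ring_hom_cringI[OF P.cring_axioms C.cring_axioms ev])
  define \<phi> where "\<phi> = restrict (\<lambda>X. ev (SOME p. p \<in> carrier P \<and> \<pi> p = X)) (carrier Q)"
  have \<phi>: "\<phi> (\<pi> p) = ev p" if p: "p \<in> carrier P" for p
  proof -
    define q where "q = (SOME q. q \<in> carrier P \<and> \<pi> q = \<pi> p)"
    have q: "q \<in> carrier P" "\<pi> q = \<pi> p"
      using someI[of "\<lambda>q. q \<in> carrier P \<and> \<pi> q = \<pi> p" p] p unfolding q_def by auto
    have "\<pi> (q \<ominus>\<^bsub>P\<^esub> p) = \<zero>\<^bsub>Q\<^esub>" using q p by (simp add: P.minus_eq Q.r_neg)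
    then have "q \<ominus>\<^bsub>P\<^esub> p \<in> I" using q p \<pi>_zero_iff[of "q \<ominus>\<^bsub>P\<^esub> p"] by auto
    from ker[OF this] have "ev q \<ominus>\<^bsub>B\<^esub> ev p = \<zero>\<^bsub>B\<^esub>"
      using q p by (simp add: P.minus_eq C.minus_eq)
    then have "ev q = ev p" using q p C.r_right_minus_eq[of "ev q" "ev p"] by simp
    then show ?thesis using p by (simp add: \<phi>_def q_def)
  qed
  have "\<phi> \<in> alg_hom k Q B"
    unfolding alg_hom_def
  proof (intro CollectI conjI IntI ballI)
    show "\<phi> \<in> extensional (carrier Q)" by (simp add: \<phi>_def)
    show "\<phi> \<in> Ring.ring_hom Q B"
    proof (rule ring_hom_memI)
      fix x y assume "x \<in> carrier Q" "y \<in> carrier Q"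
      then obtain p q where [simp]: "p \<in> carrier P" "q \<in> carrier P" "x = \<pi> p" "y = \<pi> q" using \<pi>_surj by metis
      show "\<phi> x \<in> carrier B" by (simp add: \<phi>)
      show "\<phi> (x \<otimes>\<^bsub>Q\<^esub> y) = \<phi> x \<otimes>\<^bsub>B\<^esub> \<phi> y" using \<phi>[of "p \<otimes>\<^bsub>P\<^esub> q"] by (simp add: \<phi>)
      show "\<phi> (x \<oplus>\<^bsub>Q\<^esub> y) = \<phi> x \<oplus>\<^bsub>B\<^esub> \<phi> y" using \<phi>[of "p \<oplus>\<^bsub>P\<^esub> q"] by (simp add: \<phi>)
    next
      show "\<phi> \<one>\<^bsub>Q\<^esub> = \<one>\<^bsub>B\<^esub>" using \<phi>[of "\<one>\<^bsub>P\<^esub>"] by simp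
    qed
    fix c x assume c: "c \<in> carrier k" and "x \<in> carrier Q"
    then obtain p where [simp]: "p \<in> carrier P" "x = \<pi> p" using \<pi>_surj by metis
    show "\<phi> (c \<odot>\<^bsub>Q\<^esub> x) = c \<odot>\<^bsub>B\<^esub> \<phi> x"
      using \<phi>[of "mterm k c 0 \<otimes>\<^bsub>P\<^esub> p"] c mterm_P[of c 0]
      by (simp add: smult_\<pi> \<phi> const B.smult_assoc2 del: \<pi>.hom_mult)
  qed
  then show ?thesis using \<phi> by blast
qed

text \<open>The classes of the variables generate the quotient as a \<open>k\<close>-algebra:
  agreement passes to monomials by multiplicativity, to terms by \<open>k\<close>-linearity and to
  polynomials by additivity.\<close>

lemma hom_eqI:
  assumes B: "algebra k B" and \<phi>: "\<phi> \<in> alg_hom k Q B" and \<psi>: "\<psi> \<in> alg_hom k Q B"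
    and eq: "\<And>v. v \<in> V \<Longrightarrow> \<phi> (\<pi> (mpoly_var k v)) = \<psi> (\<pi> (mpoly_var k v))"
  shows "\<phi> = \<psi>"
proof -
  interpret C: cring B using B by (simp add: algebra_def)
  interpret B: algebra k B by (rule B)
  have h: "\<phi> \<in> Ring.ring_hom Q B" "\<psi> \<in> Ring.ring_hom Q B" "\<phi> \<in> extensional (carrier Q)" "\<psi> \<in> extensional (carrier Q)"
    and sm: "\<And>c x. c \<in> carrier k \<Longrightarrow> x \<in> carrier Q \<Longrightarrow> \<phi> (c \<odot>\<^bsub>Q\<^esub> x) = c \<odot>\<^bsub>B\<^esub> \<phi> x"
    "\<And>c x. c \<in> carrier k \<Longrightarrow> x \<in> carrier Q \<Longrightarrow> \<psi> (c \<odot>\<^bsub>Q\<^esub> x) = c \<odot>\<^bsub>B\<^esub> \<psi> x"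
    using \<phi> \<psi> by (auto simp: alg_hom_def)
  interpret \<phi>: ring_hom_cring Q B \<phi> by (rule ring_hom_cringI[OF Q.cring_axioms C.cring_axioms h(1)])
  interpret \<psi>: ring_hom_cring Q B \<psi> by (rule ring_hom_cringI[OF Q.cring_axioms C.cring_axioms h(2)])
  have monom: "\<phi> (\<pi> (mterm k \<one>\<^bsub>k\<^esub> a)) = \<psi> (\<pi> (mterm k \<one>\<^bsub>k\<^esub> a))" if "Poly_Mapping.keys a \<subseteq> V" for a
    using that
  proof (induction a rule: monom_induct)
    case zero
    have "mterm k \<one>\<^bsub>k\<^esub> 0 = \<one>\<^bsub>P\<^esub>" by (simp add: P_eq mpoly_one mterm_def)
    then show ?case by simp
  next
    case (add m v)
    have "mterm k \<one>\<^bsub>k\<^esub> (m + Poly_Mapping.single v 1) = mterm k \<one>\<^bsub>k\<^esub> m \<otimes>\<^bsub>P\<^esub> mpoly_var k v"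
      by (simp add: P_eq mpoly_var_eq mterm_mult[OF k])
    then show ?case using add mterm_P[of "\<one>\<^bsub>k\<^esub>"] eq by (simp add: mpoly_var_eq)
  qed
  have "\<phi> (\<pi> p) = \<psi> (\<pi> p)" if "p \<in> carrier (mpoly_ring k V)" for p
    using k that
  proof (induction p rule: mpoly_add_induct)
    case zero
    then show ?case by (simp add: P_eq[symmetric])
  next
    case (add c a q)
    have [simp]: "mpoly_monom k a \<in> carrier P" using mterm_P[of "\<one>\<^bsub>k\<^esub>" a] add by (simp add: mpoly_monom_eq)
    have "\<phi> (\<pi> (mterm k c a)) = \<psi> (\<pi> (mterm k c a))"
      using add monom[of a] by (simp add: \<pi>_mterm sm)
    moreover have "mterm k c a \<in> carrier P" "q \<in> carrier P"
      using add(1,2) mterm_P add(3) unfolding P_eq by blast+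
    ultimately show ?case using add.IH unfolding P_eq[symmetric] by simp
  qed
  then show ?thesis
    using h(3,4) \<pi>_surj by (intro extensionalityI[of _ "carrier Q"]) (auto simp: P_eq)
qed

end

text \<open>Evaluation is \<open>lin_ev\<close> against the monomials in the values
  \<open>t\<close>, after the coefficients have been moved to \<open>B\<close> along the structure
  map. Multiplicativity then comes from \<open>lin_ev_mult\<close>.\<close>

lemma mpoly_eval:
  fixes k :: "('k, 'm) ring_scheme" and B :: "('k, 'b, 'n) module_scheme" and V :: "'v set"
  assumes k: "cring k" and B: "algebra k B" and t: "\<And>v. v \<in> V \<Longrightarrow> t v \<in> carrier B"
  shows "\<exists>ev\<in>Ring.ring_hom (mpoly_ring k V) B. (\<forall>c\<in>carrier k. ev (mterm k c 0) = c \<odot>\<^bsub>B\<^esub> \<one>\<^bsub>B\<^esub>) \<and>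
    (\<forall>v\<in>V. ev (mpoly_var k v) = t v)"
proof -
  interpret C: cring B using B by (simp add: algebra_def)
  interpret B: algebra k B by (rule B)
  interpret P: cring "mpoly_ring k V" by (rule mpoly_cring[OF k])
  note C = C.cring_axioms
  \<comment> \<open>Values outside \<open>V\<close> are set to \<open>\<one>\<close>, since the
    rules for \<open>lin_ev\<close> ask for a functional with values in the carrier at every
    exponent.\<close>
  define t' where "t' v = (if v \<in> V then t v else \<one>\<^bsub>B\<^esub>)" for v
  have t': "t' v \<in> carrier B" for v using t by (simp add: t'_def)
  define tm where "tm m = (\<Otimes>\<^bsub>B\<^esub>v\<in>Poly_Mapping.keys m. t' v [^]\<^bsub>B\<^esub> Poly_Mapping.lookup m v)" for m :: "'v \<Rightarrow>\<^sub>0 nat"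
  have tm_closed: "tm m \<in> carrier B" for m unfolding tm_def by (intro C.finprod_closed) (auto simp: t')
  have tm_super: "tm m = (\<Otimes>\<^bsub>B\<^esub>v\<in>S. t' v [^]\<^bsub>B\<^esub> Poly_Mapping.lookup m v)" if "finite S" "Poly_Mapping.keys m \<subseteq> S" for m S
    unfolding tm_def using that t'
    by (intro C.finprod_mono_neutral_cong_left) (auto simp: in_keys_iff)
  have tm_add: "tm (a + b) = tm a \<otimes>\<^bsub>B\<^esub> tm b" for a b
  proof -
    let ?S = "Poly_Mapping.keys a \<union> Poly_Mapping.keys b"
    have "tm (a + b) = (\<Otimes>\<^bsub>B\<^esub>v\<in>?S. t' v [^]\<^bsub>B\<^esub> Poly_Mapping.lookup a v \<otimes>\<^bsub>B\<^esub> t' v [^]\<^bsub>B\<^esub> Poly_Mapping.lookup b v)"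
      by (subst tm_super[of ?S]) (auto simp: keys_add_nat lookup_add C.nat_pow_mult t' intro!: C.finprod_cong')
    also have "\<dots> = tm a \<otimes>\<^bsub>B\<^esub> tm b"
      by (subst C.finprod_multf) (auto simp: t' tm_super[of ?S])
    finally show ?thesis .
  qed
  define j where "j c = c \<odot>\<^bsub>B\<^esub> \<one>\<^bsub>B\<^esub>" for c
  have j: "j \<in> Ring.ring_hom k B"
    by (intro ring_hom_memI)
       (auto simp: j_def B.smult_l_distr B.smult_assoc2 B.smult_assoc1[symmetric])
  interpret j: ring_hom_cring k B j by (rule ring_hom_cringI[OF k C j])
  define J where "J p m = j (p m)" for p :: "('v \<Rightarrow>\<^sub>0 nat) \<Rightarrow> 'k" and m
  have J: "J p \<in> carrier (mpoly_ring B V)" if "p \<in> carrier (mpoly_ring k V)" for p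
  proof -
    have "{m. J p m \<noteq> \<zero>\<^bsub>B\<^esub>} \<subseteq> {m. p m \<noteq> \<zero>\<^bsub>k\<^esub>}" by (auto simp: J_def)
    moreover from this have "finite {m. J p m \<noteq> \<zero>\<^bsub>B\<^esub>}"
      by (rule finite_subset) (use that in \<open>auto simp: mpoly_carrier\<close>)
    ultimately show ?thesis using that by (auto simp: mpoly_carrier subset_iff J_def)
  qed
  have J_add: "J (p \<oplus>\<^bsub>mpoly_ring k V\<^esub> q) = J p \<oplus>\<^bsub>mpoly_ring B V\<^esub> J q"
    if "p \<in> carrier (mpoly_ring k V)" "q \<in> carrier (mpoly_ring k V)" for p q
    using that by (auto simp: J_def mpoly_add mpoly_carrier)
  have J_mult: "J (p \<otimes>\<^bsub>mpoly_ring k V\<^esub> q) = J p \<otimes>\<^bsub>mpoly_ring B V\<^esub> J q"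
    if "p \<in> carrier (mpoly_ring k V)" "q \<in> carrier (mpoly_ring k V)" for p q
  proof
    fix m
    have "j (\<Oplus>\<^bsub>k\<^esub>s\<in>{s. fst s + snd s = m}. p (fst s) \<otimes>\<^bsub>k\<^esub> q (snd s)) = (\<Oplus>\<^bsub>B\<^esub>s\<in>{s. fst s + snd s = m}. j (p (fst s)) \<otimes>\<^bsub>B\<^esub> j (q (snd s)))"
      using that by (subst j.hom_finsum) (auto simp: mpoly_carrier comp_def)
    then show "J (p \<otimes>\<^bsub>mpoly_ring k V\<^esub> q) m = (J p \<otimes>\<^bsub>mpoly_ring B V\<^esub> J q) m"
      by (simp add: J_def mpoly_mult)
  qed
  have J_mterm: "J (mterm k c a) = mterm B (j c) a" for c a by (auto simp: J_def mterm_def)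
  define ev where "ev p = lin_ev B (J p) tm" for p
  have Jc: "J p a \<in> carrier B" if "p \<in> carrier (mpoly_ring k V)" for p a
    using J[OF that] by (simp add: mpoly_carrier)
  have ev_mterm: "ev (mterm k c a) = j c \<otimes>\<^bsub>B\<^esub> tm a" if "c \<in> carrier k" for c a
    unfolding ev_def J_mterm using that tm_closed by (intro lin_ev_mterm[OF C]) auto
  have "ev \<in> Ring.ring_hom (mpoly_ring k V) B"
  proof (rule ring_hom_memI)
    fix p q assume p: "p \<in> carrier (mpoly_ring k V)" and q: "q \<in> carrier (mpoly_ring k V)"
    show "ev p \<in> carrier B" unfolding ev_def by (intro lin_ev_closed[OF C]) (auto simp: Jc p tm_closed)
    show "ev (p \<oplus>\<^bsub>mpoly_ring k V\<^esub> q) = ev p \<oplus>\<^bsub>B\<^esub> ev q"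
      unfolding ev_def J_add[OF p q] by (intro lin_ev_add[OF C J[OF p] J[OF q]] tm_closed)
    define L where "L = lin_ev B (J q) tm"
    have lc: "L \<in> carrier B" unfolding L_def by (intro lin_ev_closed[OF C]) (auto simp: Jc q tm_closed)
    \<comment> \<open>Translating the exponent by \<open>a\<close> multiplies the functional by
      \<open>tm a\<close>; this is where evaluation becomes multiplicative instead of merely
      linear.\<close>
    have "lin_ev B (J q) (\<lambda>b. tm (a + b)) = tm a \<otimes>\<^bsub>B\<^esub> L" for a
      unfolding L_def lin_ev_def tm_add using J[OF q] tm_closed
      by (subst C.finsum_rdistr) (auto simp: mpoly_carrier C.m_lcomm intro!: C.finsum_cong')
    then have "ev (p \<otimes>\<^bsub>mpoly_ring k V\<^esub> q) = lin_ev B (J p) (\<lambda>a. tm a \<otimes>\<^bsub>B\<^esub> L)"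
      unfolding ev_def J_mult[OF p q] by (subst lin_ev_mult[OF C J[OF p] J[OF q] tm_closed]) simp
    also have "\<dots> = ev p \<otimes>\<^bsub>B\<^esub> ev q"
      unfolding ev_def L_def[symmetric] using lc J[OF p] tm_closed
      unfolding lin_ev_def[of _ "J p"] by (subst C.finsum_ldistr) (auto simp: mpoly_carrier C.m_assoc intro!: C.finsum_cong')
    finally show "ev (p \<otimes>\<^bsub>mpoly_ring k V\<^esub> q) = ev p \<otimes>\<^bsub>B\<^esub> ev q" .
  next
    show "ev \<one>\<^bsub>mpoly_ring k V\<^esub> = \<one>\<^bsub>B\<^esub>"
      using ev_mterm[of "\<one>\<^bsub>k\<^esub>" 0] by (simp add: mpoly_one mterm_def tm_def)
  qed
  moreover have "ev (mterm k c 0) = c \<odot>\<^bsub>B\<^esub> \<one>\<^bsub>B\<^esub>" if "c \<in> carrier k" for c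
    using that by (simp add: ev_mterm tm_def) (simp add: j_def)
  moreover have "ev (mpoly_var k v) = t v" if "v \<in> V" for v
    using that t[OF that] by (simp add: mpoly_var_eq ev_mterm) (simp add: tm_def t'_def)
  ultimately show ?thesis by blast
qed

section \<open>Standard sets\<close>

lemma exponents_add: "a \<in> exponents n \<Longrightarrow> b \<in> exponents n \<Longrightarrow> a + b \<in> exponents n"
  by (auto simp: exponents_def keys_add_nat)

lemma exponents_addD: "a + b \<in> exponents n \<Longrightarrow> a \<in> exponents n \<and> b \<in> exponents n"
  by (auto simp: exponents_def keys_add_nat)

lemma zero_exponents [simp]: "0 \<in> exponents n" by (simp add: exponents_def)

lemma unit_vec_exponents [simp]: "Defs.unit_vec i \<in> exponents n \<longleftrightarrow> i < n" by (auto simp: exponents_def Defs.unit_vec_def)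

text \<open>Contrapositive of the definition: the complement absorbs multiples, so a standard set is
  closed under divisors. Summands of an exponent in \<open>n\<close> variables are again such
  exponents.\<close>

lemma standard_setD: "standard_set n S \<Longrightarrow> a + b \<in> S \<Longrightarrow> a \<in> S"
  unfolding standard_set_def by (meson DiffD2 DiffI exponents_addD subsetD)

lemma standard_set_zero: "standard_set n S \<Longrightarrow> S \<noteq> {} \<Longrightarrow> 0 \<in> S"
  using standard_setD[of n S 0] by auto

lemma standard_set_Un: "standard_set n S \<Longrightarrow> standard_set n S' \<Longrightarrow> standard_set n (S \<union> S')"
  unfolding standard_set_def by blast

lemma expo_induct [consumes 1, case_names zero add]:
  assumes "a \<in> exponents n" "Q 0"
    and "\<And>a i. a \<in> exponents n \<Longrightarrow> i < n \<Longrightarrow> Q a \<Longrightarrow> Q (a + Defs.unit_vec i)"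
  shows "Q a"
proof -
  have "Poly_Mapping.keys a \<subseteq> {..<n}" using assms(1) by (simp add: exponents_def)
  then show ?thesis
    by (induction a rule: monom_induct) (use assms(2,3) in \<open>auto simp: exponents_def Defs.unit_vec_def\<close>)
qed

text \<open>All sums run over \<open>\<Delta>\<close>, hence its finiteness; the rows, indexed by
  \<open>P\<close> and its border, may form an infinite set. Nonemptiness puts the exponent 0 into
  \<open>\<Delta>\<close>, so that the row of the monomial 1 is a unit vector.\<close>

locale frame =
  fixes n :: nat and P \<Delta> :: "expo set" and B :: "('b, 'm) ring_scheme" (structure)
  assumes P: "standard_set n P" and \<Delta>: "standard_set n \<Delta>" and fin: "finite \<Delta>" and ne: "\<Delta> \<noteq> {}"
    and sub: "\<Delta> \<subseteq> P" and B: "cring B"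
begin

sublocale cring B by (rule B)

abbreviation e where "e \<equiv> Defs.unit_vec"

abbreviation Q where "Q \<equiv> P \<union> border n P"

lemma P_exp: "P \<subseteq> exponents n" using P by (simp add: standard_set_def)

lemma Q_exp: "Q \<subseteq> exponents n"
  using P_exp by (auto simp: border_def intro!: exponents_add)

lemma P_add: "a \<in> P \<Longrightarrow> i < n \<Longrightarrow> a + e i \<in> Q"
  by (auto simp: border_def)

lemma \<Delta>_Q: "\<Delta> \<subseteq> Q" using sub by auto
lemma \<Delta>_exp: "\<Delta> \<subseteq> exponents n" using \<Delta> by (simp add: standard_set_def)
lemma \<Delta>_add: "a \<in> \<Delta> \<Longrightarrow> i < n \<Longrightarrow> a + e i \<in> Q" using sub P_add by blast
lemma zero_\<Delta>: "0 \<in> \<Delta>" using standard_set_zero[OF \<Delta> ne] .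

text \<open>If a + e_i = p + e_j with \<open>i \<noteq> j\<close>, then x_i divides x^p, and a = (p
  - e_i) + e_j is again a neighbour of an element of \<open>P\<close>. The induction over
  \<open>Q\<close> in \<open>table_extend\<close> strips off one variable at a time and relies on
  this.\<close>

lemma Q_down:
  assumes "a + e i \<in> Q"
  shows "a \<in> Q"
proof (cases "a + e i \<in> P")
  case True
  then show ?thesis using standard_setD[OF P] by blast
next
  case False
  then obtain p j where j: "j < n" and p: "p \<in> P" and eq: "a + e i = p + e j" using assms by (auto simp: border_def)
  show ?thesis
  proof (cases "i = j")
    case True
    then show ?thesis using eq p by simp
  next
    case False
    define a' where "a' = p - e i"
    have l: "Poly_Mapping.lookup a v + Poly_Mapping.lookup (e i) v = Poly_Mapping.lookup p v + Poly_Mapping.lookup (e j) v" for v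
      using arg_cong[OF eq, of "\<lambda>q. Poly_Mapping.lookup q v"] by (simp add: lookup_add)
    have "p = a' + e i"
    proof (rule poly_mapping_eqI)
      fix v show "Poly_Mapping.lookup p v = Poly_Mapping.lookup (a' + e i) v"
        using l[of v] False by (auto simp: a'_def lookup_add lookup_minus Defs.unit_vec_def lookup_single when_def split: if_splits)
    qed
    moreover from this have "a + e i = (a' + e j) + e i" using eq by (simp only: ac_simps)
    then have "a = a' + e j" by simp
    ultimately show ?thesis using standard_setD[OF P] p P_add[OF _ j] by metis
  qed
qed

text \<open>The defining relations of the coordinate ring with the variables replaced by elements of
  \<open>B\<close>; see \<open>vanish_iff_table\<close>.\<close>

definition is_table :: "(expo \<Rightarrow> expo \<Rightarrow> 'b) \<Rightarrow> bool" where
  "is_table T \<longleftrightarrow> (\<forall>\<alpha>\<in>Q. \<forall>\<beta>\<in>\<Delta>. T \<alpha> \<beta> \<in> carrier B) \<and>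
     (\<forall>\<alpha>\<in>\<Delta>. \<forall>\<beta>\<in>\<Delta>. T \<alpha> \<beta> = (if \<alpha> = \<beta> then \<one> else \<zero>)) \<and>
     (\<forall>\<alpha>\<in>Q. \<forall>i<n. \<forall>\<beta>\<in>\<Delta>. \<alpha> + e i \<in> Q \<longrightarrow> T (\<alpha> + e i) \<beta> = (\<Oplus>\<gamma>\<in>\<Delta>. T \<alpha> \<gamma> \<otimes> T (\<gamma> + e i) \<beta>)) \<and>
     (\<forall>\<alpha>\<in>border n P. \<forall>\<alpha>'\<in>border n P. \<forall>i<n. \<forall>j<n. \<forall>\<beta>\<in>\<Delta>. \<alpha> + e i = \<alpha>' + e j \<longrightarrow> \<alpha> + e i \<in> border2 n P \<longrightarrow>
        (\<Oplus>\<gamma>\<in>\<Delta>. T \<alpha> \<gamma> \<otimes> T (\<gamma> + e i) \<beta>) = (\<Oplus>\<gamma>\<in>\<Delta>. T \<alpha>' \<gamma> \<otimes> T (\<gamma> + e j) \<beta>))"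

text \<open>The row of \<open>\<alpha>\<close> in a normal table is meant to be the coefficient vector of \<open>x\<^sup>\<alpha>\<close>, here for
  arbitrary \<open>\<alpha>\<close>; the last condition is multiplication by a variable.\<close>

definition normal_table :: "(expo \<Rightarrow> expo \<Rightarrow> 'b) \<Rightarrow> bool" where
  "normal_table w \<longleftrightarrow> (\<forall>\<alpha>. \<forall>\<beta>\<in>\<Delta>. w \<alpha> \<beta> \<in> carrier B) \<and>
     (\<forall>\<alpha>\<in>\<Delta>. \<forall>\<beta>\<in>\<Delta>. w \<alpha> \<beta> = (if \<alpha> = \<beta> then \<one> else \<zero>)) \<and>
     (\<forall>\<alpha>\<in>exponents n. \<forall>i<n. \<forall>\<eta>\<in>\<Delta>. w (\<alpha> + e i) \<eta> = (\<Oplus>\<beta>\<in>\<Delta>. w \<alpha> \<beta> \<otimes> w (\<beta> + e i) \<eta>))"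

section \<open>Rows under multiplication by monomials\<close>

lemma normal_tableD:
  assumes "normal_table w"
  shows "\<And>\<alpha> \<beta>. \<beta> \<in> \<Delta> \<Longrightarrow> w \<alpha> \<beta> \<in> carrier B"
    and "\<And>\<alpha> \<beta>. \<alpha> \<in> \<Delta> \<Longrightarrow> \<beta> \<in> \<Delta> \<Longrightarrow> w \<alpha> \<beta> = (if \<alpha> = \<beta> then \<one> else \<zero>)"
    and "\<And>\<alpha> i \<eta>. \<alpha> \<in> exponents n \<Longrightarrow> i < n \<Longrightarrow> \<eta> \<in> \<Delta> \<Longrightarrow> w (\<alpha> + e i) \<eta> = (\<Oplus>\<beta>\<in>\<Delta>. w \<alpha> \<beta> \<otimes> w (\<beta> + e i) \<eta>)"
  using assms unfolding normal_table_def by blast+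

text \<open>Induction on \<open>c\<close>, one variable at a time. The matrix with rows
  \<open>w (\<beta> + c)\<close> represents multiplication by x^c, and the step multiplies it by the
  matrix of one more variable.\<close>

lemma normal_table_add:
  assumes w: "normal_table w" and a: "a \<in> exponents n" and c: "c \<in> exponents n" and "\<eta> \<in> \<Delta>"
  shows "w (a + c) \<eta> = (\<Oplus>\<beta>\<in>\<Delta>. w a \<beta> \<otimes> w (\<beta> + c) \<eta>)"
  using c \<open>\<eta> \<in> \<Delta>\<close>
proof (induction c arbitrary: \<eta> rule: expo_induct)
  note [simp] = normal_tableD(1)[OF w]
  case zero
  have "(\<Oplus>\<beta>\<in>\<Delta>. w a \<beta> \<otimes> w (\<beta> + 0) \<eta>) = (\<Oplus>\<beta>\<in>\<Delta>. w a \<beta> \<otimes> (if \<beta> = \<eta> then \<one> else \<zero>))"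
    using zero by (intro finsum_cong') (auto simp: normal_tableD(2)[OF w])
  also have "\<dots> = w a \<eta>" using fin zero by (intro sum_delta(1)) auto
  finally show ?case by simp
next
  note [simp] = normal_tableD(1)[OF w]
  case (add c i)
  have "w (a + (c + e i)) \<eta> = (\<Oplus>\<zeta>\<in>\<Delta>. w (a + c) \<zeta> \<otimes> w (\<zeta> + e i) \<eta>)"
    using normal_tableD(3)[OF w, of "a + c" i \<eta>] add a by (simp add: exponents_add add.assoc)
  also have "\<dots> = (\<Oplus>\<zeta>\<in>\<Delta>. (\<Oplus>\<beta>\<in>\<Delta>. w a \<beta> \<otimes> w (\<beta> + c) \<zeta>) \<otimes> w (\<zeta> + e i) \<eta>)"
    using add by (intro finsum_cong') auto
  also have "\<dots> = (\<Oplus>\<beta>\<in>\<Delta>. w a \<beta> \<otimes> (\<Oplus>\<zeta>\<in>\<Delta>. w (\<beta> + c) \<zeta> \<otimes> w (\<zeta> + e i) \<eta>))"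
    using add fin by (intro vec_assoc) auto
  also have "\<dots> = (\<Oplus>\<beta>\<in>\<Delta>. w a \<beta> \<otimes> w (\<beta> + (c + e i)) \<eta>)"
  proof (intro finsum_cong' refl)
    fix \<beta> assume "\<beta> \<in> \<Delta>"
    then show "w a \<beta> \<otimes> (\<Oplus>\<zeta>\<in>\<Delta>. w (\<beta> + c) \<zeta> \<otimes> w (\<zeta> + e i) \<eta>) = w a \<beta> \<otimes> w (\<beta> + (c + e i)) \<eta>"
      using normal_tableD(3)[OF w, of "\<beta> + c" i \<eta>] add \<Delta>_exp by (auto simp: exponents_add add.assoc)
  qed (use add in auto)
  finally show ?case .
qed

lemma is_tableD:
  assumes "is_table T"
  shows "\<And>\<alpha> \<beta>. \<alpha> \<in> Q \<Longrightarrow> \<beta> \<in> \<Delta> \<Longrightarrow> T \<alpha> \<beta> \<in> carrier B"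
    and "\<And>\<alpha> \<beta>. \<alpha> \<in> \<Delta> \<Longrightarrow> \<beta> \<in> \<Delta> \<Longrightarrow> T \<alpha> \<beta> = (if \<alpha> = \<beta> then \<one> else \<zero>)"
    and "\<And>\<alpha> i \<beta>. \<alpha> \<in> Q \<Longrightarrow> i < n \<Longrightarrow> \<beta> \<in> \<Delta> \<Longrightarrow> \<alpha> + e i \<in> Q \<Longrightarrow>
      T (\<alpha> + e i) \<beta> = (\<Oplus>\<gamma>\<in>\<Delta>. T \<alpha> \<gamma> \<otimes> T (\<gamma> + e i) \<beta>)"
    and "\<And>\<alpha> \<alpha>' i j \<beta>. \<alpha> \<in> border n P \<Longrightarrow> \<alpha>' \<in> border n P \<Longrightarrow> i < n \<Longrightarrow> j < n \<Longrightarrow> \<beta> \<in> \<Delta> \<Longrightarrow>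
      \<alpha> + e i = \<alpha>' + e j \<Longrightarrow> \<alpha> + e i \<in> border2 n P \<Longrightarrow>
      (\<Oplus>\<gamma>\<in>\<Delta>. T \<alpha> \<gamma> \<otimes> T (\<gamma> + e i) \<beta>) = (\<Oplus>\<gamma>\<in>\<Delta>. T \<alpha>' \<gamma> \<otimes> T (\<gamma> + e j) \<beta>)"
  using assms unfolding is_table_def by blast+

text \<open>The recursion of a normal table holds at all exponents, so in the border relations both
  sides equal the row of the common exponent.\<close>

lemma normal_table_is_table:
  assumes "normal_table w"
  shows "is_table w"
  unfolding is_table_def
proof (intro conjI ballI allI impI)
  note w = normal_tableD[OF assms]
  fix \<alpha> \<beta>
  show "\<beta> \<in> \<Delta> \<Longrightarrow> w \<alpha> \<beta> \<in> carrier B" by (rule w(1))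
  show "\<alpha> \<in> \<Delta> \<Longrightarrow> \<beta> \<in> \<Delta> \<Longrightarrow> w \<alpha> \<beta> = (if \<alpha> = \<beta> then \<one> else \<zero>)" by (rule w(2))
  fix i assume i: "i < n"
  show "w (\<alpha> + e i) \<beta> = (\<Oplus>\<gamma>\<in>\<Delta>. w \<alpha> \<gamma> \<otimes> w (\<gamma> + e i) \<beta>)" if "\<alpha> \<in> Q" "\<beta> \<in> \<Delta>"
    using that i Q_exp by (intro w(3)) auto
next
  note w = normal_tableD[OF assms]
  fix \<alpha> \<alpha>' i j \<beta>
  assume a: "\<alpha> \<in> border n P" "\<alpha>' \<in> border n P" "i < n" "j < n" "\<beta> \<in> \<Delta>" "\<alpha> + e i = \<alpha>' + e j"
  have ex: "\<alpha> \<in> exponents n" "\<alpha>' \<in> exponents n" using a Q_exp by blast+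
  show "(\<Oplus>\<gamma>\<in>\<Delta>. w \<alpha> \<gamma> \<otimes> w (\<gamma> + e i) \<beta>) = (\<Oplus>\<gamma>\<in>\<Delta>. w \<alpha>' \<gamma> \<otimes> w (\<gamma> + e j) \<beta>)"
    using w(3)[OF ex(1) a(3,5)] w(3)[OF ex(2) a(4,5)] a(6) by simp
qed

text \<open>Outside \<open>Q\<close> the rows are forced: the recursion computes a row from the
  previous one and from the rows at \<open>\<gamma> + e i\<close> with
  \<open>\<gamma> \<in> \<Delta>\<close>, and the latter lie in \<open>Q\<close>.\<close>

lemma normal_table_unique:
  assumes w: "normal_table w" and w': "normal_table w'"
    and eq: "\<And>\<alpha> \<beta>. \<alpha> \<in> Q \<Longrightarrow> \<beta> \<in> \<Delta> \<Longrightarrow> w \<alpha> \<beta> = w' \<alpha> \<beta>"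
    and "a \<in> exponents n" "\<beta> \<in> \<Delta>"
  shows "w a \<beta> = w' a \<beta>"
  using assms(4,5)
proof (induction a arbitrary: \<beta> rule: expo_induct)
  case zero
  then show ?case using normal_tableD(2)[OF w zero_\<Delta>] normal_tableD(2)[OF w' zero_\<Delta>] by simp
next
  case (add a i)
  have "(\<Oplus>\<gamma>\<in>\<Delta>. w a \<gamma> \<otimes> w (\<gamma> + e i) \<beta>) = (\<Oplus>\<gamma>\<in>\<Delta>. w' a \<gamma> \<otimes> w' (\<gamma> + e i) \<beta>)"
    using add normal_tableD(1)[OF w'] eq \<Delta>_add by (intro finsum_cong') auto
  then show ?case using add normal_tableD(3)[OF w] normal_tableD(3)[OF w'] by simp
qed

text \<open>Commutation of the matrices of x_i and x_j, entrywise. If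
  \<open>\<gamma> + e j + e i\<close> lies in \<open>Q\<close>, the recursion computes its row in
  two orders. Otherwise \<open>\<gamma> + e i\<close> and \<open>\<gamma> + e j\<close> are border
  elements whose common successor is in the second border, which is the situation of the last family
  of relations.\<close>

lemma table_commute:
  assumes T: "is_table T" and g: "\<gamma> \<in> \<Delta>" "i < n" "j < n" "\<beta> \<in> \<Delta>"
  shows "(\<Oplus>\<zeta>\<in>\<Delta>. T (\<gamma> + e j) \<zeta> \<otimes> T (\<zeta> + e i) \<beta>) = (\<Oplus>\<zeta>\<in>\<Delta>. T (\<gamma> + e i) \<zeta> \<otimes> T (\<zeta> + e j) \<beta>)"
proof -
  have ac: "\<gamma> + e j + e i = \<gamma> + e i + e j" by (simp add: ac_simps)
  have q: "\<gamma> + e i \<in> Q" "\<gamma> + e j \<in> Q" using g \<Delta>_add by auto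
  show ?thesis
  proof (cases "\<gamma> + e j + e i \<in> Q")
    case True
    have "T (\<gamma> + e j + e i) \<beta> = (\<Oplus>\<zeta>\<in>\<Delta>. T (\<gamma> + e j) \<zeta> \<otimes> T (\<zeta> + e i) \<beta>)"
      using T q g True unfolding is_table_def by blast
    moreover have "T (\<gamma> + e i + e j) \<beta> = (\<Oplus>\<zeta>\<in>\<Delta>. T (\<gamma> + e i) \<zeta> \<otimes> T (\<zeta> + e j) \<beta>)"
      using T q g True unfolding ac is_table_def by blast
    ultimately show ?thesis by (simp add: ac)
  next
    case False
    have 1: "\<gamma> + e j \<notin> P" using P_add[of "\<gamma> + e j" i] g False by blast
    have 2: "\<gamma> + e i \<notin> P" using P_add[of "\<gamma> + e i" j] g False by (auto simp: ac)
    have 3: "\<gamma> + e j + e i \<in> border2 n P"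
      using False q g unfolding border2_def border_def[of n "P \<union> border n P"] by blast
    from 1 2 q have "\<gamma> + e i \<in> border n P" "\<gamma> + e j \<in> border n P" by auto
    then show ?thesis using T g 3 ac unfolding is_table_def by blast
  qed
qed

text \<open>Each row arises from the row of the monomial 1 by applying one multiplication operator
  per variable factor. Commuting operators can be folded over a multiset, so the result depends on
  the exponent alone and the recursion holds by construction.\<close>

lemma table_extend:
  assumes T: "is_table T"
  shows "\<exists>w. normal_table w \<and> (\<forall>\<alpha>\<in>Q. \<forall>\<beta>\<in>\<Delta>. w \<alpha> \<beta> = T \<alpha> \<beta>)"
proof -
  have Tc [simp]: "T \<alpha> \<beta> \<in> carrier B" if "\<alpha> \<in> Q" "\<beta> \<in> \<Delta>" for \<alpha> \<beta> using T that unfolding is_table_def by blast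
  have Tc' [simp]: "T (\<alpha> + e i) \<beta> \<in> carrier B" if "\<alpha> \<in> \<Delta>" "i < n" "\<beta> \<in> \<Delta>" for \<alpha> i \<beta>
    using Tc[OF \<Delta>_add] that by blast
  let ?X = "\<Delta> \<rightarrow>\<^sub>E carrier B"
  \<comment> \<open>Multiplication by \<open>x\<^sub>i\<close> on coefficient vectors, extended by the identity so that these operators
    commute on the whole type, as \<open>fold_mset\<close> requires.\<close>
  define op where "op i v = (if i < n \<and> v \<in> ?X then (\<lambda>\<beta>\<in>\<Delta>. \<Oplus>\<gamma>\<in>\<Delta>. v \<gamma> \<otimes> T (\<gamma> + e i) \<beta>) else v)" for i v
  have op_X: "op i v \<in> ?X \<longleftrightarrow> v \<in> ?X" for i v
    unfolding op_def by (auto intro!: finsum_closed simp: PiE_mem)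
  have comm: "op i (op j v) = op j (op i v)" for i j v
  proof (cases "i < n \<and> j < n \<and> v \<in> ?X")
    case True
    then have v [simp]: "v \<gamma> \<in> carrier B" if "\<gamma> \<in> \<Delta>" for \<gamma> using that by auto
    have *: "op i (op j v) \<beta> = (\<Oplus>\<gamma>\<in>\<Delta>. v \<gamma> \<otimes> (\<Oplus>\<zeta>\<in>\<Delta>. T (\<gamma> + e j) \<zeta> \<otimes> T (\<zeta> + e i) \<beta>))"
      if "i < n" "j < n" "\<beta> \<in> \<Delta>" for i j \<beta>
    proof -
      have "op i (op j v) \<beta> = (\<Oplus>\<zeta>\<in>\<Delta>. op j v \<zeta> \<otimes> T (\<zeta> + e i) \<beta>)"
        using op_X[of j v] that True by (simp add: op_def[of i])
      also have "\<dots> = (\<Oplus>\<zeta>\<in>\<Delta>. (\<Oplus>\<gamma>\<in>\<Delta>. v \<gamma> \<otimes> T (\<gamma> + e j) \<zeta>) \<otimes> T (\<zeta> + e i) \<beta>)"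
        using that True by (intro finsum_cong') (auto simp: op_def)
      also have "\<dots> = (\<Oplus>\<gamma>\<in>\<Delta>. v \<gamma> \<otimes> (\<Oplus>\<zeta>\<in>\<Delta>. T (\<gamma> + e j) \<zeta> \<otimes> T (\<zeta> + e i) \<beta>))"
        using fin that by (intro vec_assoc) auto
      finally show ?thesis .
    qed
    show ?thesis
    proof (rule PiE_ext)
      show "op i (op j v) \<in> ?X" "op j (op i v) \<in> ?X" using True op_X by auto
      fix \<beta> assume "\<beta> \<in> \<Delta>"
      then show "op i (op j v) \<beta> = op j (op i v) \<beta>"
        using True by (auto simp: * table_commute[OF T, of _ i j \<beta>] intro!: finsum_cong')
    qed
  next
    case False
    then show ?thesis using op_X by (auto simp: op_def)
  qed
  interpret cf: comp_fun_commute op using comm by unfold_locales (auto simp: fun_eq_iff)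
  \<comment> \<open>The coefficient vector of the monomial 1, whose exponent 0 belongs to
    \<open>\<Delta>\<close>.\<close>
  define v0 where "v0 = (\<lambda>\<beta>\<in>\<Delta>. if \<beta> = 0 then \<one> else \<zero>)"
  \<comment> \<open>An exponent read as the multiset of its variables with multiplicities.\<close>
  define ms :: "expo \<Rightarrow> nat multiset" where "ms a = Abs_multiset (Poly_Mapping.lookup a)" for a
  have count: "count (ms a) = Poly_Mapping.lookup a" for a
    unfolding ms_def by (rule Abs_multiset_inverse) simp
  have ms_add: "ms (a + e i) = add_mset i (ms a)" for a i
    by (rule multiset_eqI) (simp add: count lookup_add Defs.unit_vec_def lookup_single when_def)
  have ms_0: "ms 0 = {#}" by (rule multiset_eqI) (simp add: count)
  define W where "W a = fold_mset op v0 (ms a)" for a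
  have W_0: "W 0 = v0" by (simp add: W_def ms_0)
  have W_add: "W (a + e i) = op i (W a)" for a i by (simp add: W_def ms_add)
  have "fold_mset op v0 M \<in> ?X" for M
    by (induction M) (auto simp: op_X v0_def)
  then have W_X: "W a \<in> ?X" for a by (simp add: W_def)
  then have Wc [simp]: "W a \<beta> \<in> carrier B" if "\<beta> \<in> \<Delta>" for a \<beta> using that by blast
  have W_rec: "W (a + e i) \<beta> = (\<Oplus>\<gamma>\<in>\<Delta>. W a \<gamma> \<otimes> T (\<gamma> + e i) \<beta>)" if "i < n" "\<beta> \<in> \<Delta>" for a i \<beta>
    using that W_X by (simp add: W_add op_def)
  \<comment> \<open>Agreement with \<open>T\<close> is proved by stripping variables:
    \<open>Q_down\<close> keeps the predecessor in \<open>Q\<close>, where the relations for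
    \<open>T\<close> apply.\<close>
  have W_T: "\<forall>\<beta>\<in>\<Delta>. W a \<beta> = T a \<beta>" if "a \<in> Q" for a
  proof -
    have "a \<in> exponents n" using that Q_exp by blast
    then show ?thesis using that
    proof (induction a rule: expo_induct)
      case zero
      then show ?case using T zero_\<Delta> unfolding is_table_def W_0 v0_def by auto
    next
      case (add a i)
      then have a: "a \<in> Q" using Q_down by blast
      show ?case
      proof
        fix \<beta> assume b: "\<beta> \<in> \<Delta>"
        have "W (a + e i) \<beta> = (\<Oplus>\<gamma>\<in>\<Delta>. T a \<gamma> \<otimes> T (\<gamma> + e i) \<beta>)"
          unfolding W_rec[OF add(2) b] using add a b by (intro finsum_cong') auto
        also have "\<dots> = T (a + e i) \<beta>"
          using is_tableD(3)[OF T a add(2) b add(4)] by simp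
        finally show "W (a + e i) \<beta> = T (a + e i) \<beta>" .
      qed
    qed
  qed
  have "normal_table W"
    unfolding normal_table_def
  proof (intro conjI ballI allI impI)
    fix \<alpha> \<beta> assume ab: "\<alpha> \<in> \<Delta>" "\<beta> \<in> \<Delta>"
    then have "W \<alpha> \<beta> = T \<alpha> \<beta>" using W_T \<Delta>_Q by blast
    then show "W \<alpha> \<beta> = (if \<alpha> = \<beta> then \<one> else \<zero>)" using T ab unfolding is_table_def by auto
  next
    fix \<alpha> i \<eta> assume "i < n" "\<eta> \<in> \<Delta>"
    then show "W (\<alpha> + e i) \<eta> = (\<Oplus>\<beta>\<in>\<Delta>. W \<alpha> \<beta> \<otimes> W (\<beta> + e i) \<eta>)"
      using W_T[OF \<Delta>_add] by (subst W_rec) (auto intro!: finsum_cong')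
  qed simp
  then show ?thesis using W_T by blast
qed

section \<open>Ideals with a monomial basis\<close>

abbreviation Pol where "Pol \<equiv> mpoly_ring B {..<n}"

definition table_ideal :: "(expo \<Rightarrow> expo \<Rightarrow> 'b) \<Rightarrow> (expo \<Rightarrow> 'b) set" where
  "table_ideal w = {p \<in> carrier Pol. \<forall>\<eta>\<in>\<Delta>. lin_ev B p (\<lambda>\<alpha>. w \<alpha> \<eta>) = \<zero>}"

lemma Pol_cring: "cring Pol" by (rule mpoly_cring[OF B])

lemma lin_ev_0: "lin_ev B (\<zero>\<^bsub>Pol\<^esub>) g = \<zero>"
  by (simp add: lin_ev_def mpoly_zero)

lemma Pol_carr: "p \<in> carrier Pol \<Longrightarrow> p a \<in> carrier B" by (simp add: mpoly_carrier)

lemma lin_ev_diff: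
  assumes p: "p \<in> carrier Pol" "q \<in> carrier Pol" and g: "\<And>a. g a \<in> carrier B"
  shows "lin_ev B (p \<ominus>\<^bsub>Pol\<^esub> q) g = lin_ev B p g \<ominus> lin_ev B q g"
proof -
  interpret Pol: cring Pol by (rule Pol_cring)
  have c: "lin_ev B p g \<in> carrier B" if "p \<in> carrier Pol" for p
    by (intro lin_ev_closed[OF B]) (auto simp: g Pol_carr that)
  have "lin_ev B ((p \<ominus>\<^bsub>Pol\<^esub> q) \<oplus>\<^bsub>Pol\<^esub> q) g = lin_ev B (p \<ominus>\<^bsub>Pol\<^esub> q) g \<oplus> lin_ev B q g"
    using p g by (intro lin_ev_add[OF B]) auto
  moreover have "(p \<ominus>\<^bsub>Pol\<^esub> q) \<oplus>\<^bsub>Pol\<^esub> q = p" using p by (simp add: Pol.minus_eq Pol.a_assoc Pol.l_neg)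
  ultimately show ?thesis using c[of p] c[of q] c[of "p \<ominus>\<^bsub>Pol\<^esub> q"] p by (simp add: minus_eq a_assoc r_neg)
qed

text \<open>By \<open>normal_table_add\<close>, the coordinates of x^a q are those of
  \<open>q\<close> multiplied by the matrix of x^a. They vanish together with the coordinates of
  \<open>q\<close>, and a general factor is a combination of monomials.\<close>

lemma table_ideal_ideal:
  assumes w: "normal_table w"
  shows "ideal (table_ideal w) Pol"
proof -
  interpret Pol: cring Pol by (rule Pol_cring)
  note wc = normal_tableD(1)[OF w]
  have mult: "p \<otimes>\<^bsub>Pol\<^esub> q \<in> table_ideal w" if p: "p \<in> carrier Pol" and q: "q \<in> table_ideal w" for p q
  proof -
    have qc: "q \<in> carrier Pol" and q0: "\<And>\<eta>. \<eta> \<in> \<Delta> \<Longrightarrow> lin_ev B q (\<lambda>\<alpha>. w \<alpha> \<eta>) = \<zero>"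
      using q by (auto simp: table_ideal_def)
    have "lin_ev B (p \<otimes>\<^bsub>Pol\<^esub> q) (\<lambda>\<alpha>. w \<alpha> \<eta>) = \<zero>" if h: "\<eta> \<in> \<Delta>" for \<eta>
    proof -
      have inner: "lin_ev B q (\<lambda>b. w (a + b) \<eta>) = \<zero>" if a: "Poly_Mapping.keys a \<subseteq> {..<n}" for a
      proof -
        have "lin_ev B q (\<lambda>b. w (a + b) \<eta>) = lin_ev B q (\<lambda>b. \<Oplus>\<beta>\<in>\<Delta>. w b \<beta> \<otimes> w (\<beta> + a) \<eta>)"
          using a h wc by (intro lin_ev_cong[OF B qc])
            (auto simp: normal_table_add[OF w, symmetric] exponents_def add.commute intro!: finsum_closed)
        also have "\<dots> = (\<Oplus>\<beta>\<in>\<Delta>. lin_ev B q (\<lambda>b. w b \<beta>) \<otimes> w (\<beta> + a) \<eta>)"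
          unfolding lin_ev_def using qc wc h fin by (intro vec_assoc[symmetric]) (auto simp: mpoly_carrier)
        also have "\<dots> = \<zero>" using wc h by (intro finsum_neutral) (auto simp: q0)
        finally show ?thesis .
      qed
      have "lin_ev B (p \<otimes>\<^bsub>Pol\<^esub> q) (\<lambda>\<alpha>. w \<alpha> \<eta>) = lin_ev B p (\<lambda>a. lin_ev B q (\<lambda>b. w (a + b) \<eta>))"
        using wc h by (intro lin_ev_mult[OF B p qc]) auto
      also have "\<dots> = lin_ev B p (\<lambda>_. \<zero>)"
        using p by (intro lin_ev_cong[OF B p]) (auto simp: inner)
      also have "\<dots> = \<zero>" unfolding lin_ev_def using p by (intro finsum_neutral) (auto simp: mpoly_carrier)
      finally show ?thesis .
    qed
    then show ?thesis using p qc by (simp add: table_ideal_def)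
  qed
  have sub: "subgroup (table_ideal w) (add_monoid Pol)"
  proof (rule Pol.add.subgroupI)
    show "table_ideal w \<subseteq> carrier Pol" by (auto simp: table_ideal_def)
    show "table_ideal w \<noteq> {}" using Pol.zero_closed by (auto simp: table_ideal_def lin_ev_0)
    fix p assume p: "p \<in> table_ideal w"
    have "\<zero>\<^bsub>Pol\<^esub> \<ominus>\<^bsub>Pol\<^esub> p \<in> table_ideal w" using p wc by (auto simp: table_ideal_def lin_ev_diff lin_ev_0 minus_eq)
    then show "\<ominus>\<^bsub>Pol\<^esub> p \<in> table_ideal w" using p by (simp add: Pol.minus_eq table_ideal_def)
    fix q assume q: "q \<in> table_ideal w"
    show "p \<oplus>\<^bsub>Pol\<^esub> q \<in> table_ideal w" using p q wc by (auto simp: table_ideal_def lin_ev_add[OF B])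
  qed
  show ?thesis
  proof (rule idealI[OF Pol.ring_axioms sub])
    fix a x assume "a \<in> table_ideal w" "x \<in> carrier Pol"
    then show "x \<otimes>\<^bsub>Pol\<^esub> a \<in> table_ideal w" "a \<otimes>\<^bsub>Pol\<^esub> x \<in> table_ideal w"
      using mult[of x a] Pol.m_comm[of a x] by (auto simp: table_ideal_def)
  qed
qed

abbreviation A where "A I \<equiv> mpoly_quot B {..<n} I"
abbreviation X where "X I \<equiv> monom_class n B I"

text \<open>The index set is a parameter so that sums over \<open>\<Delta>\<close> can be built up
  by induction on subsets.\<close>

definition lincomb :: "expo set \<Rightarrow> (expo \<Rightarrow> 'b) \<Rightarrow> expo \<Rightarrow> 'b" where
  "lincomb D c = (\<lambda>m. if m \<in> D then c m else \<zero>)"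

lemma quotient: "ideal I Pol \<Longrightarrow> mpoly_quotient B {..<n} I Pol (A I) (a_r_coset Pol I)"
  by (intro mpoly_quotient.intro) (auto simp: B)

lemma lincomb_closed:
  assumes "\<And>\<beta>. \<beta> \<in> \<Delta> \<Longrightarrow> c \<beta> \<in> carrier B"
  shows "lincomb \<Delta> c \<in> carrier Pol"
proof -
  have "{m. lincomb \<Delta> c m \<noteq> \<zero>} \<subseteq> \<Delta>" by (auto simp: lincomb_def)
  then show ?thesis using assms \<Delta>_exp fin finite_subset[of "{m. lincomb \<Delta> c m \<noteq> \<zero>}" \<Delta>]
    by (auto simp: mpoly_carrier lincomb_def exponents_def split: if_splits)
qed

lemma lin_ev_lincomb:
  assumes "\<And>\<beta>. \<beta> \<in> \<Delta> \<Longrightarrow> c \<beta> \<in> carrier B" and w: "normal_table w" and h: "\<eta> \<in> \<Delta>"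
  shows "lin_ev B (lincomb \<Delta> c) (\<lambda>\<alpha>. w \<alpha> \<eta>) = c \<eta>"
proof -
  have "lin_ev B (lincomb \<Delta> c) (\<lambda>\<alpha>. w \<alpha> \<eta>) = (\<Oplus>\<alpha>\<in>\<Delta>. lincomb \<Delta> c \<alpha> \<otimes> w \<alpha> \<eta>)"
    using assms fin normal_tableD(1)[OF w] by (intro lin_ev_superset) (auto simp: lincomb_def)
  also have "\<dots> = (\<Oplus>\<alpha>\<in>\<Delta>. c \<alpha> \<otimes> (if \<alpha> = \<eta> then \<one> else \<zero>))"
    using assms by (intro finsum_cong') (auto simp: lincomb_def normal_tableD(2)[OF w])
  also have "\<dots> = c \<eta>" using assms fin by (intro sum_delta(1)) auto
  finally show ?thesis .
qed

section \<open>Classes modulo an ideal and combinations of monomials\<close>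

context
  fixes I
  assumes I: "ideal I Pol"
begin

interpretation mpoly_quotient B "{..<n}" I Pol "A I" "a_r_coset Pol I" by (rule quotient[OF I])

lemma A_algebra: "algebra B (A I)" by (rule algebra_Q)

lemma X_eq: "X I \<alpha> = I +>\<^bsub>Pol\<^esub> mterm B \<one> \<alpha>"
  by (simp add: monom_class_def mpoly_monom_eq)

lemma X_closed: "\<alpha> \<in> exponents n \<Longrightarrow> X I \<alpha> \<in> carrier (A I)"
  unfolding X_eq by (rule \<pi>.hom_closed) (auto simp: exponents_def intro: mterm_P)

lemma X_add: "a \<in> exponents n \<Longrightarrow> c \<in> exponents n \<Longrightarrow> X I (a + c) = X I a \<otimes>\<^bsub>A I\<^esub> X I c"
  unfolding X_eq by (subst \<pi>.hom_mult[symmetric]) (auto simp: exponents_def mterm_mult[OF B] intro: mterm_P)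

lemma comb_eq:
  assumes "\<And>\<beta>. \<beta> \<in> \<Delta> \<Longrightarrow> c \<beta> \<in> carrier B"
  shows "(\<Oplus>\<^bsub>A I\<^esub>\<beta>\<in>\<Delta>. c \<beta> \<odot>\<^bsub>A I\<^esub> X I \<beta>) = I +>\<^bsub>Pol\<^esub> lincomb \<Delta> c"
proof -
  have m: "mterm B (c \<beta>) \<beta> \<in> carrier Pol" if "\<beta> \<in> \<Delta>" for \<beta>
    using that assms \<Delta>_exp by (intro mterm_P) (auto simp: exponents_def)
  have sums: "(\<Oplus>\<^bsub>Pol\<^esub>\<beta>\<in>D. mterm B (c \<beta>) \<beta>) = lincomb D c" if "D \<subseteq> \<Delta>" for D
    using finite_subset[OF that fin] that
  proof (induction D rule: finite_induct)
    case empty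
    then show ?case by (simp add: lincomb_def mpoly_zero)
  next
    case (insert x D)
    then show ?case using m assms by (subst P.finsum_insert) (auto simp: lincomb_def mpoly_add mterm_def fun_eq_iff Pi_def)
  qed
  have "(\<Oplus>\<^bsub>A I\<^esub>\<beta>\<in>\<Delta>. c \<beta> \<odot>\<^bsub>A I\<^esub> X I \<beta>) = (\<Oplus>\<^bsub>A I\<^esub>\<beta>\<in>\<Delta>. I +>\<^bsub>Pol\<^esub> mterm B (c \<beta>) \<beta>)"
  proof (intro Q.finsum_cong' refl)
    show "(\<lambda>\<beta>. I +>\<^bsub>Pol\<^esub> mterm B (c \<beta>) \<beta>) \<in> \<Delta> \<rightarrow> carrier (A I)" using m \<pi>.hom_closed by blast
    fix \<beta> assume "\<beta> \<in> \<Delta>"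
    then show "c \<beta> \<odot>\<^bsub>A I\<^esub> X I \<beta> = I +>\<^bsub>Pol\<^esub> mterm B (c \<beta>) \<beta>"
      using assms \<Delta>_exp by (subst \<pi>_mterm) (auto simp: exponents_def monom_class_def)
  qed
  also have "\<dots> = I +>\<^bsub>Pol\<^esub> (\<Oplus>\<^bsub>Pol\<^esub>\<beta>\<in>\<Delta>. mterm B (c \<beta>) \<beta>)"
    using m by (subst \<pi>.hom_finsum) (auto simp: comp_def)
  also have "(\<Oplus>\<^bsub>Pol\<^esub>\<beta>\<in>\<Delta>. mterm B (c \<beta>) \<beta>) = lincomb \<Delta> c" by (rule sums) simp
  finally show ?thesis .
qed

end

text \<open>The combination of the x^\<beta> whose coefficients are the coordinates of
  \<open>p\<close> has the same coordinates as \<open>p\<close>, because rows over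
  \<open>\<Delta>\<close> are unit vectors. The difference therefore lies in the ideal.\<close>

lemma table_ideal_expand:
  assumes w: "normal_table w" and p: "p \<in> carrier Pol"
  shows "table_ideal w +>\<^bsub>Pol\<^esub> p = (\<Oplus>\<^bsub>A (table_ideal w)\<^esub>\<beta>\<in>\<Delta>. lin_ev B p (\<lambda>\<alpha>. w \<alpha> \<beta>) \<odot>\<^bsub>A (table_ideal w)\<^esub> X (table_ideal w) \<beta>)"
proof -
  let ?I = "table_ideal w"
  note I = table_ideal_ideal[OF w]
  interpret Pol: cring Pol by (rule Pol_cring)
  let ?c = "\<lambda>\<beta>. lin_ev B p (\<lambda>\<alpha>. w \<alpha> \<beta>)"
  have c: "?c \<beta> \<in> carrier B" if "\<beta> \<in> \<Delta>" for \<beta>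
    using normal_tableD(1)[OF w that] p by (intro lin_ev_closed[OF B]) (auto simp: Pol_carr)
  have l: "lincomb \<Delta> ?c \<in> carrier Pol" using c by (rule lincomb_closed)
  have "p \<ominus>\<^bsub>Pol\<^esub> lincomb \<Delta> ?c \<in> ?I"
    unfolding table_ideal_def using p l c normal_tableD(1)[OF w]
    by (auto simp: lin_ev_diff lin_ev_lincomb[OF _ w] minus_eq r_neg)
  then have "?I +>\<^bsub>Pol\<^esub> p = ?I +>\<^bsub>Pol\<^esub> lincomb \<Delta> ?c"
    using Pol.quotient_eq_iff_same_a_r_cos[OF I p l] by simp
  then show ?thesis using comb_eq[OF I c] by simp
qed

lemma lincomb_diff_in_table_ideal:
  assumes w: "normal_table w" and c: "\<And>j. j \<in> \<Delta> \<Longrightarrow> c j \<in> carrier B" and d: "\<And>j. j \<in> \<Delta> \<Longrightarrow> d j \<in> carrier B"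
    and m: "lincomb \<Delta> c \<ominus>\<^bsub>Pol\<^esub> lincomb \<Delta> d \<in> table_ideal w" and j: "j \<in> \<Delta>"
  shows "c j = d j"
proof -
  have l: "lincomb \<Delta> c \<in> carrier Pol" "lincomb \<Delta> d \<in> carrier Pol" using c d lincomb_closed by blast+
  have "lin_ev B (lincomb \<Delta> c \<ominus>\<^bsub>Pol\<^esub> lincomb \<Delta> d) (\<lambda>\<alpha>. w \<alpha> j) = \<zero>"
    using m j unfolding table_ideal_def by blast
  moreover have "lin_ev B (lincomb \<Delta> c \<ominus>\<^bsub>Pol\<^esub> lincomb \<Delta> d) (\<lambda>\<alpha>. w \<alpha> j) = c j \<ominus> d j"
    using lin_ev_diff[OF l, of "\<lambda>\<alpha>. w \<alpha> j"] normal_tableD(1)[OF w j] lin_ev_lincomb[OF c w j] lin_ev_lincomb[OF d w j]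
    by simp
  ultimately show ?thesis using r_right_minus_eq[OF c[OF j] d[OF j]] by simp
qed

text \<open>Spanning is \<open>table_ideal_expand\<close>; independence holds because the
  coordinates of a combination of basis monomials are its coefficients.\<close>

lemma table_ideal_basis:
  assumes w: "normal_table w"
  shows "is_basis B (A (table_ideal w)) \<Delta> (X (table_ideal w))"
proof -
  let ?I = "table_ideal w"
  note I = table_ideal_ideal[OF w]
  interpret mq: mpoly_quotient B "{..<n}" ?I Pol "A ?I" "a_r_coset Pol ?I" by (rule quotient[OF I])
  show ?thesis
  proof (rule mq.Q.is_basisI)
    show "X ?I \<beta> \<in> carrier (A ?I)" if "\<beta> \<in> \<Delta>" for \<beta> using that \<Delta>_exp X_closed[OF I] by blast
  next
    fix v assume "v \<in> carrier (A ?I)"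
    then obtain p where p: "p \<in> carrier Pol" "v = ?I +>\<^bsub>Pol\<^esub> p" using mq.\<pi>_surj by blast
    have "lin_ev B p (\<lambda>\<alpha>. w \<alpha> \<beta>) \<in> carrier B" if "\<beta> \<in> \<Delta>" for \<beta>
      using normal_tableD(1)[OF w that] p by (intro lin_ev_closed[OF B]) (auto simp: Pol_carr)
    then show "\<exists>c. (\<forall>j\<in>\<Delta>. c j \<in> carrier B) \<and> v = (\<Oplus>\<^bsub>A ?I\<^esub>j\<in>\<Delta>. c j \<odot>\<^bsub>A ?I\<^esub> X ?I j)"
      using table_ideal_expand[OF w p(1)] p(2)
      by (intro exI[of _ "\<lambda>\<beta>. lin_ev B p (\<lambda>\<alpha>. w \<alpha> \<beta>)"] conjI ballI) auto
  next
    fix c d j assume c: "\<And>j. j \<in> \<Delta> \<Longrightarrow> c j \<in> carrier B" and d: "\<And>j. j \<in> \<Delta> \<Longrightarrow> d j \<in> carrier B"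
      and eq: "(\<Oplus>\<^bsub>A ?I\<^esub>j\<in>\<Delta>. c j \<odot>\<^bsub>A ?I\<^esub> X ?I j) = (\<Oplus>\<^bsub>A ?I\<^esub>j\<in>\<Delta>. d j \<odot>\<^bsub>A ?I\<^esub> X ?I j)" and j: "j \<in> \<Delta>"
    have l: "lincomb \<Delta> c \<in> carrier Pol" "lincomb \<Delta> d \<in> carrier Pol" using c d lincomb_closed by auto
    have 1: "(\<Oplus>\<^bsub>A ?I\<^esub>j\<in>\<Delta>. c j \<odot>\<^bsub>A ?I\<^esub> X ?I j) = ?I +>\<^bsub>Pol\<^esub> lincomb \<Delta> c"
      by (rule comb_eq[OF I]) (rule c)
    have 2: "(\<Oplus>\<^bsub>A ?I\<^esub>j\<in>\<Delta>. d j \<odot>\<^bsub>A ?I\<^esub> X ?I j) = ?I +>\<^bsub>Pol\<^esub> lincomb \<Delta> d"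
      by (rule comb_eq[OF I]) (rule d)
    have "?I +>\<^bsub>Pol\<^esub> lincomb \<Delta> c = ?I +>\<^bsub>Pol\<^esub> lincomb \<Delta> d"
      by (rule trans[OF 1[symmetric] trans[OF eq 2]])
    then have m: "lincomb \<Delta> c \<ominus>\<^bsub>Pol\<^esub> lincomb \<Delta> d \<in> ?I"
      unfolding mq.P.quotient_eq_iff_same_a_r_cos[OF I l] .
    show "c j = d j" by (rule lincomb_diff_in_table_ideal[OF w c d m j])
  qed
qed

text \<open>The value outside \<open>exponents n\<close> is fixed to zero because
  \<open>normal_table\<close> asks for entries in the carrier at every exponent.\<close>

definition coord_table :: "(expo \<Rightarrow> 'b) set \<Rightarrow> expo \<Rightarrow> expo \<Rightarrow> 'b" where
  "coord_table I \<alpha> \<beta> = (if \<alpha> \<in> exponents n then coords B (A I) \<Delta> (X I) (X I \<alpha>) \<beta> else \<zero>)"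

section \<open>The table of an ideal with a monomial basis\<close>

context
  fixes I
  assumes I: "ideal I Pol" and basis: "is_basis B (A I) \<Delta> (X I)"
begin

interpretation mpoly_quotient B "{..<n}" I Pol "A I" "a_r_coset Pol I" by (rule quotient[OF I])

lemma coord_table_closed: "\<beta> \<in> \<Delta> \<Longrightarrow> coord_table I \<alpha> \<beta> \<in> carrier B"
  using is_basis_coords(1)[OF basis X_closed[OF I]] by (simp add: coord_table_def)

lemma coord_table_expand:
  assumes "\<alpha> \<in> exponents n"
  shows "X I \<alpha> = (\<Oplus>\<^bsub>A I\<^esub>\<beta>\<in>\<Delta>. coord_table I \<alpha> \<beta> \<odot>\<^bsub>A I\<^esub> X I \<beta>)"
  using assms is_basis_coords(2)[OF basis X_closed[OF I assms]] by (simp add: coord_table_def)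

lemma coord_table_unique:
  assumes "\<alpha> \<in> exponents n" "\<And>\<beta>. \<beta> \<in> \<Delta> \<Longrightarrow> c \<beta> \<in> carrier B"
    "X I \<alpha> = (\<Oplus>\<^bsub>A I\<^esub>\<beta>\<in>\<Delta>. c \<beta> \<odot>\<^bsub>A I\<^esub> X I \<beta>)" "\<beta> \<in> \<Delta>"
  shows "coord_table I \<alpha> \<beta> = c \<beta>"
  using assms Q.coords_unique[OF basis X_closed[OF I assms(1)]] by (simp add: coord_table_def)

text \<open>The monomial at \<open>\<alpha> + e i\<close> is expanded in two ways: directly, and by
  expanding x^\<alpha>, multiplying by x_i and expanding every x^\<beta> x_i again. Comparing
  coefficients in the basis gives the recursion.\<close>

lemma coord_table_normal: "normal_table (coord_table I)"
  unfolding normal_table_def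
proof (intro conjI ballI allI impI)
  note Xc = X_closed[OF I] and X\<Delta> = subsetD[OF \<Delta>_exp]
  fix \<alpha> \<beta> assume ab: "\<alpha> \<in> \<Delta>" "\<beta> \<in> \<Delta>"
  have "X I \<alpha> = (\<Oplus>\<^bsub>A I\<^esub>\<beta>\<in>\<Delta>. (if \<alpha> = \<beta> then \<one> else \<zero>) \<odot>\<^bsub>A I\<^esub> X I \<beta>)"
    using Q.sum_delta_smult[of \<Delta> "X I" \<alpha>] fin ab Xc X\<Delta> by simp
  then show "coord_table I \<alpha> \<beta> = (if \<alpha> = \<beta> then \<one> else \<zero>)"
    using ab X\<Delta> by (intro coord_table_unique) auto
next
  note Xc = X_closed[OF I] and X\<Delta> = subsetD[OF \<Delta>_exp]
  fix \<alpha> i \<eta> assume a: "\<alpha> \<in> exponents n" "i < n" "\<eta> \<in> \<Delta>"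
  let ?w = "coord_table I"
  have ei: "e i \<in> exponents n" using a by simp
  have "X I (\<alpha> + e i) = (\<Oplus>\<^bsub>A I\<^esub>\<beta>\<in>\<Delta>. ?w \<alpha> \<beta> \<odot>\<^bsub>A I\<^esub> X I \<beta>) \<otimes>\<^bsub>A I\<^esub> X I (e i)"
    using X_add[OF I a(1) ei] coord_table_expand[OF a(1)] by simp
  also have "\<dots> = (\<Oplus>\<^bsub>A I\<^esub>\<beta>\<in>\<Delta>. (?w \<alpha> \<beta> \<odot>\<^bsub>A I\<^esub> X I \<beta>) \<otimes>\<^bsub>A I\<^esub> X I (e i))"
    using fin ei by (intro Q.finsum_ldistr) (auto simp: coord_table_closed Xc X\<Delta>)
  also have "\<dots> = (\<Oplus>\<^bsub>A I\<^esub>\<beta>\<in>\<Delta>. ?w \<alpha> \<beta> \<odot>\<^bsub>A I\<^esub> (\<Oplus>\<^bsub>A I\<^esub>\<eta>\<in>\<Delta>. ?w (\<beta> + e i) \<eta> \<odot>\<^bsub>A I\<^esub> X I \<eta>))"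
  proof (intro Q.finsum_cong' refl)
    fix \<beta> assume b: "\<beta> \<in> \<Delta>"
    have "(?w \<alpha> \<beta> \<odot>\<^bsub>A I\<^esub> X I \<beta>) \<otimes>\<^bsub>A I\<^esub> X I (e i) = ?w \<alpha> \<beta> \<odot>\<^bsub>A I\<^esub> X I (\<beta> + e i)"
      using b ei by (simp add: X_add[OF I] X\<Delta> Q.smult_assoc2 coord_table_closed Xc)
    then show "(?w \<alpha> \<beta> \<odot>\<^bsub>A I\<^esub> X I \<beta>) \<otimes>\<^bsub>A I\<^esub> X I (e i) = ?w \<alpha> \<beta> \<odot>\<^bsub>A I\<^esub> (\<Oplus>\<^bsub>A I\<^esub>\<eta>\<in>\<Delta>. ?w (\<beta> + e i) \<eta> \<odot>\<^bsub>A I\<^esub> X I \<eta>)"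
      using coord_table_expand[of "\<beta> + e i"] b ei by (simp add: exponents_add X\<Delta>)
  qed (auto simp: coord_table_closed Xc X\<Delta> intro!: Q.finsum_closed)
  also have "\<dots> = (\<Oplus>\<^bsub>A I\<^esub>\<eta>\<in>\<Delta>. (\<Oplus>\<beta>\<in>\<Delta>. ?w \<alpha> \<beta> \<otimes> ?w (\<beta> + e i) \<eta>) \<odot>\<^bsub>A I\<^esub> X I \<eta>)"
    using fin by (intro Q.vec_assoc_smult[symmetric]) (auto simp: coord_table_closed Xc X\<Delta>)
  finally show "?w (\<alpha> + e i) \<eta> = (\<Oplus>\<beta>\<in>\<Delta>. ?w \<alpha> \<beta> \<otimes> ?w (\<beta> + e i) \<eta>)"
    using a ei by (intro coord_table_unique) (auto simp: exponents_add coord_table_closed intro!: finsum_closed)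
qed (rule coord_table_closed)

lemma coset_expand:
  assumes "p \<in> carrier Pol"
  shows "I +>\<^bsub>Pol\<^esub> p = (\<Oplus>\<^bsub>A I\<^esub>\<beta>\<in>\<Delta>. lin_ev B p (\<lambda>\<alpha>. coord_table I \<alpha> \<beta>) \<odot>\<^bsub>A I\<^esub> X I \<beta>)"
  using B assms
proof (induction p rule: mpoly_add_induct)
  note Xc = X_closed[OF I] and X\<Delta> = subsetD[OF \<Delta>_exp]
  case zero
  show ?case unfolding lin_ev_0 \<pi>.hom_zero
    by (intro Q.finsum_neutral[symmetric]) (auto simp: Xc X\<Delta>)
next
  note Xc = X_closed[OF I] and X\<Delta> = subsetD[OF \<Delta>_exp]
  let ?w = "coord_table I"
  case (add c a q)
  have a: "a \<in> exponents n" using add by (simp add: exponents_def)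
  have m: "mterm B c a \<in> carrier Pol" using add by (intro mterm_P)
  have lc: "lin_ev B q (\<lambda>\<alpha>. ?w \<alpha> \<beta>) \<in> carrier B" if "\<beta> \<in> \<Delta>" for \<beta>
    using coord_table_closed[OF that] add(3) by (intro lin_ev_closed[OF B]) (auto simp: Pol_carr)
  have l: "lin_ev B (mterm B c a \<oplus>\<^bsub>Pol\<^esub> q) (\<lambda>\<alpha>. ?w \<alpha> \<beta>) = c \<otimes> ?w a \<beta> \<oplus> lin_ev B q (\<lambda>\<alpha>. ?w \<alpha> \<beta>)" if "\<beta> \<in> \<Delta>" for \<beta>
    using add m coord_table_closed[OF that] by (simp add: lin_ev_add[OF B] lin_ev_mterm[OF B])
  have "I +>\<^bsub>Pol\<^esub> mterm B c a = c \<odot>\<^bsub>A I\<^esub> X I a"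
    using add by (subst \<pi>_mterm) (auto simp: monom_class_def)
  also have "\<dots> = (\<Oplus>\<^bsub>A I\<^esub>\<beta>\<in>\<Delta>. c \<odot>\<^bsub>A I\<^esub> (?w a \<beta> \<odot>\<^bsub>A I\<^esub> X I \<beta>))"
    unfolding coord_table_expand[OF a]
    using add fin by (intro Q.finsum_smult_ldistr) (auto simp: coord_table_closed Xc X\<Delta>)
  finally have "I +>\<^bsub>Pol\<^esub> (mterm B c a \<oplus>\<^bsub>Pol\<^esub> q) =
     (\<Oplus>\<^bsub>A I\<^esub>\<beta>\<in>\<Delta>. c \<odot>\<^bsub>A I\<^esub> (?w a \<beta> \<odot>\<^bsub>A I\<^esub> X I \<beta>)) \<oplus>\<^bsub>A I\<^esub> (\<Oplus>\<^bsub>A I\<^esub>\<beta>\<in>\<Delta>. lin_ev B q (\<lambda>\<alpha>. ?w \<alpha> \<beta>) \<odot>\<^bsub>A I\<^esub> X I \<beta>)"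
    using add m by simp
  also have "\<dots> = (\<Oplus>\<^bsub>A I\<^esub>\<beta>\<in>\<Delta>. c \<odot>\<^bsub>A I\<^esub> (?w a \<beta> \<odot>\<^bsub>A I\<^esub> X I \<beta>) \<oplus>\<^bsub>A I\<^esub> lin_ev B q (\<lambda>\<alpha>. ?w \<alpha> \<beta>) \<odot>\<^bsub>A I\<^esub> X I \<beta>)"
    using add lc by (intro Q.finsum_addf[symmetric]) (auto simp: coord_table_closed Xc X\<Delta>)
  also have "\<dots> = (\<Oplus>\<^bsub>A I\<^esub>\<beta>\<in>\<Delta>. lin_ev B (mterm B c a \<oplus>\<^bsub>Pol\<^esub> q) (\<lambda>\<alpha>. ?w \<alpha> \<beta>) \<odot>\<^bsub>A I\<^esub> X I \<beta>)"
    using add lc by (intro Q.finsum_cong')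
      (auto simp: l coord_table_closed Xc X\<Delta> Q.smult_l_distr Q.smult_assoc1)
  finally show ?case .
qed

text \<open>A class vanishes iff its coordinates do. Consequently the ideal is determined by its
  table, which makes the chart injective.\<close>

lemma ideal_eq_table_ideal: "I = table_ideal (coord_table I)"
proof -
  note Xc = X_closed[OF I] and X\<Delta> = subsetD[OF \<Delta>_exp]
  have "p \<in> I \<longleftrightarrow> (\<forall>\<eta>\<in>\<Delta>. lin_ev B p (\<lambda>\<alpha>. coord_table I \<alpha> \<eta>) = \<zero>)" if p: "p \<in> carrier Pol" for p
  proof -
    have z: "\<zero>\<^bsub>A I\<^esub> = (\<Oplus>\<^bsub>A I\<^esub>\<beta>\<in>\<Delta>. \<zero> \<odot>\<^bsub>A I\<^esub> X I \<beta>)"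
      by (intro Q.finsum_neutral[symmetric]) (auto simp: Xc X\<Delta>)
    have lc: "lin_ev B p (\<lambda>\<alpha>. coord_table I \<alpha> \<beta>) \<in> carrier B" if "\<beta> \<in> \<Delta>" for \<beta>
      using coord_table_closed[OF that] p by (intro lin_ev_closed[OF B]) (auto simp: Pol_carr)
    have "p \<in> I \<longleftrightarrow> I +>\<^bsub>Pol\<^esub> p = \<zero>\<^bsub>A I\<^esub>" using \<pi>_zero_iff[OF p] by simp
    also have "\<dots> \<longleftrightarrow> (\<forall>\<eta>\<in>\<Delta>. lin_ev B p (\<lambda>\<alpha>. coord_table I \<alpha> \<eta>) = \<zero>)"
      unfolding coset_expand[OF p]
    proof
      assume "(\<Oplus>\<^bsub>A I\<^esub>\<beta>\<in>\<Delta>. lin_ev B p (\<lambda>\<alpha>. coord_table I \<alpha> \<beta>) \<odot>\<^bsub>A I\<^esub> X I \<beta>) = \<zero>\<^bsub>A I\<^esub>"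
      then show "\<forall>\<eta>\<in>\<Delta>. lin_ev B p (\<lambda>\<alpha>. coord_table I \<alpha> \<eta>) = \<zero>"
        using lc unfolding z by (intro ballI Q.is_basis_unique[OF basis]) auto
    next
      assume "\<forall>\<eta>\<in>\<Delta>. lin_ev B p (\<lambda>\<alpha>. coord_table I \<alpha> \<eta>) = \<zero>"
      then show "(\<Oplus>\<^bsub>A I\<^esub>\<beta>\<in>\<Delta>. lin_ev B p (\<lambda>\<alpha>. coord_table I \<alpha> \<beta>) \<odot>\<^bsub>A I\<^esub> X I \<beta>) = \<zero>\<^bsub>A I\<^esub>"
        by (intro Q.finsum_neutral) (auto simp: Xc X\<Delta>)
    qed
    finally show ?thesis .
  qed
  then show ?thesis unfolding table_ideal_def using I.Icarr by blast
qed

end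

text \<open>Modulo the ideal, x^\<alpha> expands with row \<alpha> of \<open>w\<close> as
  coefficients, and coordinates are unique. This is the other half of the correspondence begun in
  \<open>ideal_eq_table_ideal\<close> and gives surjectivity of the chart.\<close>

lemma coord_table_table_ideal:
  assumes w: "normal_table w" and "\<alpha> \<in> exponents n" "\<beta> \<in> \<Delta>"
  shows "coord_table (table_ideal w) \<alpha> \<beta> = w \<alpha> \<beta>"
proof (rule coord_table_unique[OF table_ideal_ideal[OF w] table_ideal_basis[OF w] assms(2) _ _ assms(3)])
  have "mterm B \<one> \<alpha> \<in> carrier Pol" using assms by (intro mterm_closed[OF B]) (auto simp: exponents_def)
  from table_ideal_expand[OF w this]
  show "X (table_ideal w) \<alpha> = (\<Oplus>\<^bsub>A (table_ideal w)\<^esub>\<beta>\<in>\<Delta>. w \<alpha> \<beta> \<odot>\<^bsub>A (table_ideal w)\<^esub> X (table_ideal w) \<beta>)"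
  proof -
    interpret mpoly_quotient B "{..<n}" "table_ideal w" Pol "A (table_ideal w)" "a_r_coset Pol (table_ideal w)"
      by (rule quotient[OF table_ideal_ideal[OF w]])
    have "lin_ev B (mterm B \<one> \<alpha>) (\<lambda>\<alpha>. w \<alpha> \<beta>) = w \<alpha> \<beta>" if "\<beta> \<in> \<Delta>" for \<beta>
      using normal_tableD(1)[OF w that] by (simp add: lin_ev_mterm[OF B])
    then show ?thesis
      unfolding X_eq[OF table_ideal_ideal[OF w], of \<alpha>] table_ideal_expand[OF w \<open>mterm B \<one> \<alpha> \<in> carrier Pol\<close>]
      using normal_tableD(1)[OF w] X_closed[OF table_ideal_ideal[OF w]] \<Delta>_exp
      by (intro Q.finsum_cong') auto
  qed
qed (use normal_tableD(1)[OF w] in auto)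

end

section \<open>The coordinate ring represents the points\<close>

text \<open>A global basis is a local one with f = 1, an element outside every prime ideal; the
  basis only has to be renumbered by \<open>{..<card J}\<close>.\<close>

lemma (in Module.module) basis_locally_free:
  assumes basis: "is_basis R M J b" and fin: "finite J"
  shows "locally_free_of_rank R M (card J)"
proof -
  obtain g where g: "bij_betw g {..<card J} J"
    using ex_bij_betw_nat_finite[OF fin] by (auto simp: lessThan_atLeast0)
  have gJ: "g j \<in> J" if "j < card J" for j using g that by (auto simp: bij_betw_def)
  have b: "b j \<in> carrier M" if "j \<in> J" for j using basis that by (auto simp: is_basis_def)
  have re: "(\<Oplus>\<^bsub>M\<^esub>j\<in>J. c j \<odot>\<^bsub>M\<^esub> b j) = (\<Oplus>\<^bsub>M\<^esub>j\<in>{..<card J}. c (g j) \<odot>\<^bsub>M\<^esub> b (g j))"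
    if "\<And>j. j \<in> J \<Longrightarrow> c j \<in> carrier R" for c
  proof -
    have "J = g ` {..<card J}" "inj_on g {..<card J}" using g by (auto simp: bij_betw_def)
    moreover have "(\<Oplus>\<^bsub>M\<^esub>j\<in>g ` {..<card J}. c j \<odot>\<^bsub>M\<^esub> b j) = (\<Oplus>\<^bsub>M\<^esub>j\<in>{..<card J}. c (g j) \<odot>\<^bsub>M\<^esub> b (g j))"
      using g that b gJ by (intro M.finsum_reindex) (auto simp: bij_betw_def)
    ultimately show ?thesis by metis
  qed
  have "free_away R M \<one> (card J)"
    unfolding free_away_def
  proof (intro bexI[of _ "b \<circ> g"] conjI ballI impI allI)
    show "b \<circ> g \<in> {..<card J} \<rightarrow> carrier M" using b gJ by auto
    fix v assume v: "v \<in> carrier M"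
    let ?c = "coords R M J b v"
    have "v = (\<Oplus>\<^bsub>M\<^esub>j\<in>{..<card J}. ?c (g j) \<odot>\<^bsub>M\<^esub> b (g j))"
      using is_basis_coords[OF basis v] re[of ?c] by simp
    then have "(\<one> [^] (0::nat)) \<odot>\<^bsub>M\<^esub> v = (\<Oplus>\<^bsub>M\<^esub>j\<in>{..<card J}. (?c \<circ> g) j \<odot>\<^bsub>M\<^esub> (b \<circ> g) j)"
      using v by simp
    moreover have "?c \<circ> g \<in> {..<card J} \<rightarrow> carrier R" using is_basis_coords(1)[OF basis v] gJ by auto
    ultimately show "\<exists>s::nat. \<exists>c\<in>{..<card J} \<rightarrow> carrier R.
      (\<one> [^] s) \<odot>\<^bsub>M\<^esub> v = (\<Oplus>\<^bsub>M\<^esub>j\<in>{..<card J}. c j \<odot>\<^bsub>M\<^esub> (b \<circ> g) j)"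
      by blast
  next
    fix c j assume c: "c \<in> {..<card J} \<rightarrow> carrier R" and z: "(\<Oplus>\<^bsub>M\<^esub>j\<in>{..<card J}. c j \<odot>\<^bsub>M\<^esub> (b \<circ> g) j) = \<zero>\<^bsub>M\<^esub>"
      and j: "j < card J"
    define c' where "c' = c \<circ> inv_into {..<card J} g"
    have c'g: "c' (g i) = c i" if "i < card J" for i
      using g that unfolding c'_def bij_betw_def by (simp add: inv_into_f_f)
    have c'c: "c' i \<in> carrier R" if "i \<in> J" for i
      using c g that unfolding c'_def bij_betw_def by (metis PiE comp_apply inv_into_into)
    have "(\<Oplus>\<^bsub>M\<^esub>j\<in>J. c' j \<odot>\<^bsub>M\<^esub> b j) = (\<Oplus>\<^bsub>M\<^esub>j\<in>{..<card J}. c' (g j) \<odot>\<^bsub>M\<^esub> b (g j))"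
      by (rule re) (rule c'c)
    also have "\<dots> = (\<Oplus>\<^bsub>M\<^esub>j\<in>{..<card J}. c j \<odot>\<^bsub>M\<^esub> (b \<circ> g) j)"
      using c b gJ by (intro M.finsum_cong') (auto simp: c'g)
    also have "\<dots> = (\<Oplus>\<^bsub>M\<^esub>j\<in>J. \<zero> \<odot>\<^bsub>M\<^esub> b j)"
      unfolding z using b by (intro M.finsum_neutral[symmetric]) auto
    finally have "c' (g j) = \<zero>"
      using c'c gJ[OF j] by (intro is_basis_unique[OF basis]) auto
    then have "(\<one> [^] (0::nat)) \<otimes> c j = \<zero>" using c'g[OF j] by simp
    then show "\<exists>s::nat. (\<one> [^] s) \<otimes> c j = \<zero>" by blast
  qed
  then show ?thesis
    unfolding locally_free_of_rank_def
    by (metis DiffI R.one_closed ideal.one_imp_carrier primeideal.I_notcarr primeideal_def)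
qed

text \<open>\<open>frame\<close> uses only the ring \<open>B\<close>; here the
  \<open>k\<close>-algebra structure enters, as required for homomorphisms from the coordinate
  algebra.\<close>

locale chart = frame n P \<Delta> B
  for n P \<Delta> and B :: "('k, 'b) module" (structure) +
  fixes k :: "'k ring"
  assumes alg: "algebra k B"
begin

lemma k: "cring k" using alg by (simp add: algebra_def Module.module_def)

sublocale k: cring k by (rule k)

abbreviation RA where "RA \<equiv> coord_alg k n P \<Delta>"
abbreviation CP where "CP \<equiv> coord_poly_ring k n P \<Delta>"
abbreviation var where "var \<alpha> \<beta> \<equiv> mpoly_var k (\<alpha>, \<beta>)"
abbreviation entry where "entry \<equiv> coord_entry k n P \<Delta>"

section \<open>Homomorphisms from the coordinate algebra as tables\<close>

lemma CP_cring: "cring CP" unfolding coord_poly_ring_def by (rule mpoly_cring[OF k])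

lemma var_closed: "\<alpha> \<in> Q \<Longrightarrow> \<beta> \<in> \<Delta> \<Longrightarrow> var \<alpha> \<beta> \<in> carrier CP"
  unfolding coord_poly_ring_def mpoly_var_eq by (intro mterm_closed[OF k]) (auto simp: coord_vars_def)

text \<open>A homomorphism kills a difference iff it identifies the two terms, and it commutes with
  the finite sums. It starts at the free polynomial ring, so the equivalence applies to an
  evaluation map as well as to a map that factors through the quotient.\<close>

lemma vanish_iff_table:
  assumes \<psi>: "ring_hom_cring CP B \<psi>"
  shows "(\<forall>r\<in>coord_relations k n P \<Delta>. \<psi> r = \<zero>) \<longleftrightarrow> is_table (\<lambda>\<alpha> \<beta>. \<psi> (var \<alpha> \<beta>))"
proof -
  interpret \<psi>: ring_hom_cring CP B \<psi> by (rule \<psi>)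
  have d: "x \<in> carrier CP \<Longrightarrow> y \<in> carrier CP \<Longrightarrow> \<psi> (x \<ominus>\<^bsub>CP\<^esub> y) = \<zero> \<longleftrightarrow> \<psi> x = \<psi> y" for x y
    using r_right_minus_eq[of "\<psi> x" "\<psi> y"] by (simp add: \<psi>.R.minus_eq minus_eq)
  have vQ: "\<alpha> \<in> \<Delta> \<Longrightarrow> \<beta> \<in> \<Delta> \<Longrightarrow> var \<alpha> \<beta> \<in> carrier CP" for \<alpha> \<beta> using var_closed \<Delta>_Q by blast
  have va: "\<alpha> \<in> \<Delta> \<Longrightarrow> i < n \<Longrightarrow> \<beta> \<in> \<Delta> \<Longrightarrow> var (\<alpha> + e i) \<beta> \<in> carrier CP" for \<alpha> i \<beta> using var_closed \<Delta>_add by blast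
  have sc: "(\<Oplus>\<^bsub>CP\<^esub>\<gamma>\<in>\<Delta>. var \<alpha> \<gamma> \<otimes>\<^bsub>CP\<^esub> var (\<gamma> + e i) \<beta>) \<in> carrier CP" if "\<alpha> \<in> Q" "i < n" "\<beta> \<in> \<Delta>" for \<alpha> i \<beta>
    using that va var_closed by (intro \<psi>.R.finsum_closed) auto
  have s: "\<psi> (\<Oplus>\<^bsub>CP\<^esub>\<gamma>\<in>\<Delta>. var \<alpha> \<gamma> \<otimes>\<^bsub>CP\<^esub> var (\<gamma> + e i) \<beta>) = (\<Oplus>\<gamma>\<in>\<Delta>. \<psi> (var \<alpha> \<gamma>) \<otimes> \<psi> (var (\<gamma> + e i) \<beta>))"
    if "\<alpha> \<in> Q" "i < n" "\<beta> \<in> \<Delta>" for \<alpha> i \<beta>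
    using that va var_closed[OF that(1)] by (subst \<psi>.hom_finsum) (auto simp: comp_def intro!: finsum_cong')
  have 1: "\<psi> (var \<alpha> \<beta> \<ominus>\<^bsub>CP\<^esub> (if \<alpha> = \<beta> then \<one>\<^bsub>CP\<^esub> else \<zero>\<^bsub>CP\<^esub>)) = \<zero> \<longleftrightarrow> \<psi> (var \<alpha> \<beta>) = (if \<alpha> = \<beta> then \<one> else \<zero>)"
    if "\<alpha> \<in> \<Delta>" "\<beta> \<in> \<Delta>" for \<alpha> \<beta> using that vQ by (subst d) auto
  have 2: "\<psi> (var (\<alpha> + e i) \<beta> \<ominus>\<^bsub>CP\<^esub> (\<Oplus>\<^bsub>CP\<^esub>\<gamma>\<in>\<Delta>. var \<alpha> \<gamma> \<otimes>\<^bsub>CP\<^esub> var (\<gamma> + e i) \<beta>)) = \<zero> \<longleftrightarrow>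
     \<psi> (var (\<alpha> + e i) \<beta>) = (\<Oplus>\<gamma>\<in>\<Delta>. \<psi> (var \<alpha> \<gamma>) \<otimes> \<psi> (var (\<gamma> + e i) \<beta>))"
    if "\<alpha> \<in> Q" "i < n" "\<alpha> + e i \<in> Q" "\<beta> \<in> \<Delta>" for \<alpha> i \<beta>
    using that d[OF var_closed[OF that(3,4)] sc[OF that(1,2,4)]] s[OF that(1,2,4)] by simp
  have 3: "\<psi> ((\<Oplus>\<^bsub>CP\<^esub>\<gamma>\<in>\<Delta>. var \<alpha> \<gamma> \<otimes>\<^bsub>CP\<^esub> var (\<gamma> + e i) \<beta>) \<ominus>\<^bsub>CP\<^esub> (\<Oplus>\<^bsub>CP\<^esub>\<gamma>\<in>\<Delta>. var \<alpha>' \<gamma> \<otimes>\<^bsub>CP\<^esub> var (\<gamma> + e j) \<beta>)) = \<zero> \<longleftrightarrow>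
     (\<Oplus>\<gamma>\<in>\<Delta>. \<psi> (var \<alpha> \<gamma>) \<otimes> \<psi> (var (\<gamma> + e i) \<beta>)) = (\<Oplus>\<gamma>\<in>\<Delta>. \<psi> (var \<alpha>' \<gamma>) \<otimes> \<psi> (var (\<gamma> + e j) \<beta>))"
    if "\<alpha> \<in> border n P" "\<alpha>' \<in> border n P" "i < n" "j < n" "\<beta> \<in> \<Delta>" for \<alpha> \<alpha>' i j \<beta>
    using that d[OF sc[of \<alpha> i \<beta>] sc[of \<alpha>' j \<beta>]] s[of \<alpha> i \<beta>] s[of \<alpha>' j \<beta>] by simp
  have c: "\<forall>\<alpha>\<in>Q. \<forall>\<beta>\<in>\<Delta>. \<psi> (var \<alpha> \<beta>) \<in> carrier B" using var_closed by auto
  have "(\<forall>r\<in>coord_relations k n P \<Delta>. \<psi> r = \<zero>) \<longleftrightarrow>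
    (\<forall>\<alpha>\<in>\<Delta>. \<forall>\<beta>\<in>\<Delta>. \<psi> (var \<alpha> \<beta> \<ominus>\<^bsub>CP\<^esub> (if \<alpha> = \<beta> then \<one>\<^bsub>CP\<^esub> else \<zero>\<^bsub>CP\<^esub>)) = \<zero>) \<and>
    (\<forall>\<alpha>\<in>Q. \<forall>i<n. \<forall>\<beta>\<in>\<Delta>. \<alpha> + e i \<in> Q \<longrightarrow>
       \<psi> (var (\<alpha> + e i) \<beta> \<ominus>\<^bsub>CP\<^esub> (\<Oplus>\<^bsub>CP\<^esub>\<gamma>\<in>\<Delta>. var \<alpha> \<gamma> \<otimes>\<^bsub>CP\<^esub> var (\<gamma> + e i) \<beta>)) = \<zero>) \<and>
    (\<forall>\<alpha>\<in>border n P. \<forall>\<alpha>'\<in>border n P. \<forall>i<n. \<forall>j<n. \<forall>\<beta>\<in>\<Delta>. \<alpha> + e i = \<alpha>' + e j \<longrightarrow> \<alpha> + e i \<in> border2 n P \<longrightarrow>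
       \<psi> ((\<Oplus>\<^bsub>CP\<^esub>\<gamma>\<in>\<Delta>. var \<alpha> \<gamma> \<otimes>\<^bsub>CP\<^esub> var (\<gamma> + e i) \<beta>) \<ominus>\<^bsub>CP\<^esub> (\<Oplus>\<^bsub>CP\<^esub>\<gamma>\<in>\<Delta>. var \<alpha>' \<gamma> \<otimes>\<^bsub>CP\<^esub> var (\<gamma> + e j) \<beta>)) = \<zero>)"
    unfolding coord_relations_def Let_def by blast
  also have "\<dots> \<longleftrightarrow> is_table (\<lambda>\<alpha> \<beta>. \<psi> (var \<alpha> \<beta>))"
    unfolding is_table_def eqTrueI[OF c] simp_thms
    by (rule conj_cong, (intro ball_cong refl 1; assumption), rule conj_cong,
      (intro ball_cong refl iff_allI imp_cong 2; assumption), (intro ball_cong refl iff_allI imp_cong 3; assumption))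
  finally show ?thesis .
qed

lemma relations_closed: "coord_relations k n P \<Delta> \<subseteq> carrier CP"
proof -
  interpret CP: cring CP by (rule CP_cring)
  have vQ: "\<alpha> \<in> \<Delta> \<Longrightarrow> \<beta> \<in> \<Delta> \<Longrightarrow> var \<alpha> \<beta> \<in> carrier CP" for \<alpha> \<beta> using var_closed \<Delta>_Q by blast
  have va: "\<alpha> \<in> \<Delta> \<Longrightarrow> i < n \<Longrightarrow> \<beta> \<in> \<Delta> \<Longrightarrow> var (\<alpha> + e i) \<beta> \<in> carrier CP" for \<alpha> i \<beta> using var_closed \<Delta>_add by blast
  have sc: "(\<Oplus>\<^bsub>CP\<^esub>\<gamma>\<in>\<Delta>. var \<alpha> \<gamma> \<otimes>\<^bsub>CP\<^esub> var (\<gamma> + e i) \<beta>) \<in> carrier CP" if "\<alpha> \<in> Q" "i < n" "\<beta> \<in> \<Delta>" for \<alpha> i \<beta>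
    using that va var_closed by (intro CP.finsum_closed) auto
  show ?thesis
    unfolding coord_relations_def Let_def
    by (auto intro!: CP.minus_closed sc intro: vQ var_closed)
qed

lemma coord_ideal_ideal: "ideal (coord_ideal k n P \<Delta>) CP"
proof -
  interpret CP: cring CP by (rule CP_cring)
  show ?thesis unfolding coord_ideal_def by (rule CP.genideal_ideal[OF relations_closed])
qed

lemma coord_quotient: "mpoly_quotient k (coord_vars n P \<Delta>) (coord_ideal k n P \<Delta>) CP RA (a_r_coset CP (coord_ideal k n P \<Delta>))"
  using coord_ideal_ideal by (intro mpoly_quotient.intro k) (auto simp: coord_poly_ring_def coord_alg_def)

sublocale cq: mpoly_quotient k "coord_vars n P \<Delta>" "coord_ideal k n P \<Delta>" CP RA "a_r_coset CP (coord_ideal k n P \<Delta>)"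
  by (rule coord_quotient)

lemma entry_eq: "entry \<alpha> \<beta> = coord_ideal k n P \<Delta> +>\<^bsub>CP\<^esub> var \<alpha> \<beta>"
  by (simp add: coord_entry_def)

lemma entry_closed: "\<alpha> \<in> Q \<Longrightarrow> \<beta> \<in> \<Delta> \<Longrightarrow> entry \<alpha> \<beta> \<in> carrier RA"
  unfolding entry_eq by (intro cq.\<pi>.hom_closed var_closed)

lemma RA_cring: "cring RA" using cq.algebra_Q by (simp add: algebra_def)

lemma alg_hom_ring_hom: "\<phi> \<in> alg_hom k RA B \<Longrightarrow> ring_hom_cring RA B \<phi>"
  using RA_cring B by (intro ring_hom_cringI) (auto simp: alg_hom_def)

lemma hom_table:
  assumes \<phi>: "\<phi> \<in> alg_hom k RA B"
  shows "is_table (\<lambda>\<alpha> \<beta>. \<phi> (entry \<alpha> \<beta>))"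
proof -
  interpret \<phi>: ring_hom_cring RA B \<phi> by (rule alg_hom_ring_hom[OF \<phi>])
  let ?\<psi> = "\<phi> \<circ> a_r_coset CP (coord_ideal k n P \<Delta>)"
  have "?\<psi> \<in> Ring.ring_hom CP B"
    by (rule ring_hom_trans[OF cq.\<pi>_hom]) (rule \<phi>.homh)
  then have \<psi>: "ring_hom_cring CP B ?\<psi>" by (rule ring_hom_cringI[OF CP_cring B])
  have "?\<psi> r = \<zero>" if "r \<in> coord_relations k n P \<Delta>" for r
  proof -
    have "r \<in> coord_ideal k n P \<Delta>"
      unfolding coord_ideal_def using cq.P.genideal_self[OF relations_closed] that by blast
    then have "coord_ideal k n P \<Delta> +>\<^bsub>CP\<^esub> r = \<zero>\<^bsub>RA\<^esub>"
      using cq.\<pi>_zero_iff relations_closed that by blast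
    then show ?thesis by simp
  qed
  then show ?thesis using vanish_iff_table[OF \<psi>] by (simp add: entry_eq)
qed

text \<open>The evaluation that sends the variables to the entries of \<open>T\<close> kills the
  relations. Its kernel is an ideal, so it contains the ideal generated by them, and the evaluation
  descends to the quotient.\<close>

lemma table_hom:
  assumes T: "is_table T"
  shows "\<exists>\<phi>\<in>alg_hom k RA B. \<forall>\<alpha>\<in>Q. \<forall>\<beta>\<in>\<Delta>. \<phi> (entry \<alpha> \<beta>) = T \<alpha> \<beta>"
proof -
  have "\<exists>ev\<in>Ring.ring_hom (mpoly_ring k (coord_vars n P \<Delta>)) B.
    (\<forall>c\<in>carrier k. ev (mterm k c 0) = c \<odot> \<one>) \<and> (\<forall>v\<in>coord_vars n P \<Delta>. ev (mpoly_var k v) = (case v of (\<alpha>, \<beta>) \<Rightarrow> T \<alpha> \<beta>))"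
    using is_tableD(1)[OF T] by (intro mpoly_eval[OF k alg]) (auto simp: coord_vars_def)
  then obtain ev where ev: "ev \<in> Ring.ring_hom CP B" and const: "\<And>c. c \<in> carrier k \<Longrightarrow> ev (mterm k c 0) = c \<odot> \<one>"
    and evT: "\<And>\<alpha> \<beta>. \<alpha> \<in> Q \<Longrightarrow> \<beta> \<in> \<Delta> \<Longrightarrow> ev (var \<alpha> \<beta>) = T \<alpha> \<beta>"
    by (auto simp: coord_vars_def coord_poly_ring_def)
  have evr: "ring_hom_cring CP B ev" by (rule ring_hom_cringI[OF CP_cring B ev])
  interpret ev: ring_hom_cring CP B ev by (rule evr)
  have "is_table (\<lambda>\<alpha> \<beta>. ev (var \<alpha> \<beta>))"
    unfolding is_table_def
  proof (intro conjI ballI allI impI)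
    have sum_eq: "(\<Oplus>\<gamma>\<in>\<Delta>. ev (var \<alpha> \<gamma>) \<otimes> ev (var (\<gamma> + e i) \<beta>)) = (\<Oplus>\<gamma>\<in>\<Delta>. T \<alpha> \<gamma> \<otimes> T (\<gamma> + e i) \<beta>)"
      if "\<alpha> \<in> Q" "i < n" "\<beta> \<in> \<Delta>" for \<alpha> i \<beta>
      using that evT[OF \<Delta>_add] is_tableD(1)[OF T] \<Delta>_add by (intro finsum_cong') (auto simp: evT)
    fix \<alpha> \<beta>
    show "ev (var \<alpha> \<beta>) \<in> carrier B" if "\<alpha> \<in> Q" "\<beta> \<in> \<Delta>" using var_closed that by auto
    show "ev (var \<alpha> \<beta>) = (if \<alpha> = \<beta> then \<one> else \<zero>)" if "\<alpha> \<in> \<Delta>" "\<beta> \<in> \<Delta>"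
      using evT[of \<alpha> \<beta>] is_tableD(2)[OF T] \<Delta>_Q that by auto
    fix i assume i: "i < n"
    show "ev (var (\<alpha> + e i) \<beta>) = (\<Oplus>\<gamma>\<in>\<Delta>. ev (var \<alpha> \<gamma>) \<otimes> ev (var (\<gamma> + e i) \<beta>))"
      if "\<alpha> \<in> Q" "\<beta> \<in> \<Delta>" "\<alpha> + e i \<in> Q"
      using evT[OF that(3,2)] sum_eq[OF that(1) i that(2)] is_tableD(3)[OF T that(1) i that(2,3)] by simp
    fix \<alpha>' j
    show "(\<Oplus>\<gamma>\<in>\<Delta>. ev (var \<alpha> \<gamma>) \<otimes> ev (var (\<gamma> + e i) \<beta>)) = (\<Oplus>\<gamma>\<in>\<Delta>. ev (var \<alpha>' \<gamma>) \<otimes> ev (var (\<gamma> + e j) \<beta>))"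
      if "\<alpha> \<in> border n P" "\<alpha>' \<in> border n P" "j < n" "\<beta> \<in> \<Delta>" "\<alpha> + e i = \<alpha>' + e j" "\<alpha> + e i \<in> border2 n P"
      using sum_eq[of \<alpha> i \<beta>] sum_eq[of \<alpha>' j \<beta>] is_tableD(4)[OF T that(1,2) i that(3-6)] that i by simp
  qed
  then have van: "\<forall>r\<in>coord_relations k n P \<Delta>. ev r = \<zero>" using vanish_iff_table[OF evr] by simp
  have kerI: "ideal {p \<in> carrier CP. ev p = \<zero>} CP"
    using ring_hom_ring.kernel_is_ideal[OF ring_hom_ringI2[OF cq.P.ring_axioms ring_axioms ev]]
    unfolding a_kernel_def' .
  have "coord_ideal k n P \<Delta> \<subseteq> {p \<in> carrier CP. ev p = \<zero>}"
    unfolding coord_ideal_def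
    by (rule cq.P.genideal_minimal[OF kerI]) (use van relations_closed in blast)
  then have "ev p = \<zero>" if "p \<in> coord_ideal k n P \<Delta>" for p using that by blast
  from cq.lift_hom[OF alg ev const this]
  obtain \<phi> where "\<phi> \<in> alg_hom k RA B" "\<forall>p\<in>carrier CP. \<phi> (coord_ideal k n P \<Delta> +>\<^bsub>CP\<^esub> p) = ev p" by blast
  then show ?thesis using evT var_closed by (intro bexI[of _ \<phi>]) (auto simp: entry_eq)
qed

lemma alg_hom_eqI:
  assumes "\<phi> \<in> alg_hom k RA B" "\<psi> \<in> alg_hom k RA B"
    "\<And>\<alpha> \<beta>. \<alpha> \<in> Q \<Longrightarrow> \<beta> \<in> \<Delta> \<Longrightarrow> \<phi> (entry \<alpha> \<beta>) = \<psi> (entry \<alpha> \<beta>)"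
  shows "\<phi> = \<psi>"
  using assms by (intro cq.hom_eqI[OF alg]) (auto simp: coord_vars_def entry_eq)

section \<open>The chart as a bijection from ideals to homomorphisms\<close>

abbreviation points where "points \<equiv> hilbert_points_on n \<Delta> B"

text \<open>Local freeness of rank \<open>card \<Delta>\<close> is implied by the basis, through
  \<open>basis_locally_free\<close>.\<close>

lemma points_iff: "I \<in> points \<longleftrightarrow> ideal I Pol \<and> is_basis B (A I) \<Delta> (X I)"
proof -
  have "locally_free_of_rank B (A I) (card \<Delta>)" if "ideal I Pol" "is_basis B (A I) \<Delta> (X I)"
    using module.basis_locally_free[OF _ that(2) fin] A_algebra[OF that(1)] by (simp add: algebra_def)
  then show ?thesis by (auto simp: hilbert_points_on_def hilbert_points_def)
qed

lemma pointsD: "I \<in> points \<Longrightarrow> ideal I Pol" "I \<in> points \<Longrightarrow> is_basis B (A I) \<Delta> (X I)"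
  by (auto simp: points_iff)

abbreviation ch where "ch \<equiv> hilbert_chart k n P \<Delta> B"

text \<open>This justifies the definite description in \<open>hilbert_chart\<close>. A suitable
  homomorphism exists because the table of \<open>I\<close> satisfies the relations; it is unique
  because its values on the entries are coordinates in a basis and the entries generate.\<close>

lemma chart_props:
  assumes I: "I \<in> points"
  shows "ch I \<in> alg_hom k RA B"
    and "\<And>\<alpha> \<beta>. \<alpha> \<in> Q \<Longrightarrow> \<beta> \<in> \<Delta> \<Longrightarrow> ch I (entry \<alpha> \<beta>) = coord_table I \<alpha> \<beta>"
proof -
  note I' = pointsD[OF I]
  let ?P = "\<lambda>\<phi>. \<phi> \<in> alg_hom k RA B \<and> (\<forall>\<alpha>\<in>Q. X I \<alpha> = (\<Oplus>\<^bsub>A I\<^esub>\<beta>\<in>\<Delta>. \<phi> (entry \<alpha> \<beta>) \<odot>\<^bsub>A I\<^esub> X I \<beta>))"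
  interpret AI: algebra B "A I" by (rule A_algebra[OF I'(1)])
  have val: "\<phi> (entry \<alpha> \<beta>) = coord_table I \<alpha> \<beta>" if "?P \<phi>" "\<alpha> \<in> Q" "\<beta> \<in> \<Delta>" for \<phi> \<alpha> \<beta>
  proof -
    interpret \<phi>: ring_hom_cring RA B \<phi> using that alg_hom_ring_hom by blast
    show ?thesis using that Q_exp entry_closed
      by (intro coord_table_unique[OF I', symmetric]) auto
  qed
  obtain \<phi> where \<phi>: "\<phi> \<in> alg_hom k RA B" "\<forall>\<alpha>\<in>Q. \<forall>\<beta>\<in>\<Delta>. \<phi> (entry \<alpha> \<beta>) = coord_table I \<alpha> \<beta>"
    using table_hom[OF normal_table_is_table[OF coord_table_normal[OF I']]] by blast
  have P\<phi>: "?P \<phi>"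
  proof (intro conjI ballI \<phi>(1))
    fix \<alpha> assume a: "\<alpha> \<in> Q"
    have "X I \<alpha> = (\<Oplus>\<^bsub>A I\<^esub>\<beta>\<in>\<Delta>. coord_table I \<alpha> \<beta> \<odot>\<^bsub>A I\<^esub> X I \<beta>)"
      using a Q_exp by (intro coord_table_expand[OF I']) auto
    also have "\<dots> = (\<Oplus>\<^bsub>A I\<^esub>\<beta>\<in>\<Delta>. \<phi> (entry \<alpha> \<beta>) \<odot>\<^bsub>A I\<^esub> X I \<beta>)"
      using \<phi>(2) a coord_table_closed[OF I'] X_closed[OF I'(1)] \<Delta>_exp
      by (intro AI.M.finsum_cong') (auto simp: Pi_def)
    finally show "X I \<alpha> = (\<Oplus>\<^bsub>A I\<^esub>\<beta>\<in>\<Delta>. \<phi> (entry \<alpha> \<beta>) \<odot>\<^bsub>A I\<^esub> X I \<beta>)" .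
  qed
  have uniq: "\<psi> = \<phi>" if "?P \<psi>" for \<psi>
    using that P\<phi> val[OF that] val[OF P\<phi>] by (intro alg_hom_eqI) auto
  have "?P (ch I)" unfolding hilbert_chart_def by (rule theI[of ?P, OF P\<phi>]) (rule uniq)
  then show "ch I \<in> alg_hom k RA B" "\<And>\<alpha> \<beta>. \<alpha> \<in> Q \<Longrightarrow> \<beta> \<in> \<Delta> \<Longrightarrow> ch I (entry \<alpha> \<beta>) = coord_table I \<alpha> \<beta>"
    using val by blast+
qed

text \<open>Injectivity: the rows over \<open>Q\<close> determine the normal table, which determines
  the ideal. Surjectivity: the values of a homomorphism on the entries form a table, and the ideal
  of its normal extension is mapped to this homomorphism.\<close>

lemma chart_bij: "bij_betw ch points (alg_hom k RA B)"
proof (rule bij_betw_imageI)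
  show "inj_on ch points"
  proof (rule inj_onI)
    fix I J assume I: "I \<in> points" and J: "J \<in> points" and eq: "ch I = ch J"
    have "coord_table I \<alpha> \<beta> = coord_table J \<alpha> \<beta>" if "\<alpha> \<in> Q" "\<beta> \<in> \<Delta>" for \<alpha> \<beta>
      using chart_props(2)[OF I that] chart_props(2)[OF J that] eq by simp
    then have t: "coord_table I a \<beta> = coord_table J a \<beta>" if "a \<in> exponents n" "\<beta> \<in> \<Delta>" for a \<beta>
      using that coord_table_normal[OF pointsD[OF I]] coord_table_normal[OF pointsD[OF J]] normal_table_unique by blast
    have "table_ideal (coord_table I) = table_ideal (coord_table J)"
      unfolding table_ideal_def
    proof (intro Collect_cong conj_cong refl ball_cong)
      fix p \<eta> assume p: "p \<in> carrier Pol" and h: "\<eta> \<in> \<Delta>"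
      have "lin_ev B p (\<lambda>\<alpha>. coord_table I \<alpha> \<eta>) = lin_ev B p (\<lambda>\<alpha>. coord_table J \<alpha> \<eta>)"
        using t h coord_table_closed[OF pointsD[OF J]] by (intro lin_ev_cong[OF B p]) (auto simp: exponents_def)
      then show "lin_ev B p (\<lambda>\<alpha>. coord_table I \<alpha> \<eta>) = \<zero> \<longleftrightarrow> lin_ev B p (\<lambda>\<alpha>. coord_table J \<alpha> \<eta>) = \<zero>" by simp
    qed
    then show "I = J"
      using ideal_eq_table_ideal[OF pointsD[OF I]] ideal_eq_table_ideal[OF pointsD[OF J]] by simp
  qed
  show "ch ` points = alg_hom k RA B"
  proof
    show "ch ` points \<subseteq> alg_hom k RA B" using chart_props(1) by blast
    show "alg_hom k RA B \<subseteq> ch ` points"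
    proof
      fix \<phi> assume \<phi>: "\<phi> \<in> alg_hom k RA B"
      obtain w where w: "normal_table w" "\<forall>\<alpha>\<in>Q. \<forall>\<beta>\<in>\<Delta>. w \<alpha> \<beta> = \<phi> (entry \<alpha> \<beta>)"
        using table_extend[OF hom_table[OF \<phi>]] by blast
      let ?I = "table_ideal w"
      have I: "?I \<in> points" using table_ideal_ideal[OF w(1)] table_ideal_basis[OF w(1)] by (simp add: points_iff)
      have "ch ?I = \<phi>"
      proof (rule alg_hom_eqI[OF chart_props(1)[OF I] \<phi>])
        fix \<alpha> \<beta> assume a: "\<alpha> \<in> Q" "\<beta> \<in> \<Delta>"
        have "\<alpha> \<in> exponents n" using a(1) Q_exp by blast
        then show "ch ?I (entry \<alpha> \<beta>) = \<phi> (entry \<alpha> \<beta>)"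
          using chart_props(2)[OF I a] coord_table_table_ideal[OF w(1) _ a(2)] w(2) a by simp
      qed
      then show "\<phi> \<in> ch ` points" using I by blast
    qed
  qed
qed

end

section \<open>Open subschemes\<close>

text \<open>The preimage of a prime \<qq> of \<open>B\<close> is prime and contains \<open>f\<close>
  iff \<qq> contains \<open>\<phi> f\<close>. So the image misses the vanishing set iff
  \<open>\<phi> f\<close> lies in no prime ideal, which characterizes units.\<close>

lemma open_points_iff:
  assumes A: "cring A" and B: "cring B" and \<phi>: "\<phi> \<in> alg_hom k A B" and f: "f \<in> carrier A"
  shows "\<phi> \<in> open_subscheme_points k A (prime_spectrum A - vanishing_set A f) B \<longleftrightarrow> \<phi> f \<in> Units B"
proof -
  interpret A: cring A by fact
  interpret B: cring B by fact
  have h: "\<phi> \<in> Ring.ring_hom A B" using \<phi> by (simp add: alg_hom_def)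
  interpret \<phi>: ring_hom_cring A B \<phi> by (rule ring_hom_cringI[OF A B h])
  have pr: "primeideal {a \<in> carrier A. \<phi> a \<in> \<qq>} A" if "primeideal \<qq> B" for \<qq>
    by (rule ring_hom_ring.primeideal_vimage[OF ring_hom_ringI2[OF A.ring_axioms B.ring_axioms h] A that])
  have "\<phi> \<in> open_subscheme_points k A (prime_spectrum A - vanishing_set A f) B \<longleftrightarrow>
    (\<forall>\<qq>. primeideal \<qq> B \<longrightarrow> \<phi> f \<notin> \<qq>)"
    using \<phi> pr f by (auto simp: open_subscheme_points_def prime_spectrum_def vanishing_set_def)
  then show ?thesis using B.unit_iff_not_in_prime[of "\<phi> f"] f by simp
qed

section \<open>Change of charts\<close>

lemma (in ring_hom_cring) hom_npow: "x \<in> carrier R \<Longrightarrow> h (x [^] (n::nat)) = h x [^]\<^bsub>S\<^esub> n"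
  by (induction n) auto

lemma (in cring) inverse_matrix_cong:
  assumes "\<And>i j. i \<in> I \<Longrightarrow> j \<in> J \<Longrightarrow> X i j = X' i j"
    and X: "inverse_matrix R I J X Y"
  shows "inverse_matrix R I J X' Y"
proof -
  have c: "X' i j \<in> carrier R" "Y j i \<in> carrier R" if "i \<in> I" "j \<in> J" for i j
    using X assms(1)[OF that, symmetric] that by (auto simp: inverse_matrix_def)
  have 1: "(\<Oplus>j\<in>J. X i j \<otimes> Y j i') = (\<Oplus>j\<in>J. X' i j \<otimes> Y j i')" if "i \<in> I" "i' \<in> I" for i i'
    using that c assms(1) by (intro finsum_cong') auto
  have 2: "(\<Oplus>i\<in>I. Y j i \<otimes> X i j') = (\<Oplus>i\<in>I. Y j i \<otimes> X' i j')" if "j \<in> J" "j' \<in> J" for j j'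
    using that c assms(1) by (intro finsum_cong') auto
  show ?thesis
    unfolding inverse_matrix_def
  proof (intro conjI ballI)
    fix i i' assume "i \<in> I" "i' \<in> I"
    then show "(\<Oplus>j\<in>J. X' i j \<otimes> Y j i') = (if i = i' then \<one> else \<zero>)"
      using X 1[of i i'] by (simp add: inverse_matrix_def)
  next
    fix j j' assume "j \<in> J" "j' \<in> J"
    then show "(\<Oplus>i\<in>I. Y j i \<otimes> X' i j') = (if j = j' then \<one> else \<zero>)"
      using X 2[of j j'] by (simp add: inverse_matrix_def)
  qed (use c in auto)
qed

text \<open>Multiply t = u X by \<open>Y\<close>, or u = t Y by \<open>X\<close>. Applied to the
  rows of the two coordinate matrices, this exchanges the two forms of the gluing formula.\<close>

lemma (in cring) solve_inverse_matrix:
  assumes fin: "finite I" "finite J" and inv: "inverse_matrix R I J X Y"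
    and u: "\<And>i. i \<in> I \<Longrightarrow> u i \<in> carrier R" and t: "\<And>j. j \<in> J \<Longrightarrow> t j \<in> carrier R"
  shows "(\<forall>j\<in>J. t j = (\<Oplus>i\<in>I. u i \<otimes> X i j)) \<longleftrightarrow> (\<forall>i\<in>I. u i = (\<Oplus>j\<in>J. t j \<otimes> Y j i))"
proof -
  have c: "X i j \<in> carrier R" "Y j i \<in> carrier R" if "i \<in> I" "j \<in> J" for i j
    using inv that by (auto simp: inverse_matrix_def)
  show ?thesis
  proof (intro iffI ballI)
    fix i assume h: "\<forall>j\<in>J. t j = (\<Oplus>i\<in>I. u i \<otimes> X i j)" and i: "i \<in> I"
    have "(\<Oplus>j\<in>J. t j \<otimes> Y j i) = (\<Oplus>j\<in>J. (\<Oplus>k\<in>I. u k \<otimes> X k j) \<otimes> Y j i)"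
      using i c u h by (intro finsum_cong') auto
    also have "\<dots> = (\<Oplus>k\<in>I. u k \<otimes> (\<Oplus>j\<in>J. X k j \<otimes> Y j i))"
      using fin i c u by (intro vec_assoc) auto
    also have "\<dots> = (\<Oplus>k\<in>I. u k \<otimes> (if k = i then \<one> else \<zero>))"
      using inv i u by (intro finsum_cong') (auto simp: inverse_matrix_def)
    also have "\<dots> = u i" using fin i u by (intro sum_delta(1)) auto
    finally show "u i = (\<Oplus>j\<in>J. t j \<otimes> Y j i)" by simp
  next
    fix j assume h: "\<forall>i\<in>I. u i = (\<Oplus>j\<in>J. t j \<otimes> Y j i)" and j: "j \<in> J"
    have "(\<Oplus>i\<in>I. u i \<otimes> X i j) = (\<Oplus>i\<in>I. (\<Oplus>l\<in>J. t l \<otimes> Y l i) \<otimes> X i j)"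
      using j c t h by (intro finsum_cong') auto
    also have "\<dots> = (\<Oplus>l\<in>J. t l \<otimes> (\<Oplus>i\<in>I. Y l i \<otimes> X i j))"
      using fin j c t by (intro vec_assoc) auto
    also have "\<dots> = (\<Oplus>l\<in>J. t l \<otimes> (if l = j then \<one> else \<zero>))"
      using inv j t by (intro finsum_cong') (auto simp: inverse_matrix_def)
    also have "\<dots> = t j" using fin j t by (intro sum_delta(1)) auto
    finally show "t j = (\<Oplus>i\<in>I. u i \<otimes> X i j)" by simp
  qed
qed

lemma alg_hom_compose:
  assumes \<phi>: "\<phi> \<in> alg_hom k L B" and \<chi>: "\<chi> \<in> alg_hom k A L" and A: "algebra k A"
  shows "compose (carrier A) \<phi> \<chi> \<in> alg_hom k A B"
proof -
  interpret A: algebra k A by (rule A)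
  interpret AC: cring A using A by (simp add: algebra_def)
  have \<phi>: "\<phi> \<in> Ring.ring_hom L B" "\<And>c a. c \<in> carrier k \<Longrightarrow> a \<in> carrier L \<Longrightarrow> \<phi> (c \<odot>\<^bsub>L\<^esub> a) = c \<odot>\<^bsub>B\<^esub> \<phi> a"
    and \<chi>: "\<chi> \<in> Ring.ring_hom A L" "\<And>c a. c \<in> carrier k \<Longrightarrow> a \<in> carrier A \<Longrightarrow> \<chi> (c \<odot>\<^bsub>A\<^esub> a) = c \<odot>\<^bsub>L\<^esub> \<chi> a"
    using \<phi> \<chi> by (auto simp: alg_hom_def)
  have "compose (carrier A) \<phi> \<chi> \<in> Ring.ring_hom A B"
    using ring_hom_trans[OF \<chi>(1) \<phi>(1)] by (intro ring_hom_memI) (auto simp: compose_def Ring.ring_hom_def)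
  moreover have "\<chi> a \<in> carrier L" if "a \<in> carrier A" for a using ring_hom_closed[OF \<chi>(1) that] .
  ultimately show ?thesis using \<phi>(2) \<chi>(2) by (auto simp: alg_hom_def compose_def)
qed

section \<open>Two charts over the same algebra\<close>

locale atlas = D: chart n P \<Delta> B k + E: chart n P \<Xi> B k
  for n P \<Delta> \<Xi> and B :: "('k, 'b) module" (structure) and k +
  fixes m :: nat and r c :: "nat \<Rightarrow> expo"
  assumes r: "bij_betw r {..<m} (\<Xi> - \<Delta>)" and c: "bij_betw c {..<m} (\<Delta> - \<Xi>)"
begin

text \<open>The determinant for \<Xi> has rows \<open>\<Delta> - \<Xi>\<close> and columns
  \<open>\<Xi> - \<Delta>\<close>, so the enumerations trade places. Whatever is proved from
  \<Delta> to \<Xi> thereby holds in the opposite direction.\<close>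

lemma swap: "atlas n P \<Xi> \<Delta> B k m c r"
  by (intro atlas.intro D.chart_axioms E.chart_axioms atlas_axioms.intro r c)

abbreviation det where "det \<equiv> block_det k n P \<Delta> m r c"
abbreviation "open_pts \<equiv> open_subscheme_points k D.RA (prime_spectrum D.RA - vanishing_set D.RA det) B"

lemma rc: "i < m \<Longrightarrow> r i \<in> \<Xi> - \<Delta>" "i < m \<Longrightarrow> c i \<in> \<Delta> - \<Xi>"
  using r c by (auto simp: bij_betw_def)

lemma entry_rc_closed: "i < m \<Longrightarrow> j < m \<Longrightarrow> D.entry (r i) (c j) \<in> carrier D.RA"
  using rc E.\<Delta>_Q by (intro D.entry_closed) auto

lemma det_closed: "det \<in> carrier D.RA"
  unfolding block_det_def by (rule mat_det_closed[OF D.RA_cring entry_rc_closed])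

lemma \<Xi>_entry_closed: "\<phi> \<in> alg_hom k D.RA B \<Longrightarrow> \<xi> \<in> \<Xi> \<Longrightarrow> \<beta> \<in> \<Delta> \<Longrightarrow> \<phi> (D.entry \<xi> \<beta>) \<in> carrier B"
  using D.is_tableD(1)[OF D.hom_table] E.\<Delta>_Q by blast

lemma \<Xi>_entry_delta:
  assumes "\<phi> \<in> alg_hom k D.RA B" "\<xi> \<in> \<Xi> \<inter> \<Delta>" "\<beta> \<in> \<Delta>"
  shows "\<phi> (D.entry \<xi> \<beta>) = (if \<xi> = \<beta> then \<one> else \<zero>)"
  using D.is_tableD(2)[OF D.hom_table[OF assms(1)]] assms by blast

text \<open>The transition matrix has literal unit rows over \<open>\<Delta> \<inter> \<Xi>\<close>,
  and the relations give the coordinate entries the same values there.\<close>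

lemma hom_transition_entry:
  assumes \<phi>: "\<phi> \<in> alg_hom k D.RA B" and "\<xi> \<in> \<Xi>" "\<beta> \<in> \<Delta>"
  shows "\<phi> (transition_entry k n P \<Delta> \<Xi> \<xi> \<beta>) = \<phi> (D.entry \<xi> \<beta>)"
proof -
  interpret \<phi>: ring_hom_cring D.RA B \<phi> by (rule D.alg_hom_ring_hom[OF \<phi>])
  show ?thesis using \<Xi>_entry_delta[OF \<phi>] assms by (auto simp: transition_entry_def)
qed

lemma unit_iff_invertible:
  assumes \<phi>: "\<phi> \<in> alg_hom k D.RA B"
  shows "\<phi> det \<in> Units B \<longleftrightarrow> (\<exists>Y. inverse_matrix B \<Xi> \<Delta> (\<lambda>\<xi> \<beta>. \<phi> (D.entry \<xi> \<beta>)) Y)"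
proof -
  interpret \<phi>: ring_hom_cring D.RA B \<phi> by (rule D.alg_hom_ring_hom[OF \<phi>])
  have "\<phi> det = mat_det B m (\<lambda>i j. \<phi> (D.entry (r i) (c j)))"
    unfolding block_det_def by (rule \<phi>.hom_mat_det) (rule entry_rc_closed)
  moreover have "(\<exists>Y. inverse_matrix B \<Xi> \<Delta> (\<lambda>\<xi> \<beta>. \<phi> (D.entry \<xi> \<beta>)) Y) \<longleftrightarrow> mat_det B m (\<lambda>i j. \<phi> (D.entry (r i) (c j))) \<in> Units B"
    by (rule D.invertible_iff_block_det[OF E.fin D.fin _ _ r c]) (use \<Xi>_entry_closed[OF \<phi>] \<Xi>_entry_delta[OF \<phi>] in auto)
  ultimately show ?thesis by simp
qed

text \<open>The rows over \<Xi> contain the coordinates of the monomials x^\<xi> in the basis of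
  \<Delta>, so \<open>basis_change\<close> applies. Its second part multiplies row \<alpha> of the
  first coordinate matrix by the inverse, which yields row \<alpha> of the second.\<close>

lemma other_basis:
  assumes I: "I \<in> D.points"
  shows "I \<in> E.points \<longleftrightarrow> D.ch I det \<in> Units B"
    and "inverse_matrix B \<Xi> \<Delta> (\<lambda>\<xi> \<beta>. D.ch I (D.entry \<xi> \<beta>)) Y \<Longrightarrow> \<alpha> \<in> D.Q \<Longrightarrow> \<xi> \<in> \<Xi> \<Longrightarrow>
      E.coord_table I \<alpha> \<xi> = (\<Oplus>\<beta>\<in>\<Delta>. D.ch I (D.entry \<alpha> \<beta>) \<otimes> Y \<beta> \<xi>)"
proof -
  note I' = D.pointsD[OF I]
  interpret AI: algebra B "D.A I" by (rule D.A_algebra[OF I'(1)])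
  let ?T = "\<lambda>\<xi> \<beta>. D.ch I (D.entry \<xi> \<beta>)"
  have T: "?T \<alpha> \<beta> = D.coord_table I \<alpha> \<beta>" if "\<alpha> \<in> D.Q" "\<beta> \<in> \<Delta>" for \<alpha> \<beta>
    using D.chart_props(2)[OF I that] .
  have Tc: "?T \<alpha> \<beta> \<in> carrier B" if "\<alpha> \<in> D.Q" "\<beta> \<in> \<Delta>" for \<alpha> \<beta>
    using T[OF that] D.coord_table_closed[OF I'] that by simp
  have b': "D.X I \<alpha> = (\<Oplus>\<^bsub>D.A I\<^esub>\<beta>\<in>\<Delta>. ?T \<alpha> \<beta> \<odot>\<^bsub>D.A I\<^esub> D.X I \<beta>)" if "\<alpha> \<in> D.Q" for \<alpha>
  proof -
    have "D.X I \<alpha> = (\<Oplus>\<^bsub>D.A I\<^esub>\<beta>\<in>\<Delta>. D.coord_table I \<alpha> \<beta> \<odot>\<^bsub>D.A I\<^esub> D.X I \<beta>)"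
      using that D.Q_exp by (intro D.coord_table_expand[OF I']) auto
    also have "\<dots> = (\<Oplus>\<^bsub>D.A I\<^esub>\<beta>\<in>\<Delta>. ?T \<alpha> \<beta> \<odot>\<^bsub>D.A I\<^esub> D.X I \<beta>)"
      using T[OF that] Tc[OF that] D.X_closed[OF I'(1)] D.\<Delta>_exp
      by (intro AI.M.finsum_cong') (auto simp: Pi_def)
    finally show ?thesis .
  qed
  have bc1: "is_basis B (D.A I) \<Xi> (D.X I) \<longleftrightarrow> (\<exists>Y. inverse_matrix B \<Xi> \<Delta> ?T Y)"
    by (rule AI.basis_change(1)[OF D.fin E.fin I'(2)]) (use Tc b' E.\<Delta>_Q in blast)+
  have bc2: "coords B (D.A I) \<Xi> (D.X I) v \<xi> = (\<Oplus>\<beta>\<in>\<Delta>. coords B (D.A I) \<Delta> (D.X I) v \<beta> \<otimes> Y \<beta> \<xi>)"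
    if "inverse_matrix B \<Xi> \<Delta> ?T Y" "v \<in> carrier (D.A I)" "\<xi> \<in> \<Xi>" for Y v \<xi>
    by (rule AI.basis_change(2)[OF D.fin E.fin I'(2) _ _ that]) (use Tc b' E.\<Delta>_Q in blast)+
  show "I \<in> E.points \<longleftrightarrow> D.ch I det \<in> Units B"
    unfolding unit_iff_invertible[OF D.chart_props(1)[OF I]] bc1[symmetric] E.points_iff using I' by blast
  assume Y: "inverse_matrix B \<Xi> \<Delta> ?T Y" and a: "\<alpha> \<in> D.Q" and x: "\<xi> \<in> \<Xi>"
  have ae: "\<alpha> \<in> exponents n" using a D.Q_exp by blast
  have "E.coord_table I \<alpha> \<xi> = (\<Oplus>\<beta>\<in>\<Delta>. D.coord_table I \<alpha> \<beta> \<otimes> Y \<beta> \<xi>)"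
    using bc2[OF Y D.X_closed[OF I'(1) ae] x] ae by (simp add: E.coord_table_def D.coord_table_def)
  also have "\<dots> = (\<Oplus>\<beta>\<in>\<Delta>. ?T \<alpha> \<beta> \<otimes> Y \<beta> \<xi>)"
    using T[OF a] Tc[OF a] Y x by (intro D.finsum_cong') (auto simp: inverse_matrix_def)
  finally show "E.coord_table I \<alpha> \<xi> = (\<Oplus>\<beta>\<in>\<Delta>. ?T \<alpha> \<beta> \<otimes> Y \<beta> \<xi>)" .
qed

lemma open_pts_iff: "\<phi> \<in> open_pts \<longleftrightarrow> \<phi> \<in> alg_hom k D.RA B \<and> \<phi> det \<in> Units B"
  using open_points_iff[OF D.RA_cring D.B _ det_closed, of \<phi> k] by (auto simp: open_subscheme_points_def)

lemma chart_image: "D.ch ` (D.points \<inter> E.points) = open_pts"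
proof (intro equalityI subsetI)
  fix \<phi> assume "\<phi> \<in> D.ch ` (D.points \<inter> E.points)"
  then show "\<phi> \<in> open_pts" using other_basis(1) D.chart_props(1) by (auto simp: open_pts_iff)
next
  fix \<phi> assume \<phi>: "\<phi> \<in> open_pts"
  then obtain I where "I \<in> D.points" "\<phi> = D.ch I"
    using D.chart_bij by (auto simp: open_pts_iff bij_betw_def)
  then show "\<phi> \<in> D.ch ` (D.points \<inter> E.points)"
    using \<phi> other_basis(1) by (auto simp: open_pts_iff)
qed

abbreviation "glue \<equiv> gluing_map k n P \<Delta> \<Xi> B"

lemma chart_inj: "inj_on D.ch (D.points \<inter> E.points)"
  using D.chart_bij by (auto simp: bij_betw_def intro: inj_on_subset)

lemma glue_chart: "I \<in> D.points \<Longrightarrow> I \<in> E.points \<Longrightarrow> glue (D.ch I) = E.ch I"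
  unfolding gluing_map_def by (simp add: inv_into_f_f[OF chart_inj])

lemma open_ptsE:
  assumes "\<phi> \<in> open_pts"
  obtains I where "I \<in> D.points" "I \<in> E.points" "\<phi> = D.ch I"
  using assms chart_image by blast

text \<open>The two charts map the same set of ideals bijectively onto the two open subschemes;
  gluing inverts one chart and applies the other.\<close>

lemma glue_bij:
  "bij_betw glue open_pts (open_subscheme_points k E.RA (prime_spectrum E.RA - vanishing_set E.RA (block_det k n P \<Xi> m c r)) B)"
proof -
  interpret sw: atlas n P \<Xi> \<Delta> B k m c r by (rule swap)
  have 1: "bij_betw D.ch (D.points \<inter> E.points) open_pts"
    using chart_inj chart_image by (simp add: bij_betw_def)
  have 2: "bij_betw E.ch (D.points \<inter> E.points) sw.open_pts"
    using sw.chart_inj sw.chart_image by (simp add: bij_betw_def Int_commute)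
  have "bij_betw (E.ch \<circ> inv_into (D.points \<inter> E.points) D.ch) open_pts sw.open_pts"
    using bij_betw_trans[OF bij_betw_inv_into[OF 1] 2] .
  then show ?thesis by (simp add: gluing_map_def[abs_def] comp_def)
qed

lemma glue_props:
  assumes \<chi>: "\<chi> \<in> open_pts"
  shows "glue \<chi> \<in> alg_hom k E.RA B"
    and "glue \<chi> (block_det k n P \<Xi> m c r) \<in> Units B"
    and "gluing_map k n P \<Xi> \<Delta> B (glue \<chi>) = \<chi>"
    and "\<And>Y \<alpha> \<xi>. inverse_matrix B \<Xi> \<Delta> (\<lambda>\<xi> \<beta>. \<chi> (D.entry \<xi> \<beta>)) Y \<Longrightarrow> \<alpha> \<in> D.Q \<Longrightarrow> \<xi> \<in> \<Xi> \<Longrightarrow>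
      glue \<chi> (E.entry \<alpha> \<xi>) = (\<Oplus>\<beta>\<in>\<Delta>. \<chi> (D.entry \<alpha> \<beta>) \<otimes> Y \<beta> \<xi>)"
proof -
  interpret sw: atlas n P \<Xi> \<Delta> B k m c r by (rule swap)
  \<comment> \<open>The point \<open>\<chi>\<close> is the chart value of one ideal lying in both
    charts, and each claim becomes a statement about that ideal.\<close>
  obtain I where I: "I \<in> D.points" "I \<in> E.points" "\<chi> = D.ch I" by (rule open_ptsE[OF \<chi>])
  have g: "glue \<chi> = E.ch I" using glue_chart I by simp
  show "glue \<chi> \<in> alg_hom k E.RA B" unfolding g by (rule E.chart_props(1)[OF I(2)])
  show "glue \<chi> (block_det k n P \<Xi> m c r) \<in> Units B" using sw.other_basis(1)[OF I(2)] I(1) g by simp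
  show "gluing_map k n P \<Xi> \<Delta> B (glue \<chi>) = \<chi>" using sw.glue_chart[OF I(2,1)] g I(3) by simp
  fix Y \<alpha> \<xi> assume Y: "inverse_matrix B \<Xi> \<Delta> (\<lambda>\<xi> \<beta>. \<chi> (D.entry \<xi> \<beta>)) Y" and a: "\<alpha> \<in> D.Q" "\<xi> \<in> \<Xi>"
  show "glue \<chi> (E.entry \<alpha> \<xi>) = (\<Oplus>\<beta>\<in>\<Delta>. \<chi> (D.entry \<alpha> \<beta>) \<otimes> Y \<beta> \<xi>)"
    using E.chart_props(2)[OF I(2) a] other_basis(2)[OF I(1) _ a] Y g I(3) by simp
qed

end

text \<open>\<open>\<phi>\<close> carries the inverse matrix over \<open>L\<close> to one over
  \<open>B\<close>, hence the gluing formula over \<open>L\<close> to the one over \<open>B\<close>;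
  equality on entries suffices by \<open>alg_hom_eqI\<close>. No extension of ideals from
  \<open>L\<close> to \<open>B\<close> has to be constructed.\<close>

lemma glue_natural:
  assumes L: "atlas n P \<Delta> \<Xi> L k m r c" and B: "atlas n P \<Delta> \<Xi> B k m r c"
    and \<phi>: "\<phi> \<in> alg_hom k L B" and \<chi>: "\<chi> \<in> alg_hom k (coord_alg k n P \<Delta>) L"
    and u: "\<chi> (block_det k n P \<Delta> m r c) \<in> Units L"
  shows "gluing_map k n P \<Delta> \<Xi> B (compose (carrier (coord_alg k n P \<Delta>)) \<phi> \<chi>) =
    compose (carrier (coord_alg k n P \<Xi>)) \<phi> (gluing_map k n P \<Delta> \<Xi> L \<chi>)"
    and "compose (carrier (coord_alg k n P \<Delta>)) \<phi> \<chi> (block_det k n P \<Delta> m r c) \<in> Units B"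
proof -
  interpret L: atlas n P \<Delta> \<Xi> L k m r c by (rule L)
  interpret B: atlas n P \<Delta> \<Xi> B k m r c by (rule B)
  have h: "\<phi> \<in> Ring.ring_hom L B" using \<phi> by (simp add: alg_hom_def)
  interpret \<phi>: ring_hom_cring L B \<phi> by (rule ring_hom_cringI[OF L.D.B B.D.B h])
  let ?RD = "coord_alg k n P \<Delta>" and ?RX = "coord_alg k n P \<Xi>"
  have RD: "algebra k ?RD" and RX: "algebra k ?RX" by (rule L.D.cq.algebra_Q, rule L.E.cq.algebra_Q)
  let ?\<chi> = "compose (carrier ?RD) \<phi> \<chi>"
  have \<chi>': "?\<chi> \<in> alg_hom k ?RD B" by (rule alg_hom_compose[OF \<phi> \<chi> RD])
  obtain Y where Y: "inverse_matrix L \<Xi> \<Delta> (\<lambda>\<xi> \<beta>. \<chi> (L.D.entry \<xi> \<beta>)) Y"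
    using L.unit_iff_invertible[OF \<chi>] u by blast
  have e: "?\<chi> (L.D.entry \<alpha> \<beta>) = \<phi> (\<chi> (L.D.entry \<alpha> \<beta>))" if "\<alpha> \<in> L.D.Q" "\<beta> \<in> \<Delta>" for \<alpha> \<beta>
    using L.D.entry_closed[OF that] by (simp add: compose_def)
  have \<phi>Y: "inverse_matrix B \<Xi> \<Delta> (\<lambda>\<xi> \<beta>. ?\<chi> (L.D.entry \<xi> \<beta>)) (\<lambda>j i. \<phi> (Y j i))"
    by (rule B.D.inverse_matrix_cong[OF _ \<phi>.hom_inverse_matrix[OF Y]]) (use e L.E.\<Delta>_Q in auto)
  then show unit: "?\<chi> L.det \<in> Units B" using B.unit_iff_invertible[OF \<chi>'] by blast
  have \<chi>_open: "\<chi> \<in> L.open_pts" using \<chi> u L.open_pts_iff by blast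
  have \<chi>'_open: "?\<chi> \<in> B.open_pts" using \<chi>' unit B.open_pts_iff by blast
  note gL = L.glue_props[OF \<chi>_open] and gB = B.glue_props[OF \<chi>'_open]
  show "gluing_map k n P \<Delta> \<Xi> B ?\<chi> = compose (carrier ?RX) \<phi> (gluing_map k n P \<Delta> \<Xi> L \<chi>)"
  proof (rule B.E.alg_hom_eqI[OF gB(1) alg_hom_compose[OF \<phi> gL(1) RX]])
    fix \<alpha> \<xi> assume a: "\<alpha> \<in> L.D.Q" "\<xi> \<in> \<Xi>"
    have Tc: "\<chi> (L.D.entry \<alpha> \<beta>) \<in> carrier L" if "\<beta> \<in> \<Delta>" for \<beta>
      using L.D.is_tableD(1)[OF L.D.hom_table[OF \<chi>] a(1) that] .
    have Yc: "Y \<beta> \<xi> \<in> carrier L" if "\<beta> \<in> \<Delta>" for \<beta> using Y a that by (auto simp: inverse_matrix_def)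
    have "compose (carrier ?RX) \<phi> (gluing_map k n P \<Delta> \<Xi> L \<chi>) (L.E.entry \<alpha> \<xi>) =
      \<phi> (\<Oplus>\<^bsub>L\<^esub>\<beta>\<in>\<Delta>. \<chi> (L.D.entry \<alpha> \<beta>) \<otimes>\<^bsub>L\<^esub> Y \<beta> \<xi>)"
      using L.E.entry_closed[OF a] gL(4)[OF Y a] by (simp add: compose_def)
    also have "\<dots> = (\<Oplus>\<^bsub>B\<^esub>\<beta>\<in>\<Delta>. ?\<chi> (L.D.entry \<alpha> \<beta>) \<otimes>\<^bsub>B\<^esub> \<phi> (Y \<beta> \<xi>))"
      using Tc Yc e[OF a(1)] by (subst \<phi>.hom_finsum) (auto simp: comp_def intro!: B.D.finsum_cong')
    also have "\<dots> = gluing_map k n P \<Delta> \<Xi> B ?\<chi> (L.E.entry \<alpha> \<xi>)"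
      using gB(4)[OF \<phi>Y a] by simp
    finally show "gluing_map k n P \<Delta> \<Xi> B ?\<chi> (L.E.entry \<alpha> \<xi>) =
      compose (carrier ?RX) \<phi> (gluing_map k n P \<Delta> \<Xi> L \<chi>) (L.E.entry \<alpha> \<xi>)" by simp
  qed
qed

section \<open>Localizations\<close>

text \<open>Every \<open>y\<close> becomes some \<open>l a\<close> after multiplication by a power
  of the unit \<open>l f\<close>. Both homomorphisms agree on \<open>l a\<close> and on that power,
  whose image can be cancelled.\<close>

lemma localization_hom_eqI:
  assumes loc: "localization_away k A f L l" and B: "algebra k B"
    and \<theta>: "\<theta> \<in> alg_hom k L B" and \<eta>: "\<eta> \<in> alg_hom k L B"
    and eq: "\<And>a. a \<in> carrier A \<Longrightarrow> \<theta> (l a) = \<eta> (l a)" and A: "cring A" and f: "f \<in> carrier A"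
  shows "\<theta> = \<eta>"
proof -
  have L: "algebra k L" and l: "l \<in> alg_hom k A L" and lf: "l f \<in> Units L"
    and ex: "\<And>y. y \<in> carrier L \<Longrightarrow> \<exists>a\<in>carrier A. \<exists>s::nat. y \<otimes>\<^bsub>L\<^esub> (l f [^]\<^bsub>L\<^esub> s) = l a"
    using loc unfolding localization_away_def by blast+
  interpret L: cring L using L by (simp add: algebra_def)
  interpret B: cring B using B by (simp add: algebra_def)
  have h: "\<theta> \<in> Ring.ring_hom L B" "\<eta> \<in> Ring.ring_hom L B" "\<theta> \<in> extensional (carrier L)" "\<eta> \<in> extensional (carrier L)"
    using \<theta> \<eta> by (auto simp: alg_hom_def)
  interpret \<theta>: ring_hom_cring L B \<theta> by (rule ring_hom_cringI[OF L.cring_axioms B.cring_axioms h(1)])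
  interpret \<eta>: ring_hom_cring L B \<eta> by (rule ring_hom_cringI[OF L.cring_axioms B.cring_axioms h(2)])
  show ?thesis
  proof (rule extensionalityI[OF h(3,4)])
    fix y assume y: "y \<in> carrier L"
    obtain a and s :: nat where a: "a \<in> carrier A" "y \<otimes>\<^bsub>L\<^esub> (l f [^]\<^bsub>L\<^esub> s) = l a" using ex[OF y] by blast
    let ?u = "l f [^]\<^bsub>L\<^esub> s"
    have u: "?u \<in> Units L" using lf by (rule L.Units_pow_closed)
    have uc: "?u \<in> carrier L" "inv\<^bsub>L\<^esub> ?u \<in> carrier L" using u by auto
    have fu: "\<theta> ?u = \<eta> ?u"
      using eq[OF f] lf by (simp add: \<theta>.hom_npow \<eta>.hom_npow L.Units_closed)
    have t: "\<theta> y \<otimes>\<^bsub>B\<^esub> \<theta> ?u = \<eta> y \<otimes>\<^bsub>B\<^esub> \<theta> ?u"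
      using eq[OF a(1)] y uc fu unfolding a(2)[symmetric] by simp
    have i: "\<theta> ?u \<otimes>\<^bsub>B\<^esub> \<theta> (inv\<^bsub>L\<^esub> ?u) = \<one>\<^bsub>B\<^esub>"
      using u uc by (simp add: \<theta>.hom_mult[symmetric] del: \<theta>.hom_mult)
    have "z = (z \<otimes>\<^bsub>B\<^esub> \<theta> ?u) \<otimes>\<^bsub>B\<^esub> \<theta> (inv\<^bsub>L\<^esub> ?u)" if "z \<in> carrier B" for z
      using that uc i by (simp add: B.m_assoc)
    then show "\<theta> y = \<eta> y" using t y by (metis \<theta>.hom_closed \<eta>.hom_closed)
  qed
qed

text \<open>A fraction a / f^s must go to the image of a divided by the s-th power of the image of
  f. This is well defined because an element killed by \<open>l\<close> is killed by a power of
  \<open>f\<close>, and \<open>\<chi>\<close> turns that power into a unit.\<close>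

lemma localization_lift:
  assumes loc: "localization_away k A f L l" and A: "algebra k A" and B: "algebra k B" and f: "f \<in> carrier A"
    and \<chi>: "\<chi> \<in> alg_hom k A B" and u: "\<chi> f \<in> Units B"
  shows "\<exists>\<theta>\<in>alg_hom k L B. \<forall>a\<in>carrier A. \<theta> (l a) = \<chi> a"
proof -
  have L: "algebra k L" and l: "l \<in> alg_hom k A L" and lf: "l f \<in> Units L"
    and ex: "\<And>y. y \<in> carrier L \<Longrightarrow> \<exists>a\<in>carrier A. \<exists>s::nat. y \<otimes>\<^bsub>L\<^esub> (l f [^]\<^bsub>L\<^esub> s) = l a"
    and ker: "\<And>a. a \<in> carrier A \<Longrightarrow> l a = \<zero>\<^bsub>L\<^esub> \<Longrightarrow> \<exists>s::nat. (f [^]\<^bsub>A\<^esub> s) \<otimes>\<^bsub>A\<^esub> a = \<zero>\<^bsub>A\<^esub>"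
    using loc unfolding localization_away_def by blast+
  interpret A: cring A using A by (simp add: algebra_def)
  interpret L: cring L using L by (simp add: algebra_def)
  interpret B: cring B using B by (simp add: algebra_def)
  interpret AA: algebra k A by (rule A)
  interpret LL: algebra k L by (rule L)
  interpret BB: algebra k B by (rule B)
  have hl: "l \<in> Ring.ring_hom A L" and h\<chi>: "\<chi> \<in> Ring.ring_hom A B"
    and sl: "\<And>c a. c \<in> carrier k \<Longrightarrow> a \<in> carrier A \<Longrightarrow> l (c \<odot>\<^bsub>A\<^esub> a) = c \<odot>\<^bsub>L\<^esub> l a"
    and s\<chi>: "\<And>c a. c \<in> carrier k \<Longrightarrow> a \<in> carrier A \<Longrightarrow> \<chi> (c \<odot>\<^bsub>A\<^esub> a) = c \<odot>\<^bsub>B\<^esub> \<chi> a"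
    using l \<chi> by (auto simp: alg_hom_def)
  interpret l: ring_hom_cring A L l by (rule ring_hom_cringI[OF A.cring_axioms L.cring_axioms hl])
  interpret \<chi>: ring_hom_cring A B \<chi> by (rule ring_hom_cringI[OF A.cring_axioms B.cring_axioms h\<chi>])
  let ?v = "inv\<^bsub>B\<^esub> (\<chi> f)"
  have v: "?v \<in> carrier B" "\<chi> f \<otimes>\<^bsub>B\<^esub> ?v = \<one>\<^bsub>B\<^esub>" using u by auto
  have pw: "(\<chi> f [^]\<^bsub>B\<^esub> (s::nat)) \<otimes>\<^bsub>B\<^esub> (?v [^]\<^bsub>B\<^esub> s) = \<one>\<^bsub>B\<^esub>" for s
    using f v by (simp add: B.nat_pow_distrib[symmetric])
  have cancel: "x = y" if "x \<in> carrier B" "y \<in> carrier B" "(\<chi> f [^]\<^bsub>B\<^esub> (s::nat)) \<otimes>\<^bsub>B\<^esub> x = (\<chi> f [^]\<^bsub>B\<^esub> s) \<otimes>\<^bsub>B\<^esub> y" for x y s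
  proof -
    have "z = (?v [^]\<^bsub>B\<^esub> s) \<otimes>\<^bsub>B\<^esub> ((\<chi> f [^]\<^bsub>B\<^esub> s) \<otimes>\<^bsub>B\<^esub> z)" if "z \<in> carrier B" for z
    proof -
      have "(?v [^]\<^bsub>B\<^esub> s) \<otimes>\<^bsub>B\<^esub> ((\<chi> f [^]\<^bsub>B\<^esub> s) \<otimes>\<^bsub>B\<^esub> z) = ((\<chi> f [^]\<^bsub>B\<^esub> s) \<otimes>\<^bsub>B\<^esub> (?v [^]\<^bsub>B\<^esub> s)) \<otimes>\<^bsub>B\<^esub> z"
        using f v that by (simp add: B.m_ac)
      then show ?thesis using pw that by simp
    qed
    then show ?thesis using that by metis
  qed
  have lift_eq: "\<chi> a = \<chi> b" if ab: "a \<in> carrier A" "b \<in> carrier A" "l a = l b" for a b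
  proof -
    have "l (a \<ominus>\<^bsub>A\<^esub> b) = \<zero>\<^bsub>L\<^esub>" using ab by (simp add: A.minus_eq L.r_neg)
    then obtain s :: nat where s: "(f [^]\<^bsub>A\<^esub> s) \<otimes>\<^bsub>A\<^esub> (a \<ominus>\<^bsub>A\<^esub> b) = \<zero>\<^bsub>A\<^esub>" using ker[of "a \<ominus>\<^bsub>A\<^esub> b"] ab by auto
    have "(\<chi> f [^]\<^bsub>B\<^esub> s) \<otimes>\<^bsub>B\<^esub> (\<chi> a \<ominus>\<^bsub>B\<^esub> \<chi> b) = \<chi> ((f [^]\<^bsub>A\<^esub> s) \<otimes>\<^bsub>A\<^esub> (a \<ominus>\<^bsub>A\<^esub> b))"
      using f ab by (simp add: A.minus_eq B.minus_eq \<chi>.hom_npow)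
    also have "\<dots> = \<zero>\<^bsub>B\<^esub>" unfolding s by (rule \<chi>.hom_zero)
    also have "\<dots> = (\<chi> f [^]\<^bsub>B\<^esub> s) \<otimes>\<^bsub>B\<^esub> \<zero>\<^bsub>B\<^esub>" using f by simp
    finally have z: "(\<chi> f [^]\<^bsub>B\<^esub> s) \<otimes>\<^bsub>B\<^esub> (\<chi> a \<ominus>\<^bsub>B\<^esub> \<chi> b) = (\<chi> f [^]\<^bsub>B\<^esub> s) \<otimes>\<^bsub>B\<^esub> \<zero>\<^bsub>B\<^esub>" .
    have "\<chi> a \<ominus>\<^bsub>B\<^esub> \<chi> b = \<zero>\<^bsub>B\<^esub>" by (rule cancel[OF _ _ z]) (use ab in auto)
    then show ?thesis using B.r_right_minus_eq[of "\<chi> a" "\<chi> b"] ab by simp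
  qed
  define frac where "frac y a s \<longleftrightarrow> a \<in> carrier A \<and> y \<otimes>\<^bsub>L\<^esub> (l f [^]\<^bsub>L\<^esub> s) = l a" for y a and s :: nat
  have lfc: "l f \<in> carrier L" using f by simp
  \<comment> \<open>Two representations of \<open>y\<close> are compared by cross-multiplication: a
    f^t and b f^s have the same image under \<open>l\<close>, hence under
    \<open>\<chi>\<close>.\<close>
  have indep: "\<chi> a \<otimes>\<^bsub>B\<^esub> (?v [^]\<^bsub>B\<^esub> s) = \<chi> b \<otimes>\<^bsub>B\<^esub> (?v [^]\<^bsub>B\<^esub> t)"
    if y: "y \<in> carrier L" and 1: "frac y a s" and 2: "frac y b t" for y a b s t
  proof -
    have ab: "a \<in> carrier A" "b \<in> carrier A" using 1 2 by (auto simp: frac_def)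
    have "l (a \<otimes>\<^bsub>A\<^esub> (f [^]\<^bsub>A\<^esub> t)) = y \<otimes>\<^bsub>L\<^esub> (l f [^]\<^bsub>L\<^esub> s) \<otimes>\<^bsub>L\<^esub> (l f [^]\<^bsub>L\<^esub> t)"
      using ab f 1 by (simp add: frac_def l.hom_npow)
    also have "\<dots> = y \<otimes>\<^bsub>L\<^esub> (l f [^]\<^bsub>L\<^esub> t) \<otimes>\<^bsub>L\<^esub> (l f [^]\<^bsub>L\<^esub> s)" using y lfc by (simp add: L.m_ac)
    also have "\<dots> = l (b \<otimes>\<^bsub>A\<^esub> (f [^]\<^bsub>A\<^esub> s))"
      using ab f 2 by (simp add: frac_def l.hom_npow)
    finally have "\<chi> (a \<otimes>\<^bsub>A\<^esub> (f [^]\<^bsub>A\<^esub> t)) = \<chi> (b \<otimes>\<^bsub>A\<^esub> (f [^]\<^bsub>A\<^esub> s))" using ab f by (intro lift_eq[of "a \<otimes>\<^bsub>A\<^esub> (f [^]\<^bsub>A\<^esub> t)"]) auto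
    then have e: "\<chi> a \<otimes>\<^bsub>B\<^esub> (\<chi> f [^]\<^bsub>B\<^esub> t) = \<chi> b \<otimes>\<^bsub>B\<^esub> (\<chi> f [^]\<^bsub>B\<^esub> s)"
      using ab f by (simp add: \<chi>.hom_npow)
    have "\<chi> a \<otimes>\<^bsub>B\<^esub> (?v [^]\<^bsub>B\<^esub> s) = \<chi> a \<otimes>\<^bsub>B\<^esub> (?v [^]\<^bsub>B\<^esub> s) \<otimes>\<^bsub>B\<^esub> ((\<chi> f [^]\<^bsub>B\<^esub> t) \<otimes>\<^bsub>B\<^esub> (?v [^]\<^bsub>B\<^esub> t))"
      using pw[of t] ab v by simp
    also have "\<dots> = (\<chi> a \<otimes>\<^bsub>B\<^esub> (\<chi> f [^]\<^bsub>B\<^esub> t)) \<otimes>\<^bsub>B\<^esub> (?v [^]\<^bsub>B\<^esub> s) \<otimes>\<^bsub>B\<^esub> (?v [^]\<^bsub>B\<^esub> t)"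
      using ab f v by (simp add: B.m_ac)
    also have "\<dots> = \<chi> b \<otimes>\<^bsub>B\<^esub> (?v [^]\<^bsub>B\<^esub> t) \<otimes>\<^bsub>B\<^esub> ((\<chi> f [^]\<^bsub>B\<^esub> s) \<otimes>\<^bsub>B\<^esub> (?v [^]\<^bsub>B\<^esub> s))"
      unfolding e using ab f v by (simp add: B.m_ac)
    also have "\<dots> = \<chi> b \<otimes>\<^bsub>B\<^esub> (?v [^]\<^bsub>B\<^esub> t)" using pw[of s] ab v by simp
    finally show ?thesis .
  qed
  define \<theta> where "\<theta> = (\<lambda>y\<in>carrier L. let (a, s) = SOME (a, s). frac y a s in \<chi> a \<otimes>\<^bsub>B\<^esub> (?v [^]\<^bsub>B\<^esub> s))"
  have \<theta>: "\<theta> y = \<chi> a \<otimes>\<^bsub>B\<^esub> (?v [^]\<^bsub>B\<^esub> s)" if y: "y \<in> carrier L" and fr: "frac y a s" for y a s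
  proof -
    obtain b t where bt: "(SOME (a, s). frac y a s) = (b, t)" by (cases "SOME (a, s). frac y a s") auto
    have "case (SOME (a, s). frac y a s) of (a, s) \<Rightarrow> frac y a s"
      by (rule someI[of _ "(a, s)"]) (simp add: fr)
    then have "frac y b t" unfolding bt by simp
    then show ?thesis using indep[OF y _ fr] y by (simp add: \<theta>_def bt)
  qed
  have frac_ex: "\<exists>a s. frac y a s" if "y \<in> carrier L" for y using ex[OF that] by (auto simp: frac_def)
  have frac_l: "frac (l a) a 0" if "a \<in> carrier A" for a using that by (simp add: frac_def)
  have \<theta>l: "\<theta> (l a) = \<chi> a" if "a \<in> carrier A" for a using \<theta>[OF _ frac_l[OF that]] that by simp
  have "\<theta> \<in> alg_hom k L B"
    unfolding alg_hom_def
  proof (intro CollectI conjI IntI ballI)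
    show "\<theta> \<in> extensional (carrier L)" by (simp add: \<theta>_def)
    show "\<theta> \<in> Ring.ring_hom L B"
    proof (rule ring_hom_memI)
      fix x y assume x: "x \<in> carrier L" and y: "y \<in> carrier L"
      obtain a s where as: "frac x a s" using frac_ex[OF x] by blast
      obtain b t where bt: "frac y b t" using frac_ex[OF y] by blast
      have ab: "a \<in> carrier A" "b \<in> carrier A" using as bt by (auto simp: frac_def)
      have eqs: "l a = x \<otimes>\<^bsub>L\<^esub> (l f [^]\<^bsub>L\<^esub> s)" "l b = y \<otimes>\<^bsub>L\<^esub> (l f [^]\<^bsub>L\<^esub> t)" using as bt by (auto simp: frac_def)
      have m: "frac (x \<otimes>\<^bsub>L\<^esub> y) (a \<otimes>\<^bsub>A\<^esub> b) (s + t)"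
        using ab x y lfc by (simp add: frac_def eqs L.nat_pow_mult[symmetric] L.m_ac)
      show "\<theta> (x \<otimes>\<^bsub>L\<^esub> y) = \<theta> x \<otimes>\<^bsub>B\<^esub> \<theta> y"
        using \<theta>[OF _ m] \<theta>[OF x as] \<theta>[OF y bt] x y ab v by (simp add: B.nat_pow_mult[symmetric] B.m_ac)
      have ad: "frac (x \<oplus>\<^bsub>L\<^esub> y) (a \<otimes>\<^bsub>A\<^esub> (f [^]\<^bsub>A\<^esub> t) \<oplus>\<^bsub>A\<^esub> b \<otimes>\<^bsub>A\<^esub> (f [^]\<^bsub>A\<^esub> s)) (s + t)"
        using ab x y f by (simp add: frac_def eqs l.hom_npow L.nat_pow_mult[symmetric] L.m_ac L.l_distr)
      have "\<chi> (a \<otimes>\<^bsub>A\<^esub> (f [^]\<^bsub>A\<^esub> t) \<oplus>\<^bsub>A\<^esub> b \<otimes>\<^bsub>A\<^esub> (f [^]\<^bsub>A\<^esub> s)) \<otimes>\<^bsub>B\<^esub> (?v [^]\<^bsub>B\<^esub> (s + t)) =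
        \<chi> a \<otimes>\<^bsub>B\<^esub> (?v [^]\<^bsub>B\<^esub> s) \<otimes>\<^bsub>B\<^esub> ((\<chi> f [^]\<^bsub>B\<^esub> t) \<otimes>\<^bsub>B\<^esub> (?v [^]\<^bsub>B\<^esub> t)) \<oplus>\<^bsub>B\<^esub>
        \<chi> b \<otimes>\<^bsub>B\<^esub> (?v [^]\<^bsub>B\<^esub> t) \<otimes>\<^bsub>B\<^esub> ((\<chi> f [^]\<^bsub>B\<^esub> s) \<otimes>\<^bsub>B\<^esub> (?v [^]\<^bsub>B\<^esub> s))"
        using ab f v by (simp add: \<chi>.hom_npow B.nat_pow_mult[symmetric] B.m_ac B.l_distr B.r_distr)
      also have "\<dots> = \<theta> x \<oplus>\<^bsub>B\<^esub> \<theta> y"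
        using ab v \<theta>[OF x as] \<theta>[OF y bt] by (simp add: pw)
      finally show "\<theta> (x \<oplus>\<^bsub>L\<^esub> y) = \<theta> x \<oplus>\<^bsub>B\<^esub> \<theta> y" using \<theta>[OF _ ad] x y by simp
    next
      fix x assume x: "x \<in> carrier L"
      obtain a s where as: "frac x a s" using frac_ex[OF x] by blast
      show "\<theta> x \<in> carrier B" using \<theta>[OF x as] as v by (simp add: frac_def)
    next
      show "\<theta> \<one>\<^bsub>L\<^esub> = \<one>\<^bsub>B\<^esub>" using \<theta>l[of "\<one>\<^bsub>A\<^esub>"] by simp
    qed
    fix e y assume e: "e \<in> carrier k" and y: "y \<in> carrier L"
    obtain a s where as: "frac y a s" using frac_ex[OF y] by blast
    have "frac (e \<odot>\<^bsub>L\<^esub> y) (e \<odot>\<^bsub>A\<^esub> a) s"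
      using as e y lfc by (simp add: frac_def sl LL.smult_assoc2 AA.smult_closed)
    from \<theta>[OF _ this] show "\<theta> (e \<odot>\<^bsub>L\<^esub> y) = e \<odot>\<^bsub>B\<^esub> \<theta> y"
      using as e y v \<theta>[OF y as] by (simp add: frac_def s\<chi> BB.smult_assoc2 LL.smult_closed)
  qed
  then show ?thesis using \<theta>l by blast
qed

text \<open>\<open>\<theta>\<close> extends the glued point of \<open>l\<Delta>\<close> over the
  localization of the other chart, and \<open>\<eta>\<close> arises by symmetry. A homomorphism out
  of a localization is determined on the image of the coordinate ring, so the two composites need to
  be compared with the identity only there.\<close>

lemma localized_gluing:
  fixes k :: "'k ring" and L\<Delta> :: "('k, 'l) module" and L\<Xi> :: "('k, 'q) module"
  assumes D: "atlas n P \<Delta> \<Xi> L\<Delta> k m r c" and E: "atlas n P \<Delta> \<Xi> L\<Xi> k m r c"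
    and locD: "localization_away k (coord_alg k n P \<Delta>) (block_det k n P \<Delta> m r c) L\<Delta> l\<Delta>"
    and locE: "localization_away k (coord_alg k n P \<Xi>) (block_det k n P \<Xi> m c r) L\<Xi> l\<Xi>"
  obtains \<theta> where "\<theta> \<in> alg_hom k L\<Xi> L\<Delta>" "bij_betw \<theta> (carrier L\<Xi>) (carrier L\<Delta>)"
    "\<And>a. a \<in> carrier (coord_alg k n P \<Xi>) \<Longrightarrow> \<theta> (l\<Xi> a) = gluing_map k n P \<Delta> \<Xi> L\<Delta> l\<Delta> a"
proof -
  interpret D: atlas n P \<Delta> \<Xi> L\<Delta> k m r c by (rule D)
  interpret E: atlas n P \<Delta> \<Xi> L\<Xi> k m r c by (rule E)
  interpret Dsw: atlas n P \<Xi> \<Delta> L\<Delta> k m c r by (rule D.swap)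
  interpret Esw: atlas n P \<Xi> \<Delta> L\<Xi> k m c r by (rule E.swap)
  let ?RD = "coord_alg k n P \<Delta>" and ?RX = "coord_alg k n P \<Xi>"
  let ?dD = "block_det k n P \<Delta> m r c" and ?dX = "block_det k n P \<Xi> m c r"
  have RD: "algebra k ?RD" and RX: "algebra k ?RX" by (rule D.D.cq.algebra_Q, rule D.E.cq.algebra_Q)
  have lD: "l\<Delta> \<in> alg_hom k ?RD L\<Delta>" "l\<Delta> ?dD \<in> Units L\<Delta>" and lX: "l\<Xi> \<in> alg_hom k ?RX L\<Xi>" "l\<Xi> ?dX \<in> Units L\<Xi>"
    using locD locE unfolding localization_away_def by blast+
  have LD: "algebra k L\<Delta>" and LX: "algebra k L\<Xi>" by (rule D.D.alg, rule E.D.alg)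
  let ?\<chi> = "gluing_map k n P \<Delta> \<Xi> L\<Delta> l\<Delta>" and ?\<psi> = "gluing_map k n P \<Xi> \<Delta> L\<Xi> l\<Xi>"
  have oD: "l\<Delta> \<in> D.open_pts" using lD D.open_pts_iff by blast
  have oX: "l\<Xi> \<in> Esw.open_pts" using lX Esw.open_pts_iff by blast
  note gD = D.glue_props[OF oD] and gX = Esw.glue_props[OF oX]
  obtain \<theta> where \<theta>: "\<theta> \<in> alg_hom k L\<Xi> L\<Delta>" "\<forall>a\<in>carrier ?RX. \<theta> (l\<Xi> a) = ?\<chi> a"
    using localization_lift[OF locE RX LD Dsw.det_closed gD(1,2)] by blast
  obtain \<eta> where \<eta>: "\<eta> \<in> alg_hom k L\<Delta> L\<Xi>" "\<forall>a\<in>carrier ?RD. \<eta> (l\<Delta> a) = ?\<psi> a"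
    using localization_lift[OF locD RD LX D.det_closed gX(1,2)] by blast
  have ext: "f \<in> extensional (carrier A)" if "f \<in> alg_hom k A C" for f and A :: "('k, 'x) module" and C :: "('k, 'y) module"
    using that by (simp add: alg_hom_def)
  have idh: "restrict (\<lambda>x. x) (carrier A) \<in> alg_hom k A A" if "algebra k A" for A :: "('k, 'x) module"
  proof -
    interpret A: cring A using that by (simp add: algebra_def)
    interpret AA: algebra k A by (rule that)
    show ?thesis unfolding alg_hom_def by (auto intro!: ring_hom_memI simp: AA.smult_closed)
  qed
  have \<theta>l: "compose (carrier ?RX) \<theta> l\<Xi> = ?\<chi>"
    using \<theta>(2) gD(1) by (intro extensionalityI[of _ "carrier ?RX"]) (auto simp: compose_def alg_hom_def)
  have \<eta>l: "compose (carrier ?RD) \<eta> l\<Delta> = ?\<psi>"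
    using \<eta>(2) gX(1) by (intro extensionalityI[of _ "carrier ?RD"]) (auto simp: compose_def alg_hom_def)
  \<comment> \<open>The composite of \<open>\<theta>\<close> with \<open>l\<Xi>\<close> is the glued
    point of \<open>l\<Delta>\<close>. Gluing it back returns \<open>l\<Delta>\<close>, while by
    naturality the result is \<open>\<theta>\<close> after the glued point \<open>?\<psi>\<close> of
    \<open>l\<Xi>\<close>.\<close>
  have n1: "l\<Delta> = compose (carrier ?RD) \<theta> ?\<psi>"
    using glue_natural(1)[OF E.swap D.swap \<theta>(1) lX] gD(3) unfolding \<theta>l by simp
  have n2: "l\<Xi> = compose (carrier ?RX) \<eta> ?\<chi>"
    using glue_natural(1)[OF D E \<eta>(1) lD] gX(3) unfolding \<eta>l by simp
  have cl: "l\<Delta> a \<in> carrier L\<Delta>" if "a \<in> carrier ?RD" for a using lD(1) that by (auto simp: alg_hom_def ring_hom_closed)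
  have cl': "l\<Xi> a \<in> carrier L\<Xi>" if "a \<in> carrier ?RX" for a using lX(1) that by (auto simp: alg_hom_def ring_hom_closed)
  have 1: "compose (carrier L\<Delta>) \<theta> \<eta> = restrict (\<lambda>x. x) (carrier L\<Delta>)"
  proof (rule localization_hom_eqI[OF locD LD alg_hom_compose[OF \<theta>(1) \<eta>(1) LD] idh[OF LD] _ D.D.RA_cring D.det_closed])
    fix a assume a: "a \<in> carrier ?RD"
    have "l\<Delta> a = \<theta> (?\<psi> a)" using fun_cong[OF n1, of a] a by (simp only: compose_eq)
    then have "\<theta> (\<eta> (l\<Delta> a)) = l\<Delta> a" using \<eta>(2) a by metis
    then show "compose (carrier L\<Delta>) \<theta> \<eta> (l\<Delta> a) = restrict (\<lambda>x. x) (carrier L\<Delta>) (l\<Delta> a)"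
      using cl[OF a] by (simp add: compose_def)
  qed
  have 2: "compose (carrier L\<Xi>) \<eta> \<theta> = restrict (\<lambda>x. x) (carrier L\<Xi>)"
  proof (rule localization_hom_eqI[OF locE LX alg_hom_compose[OF \<eta>(1) \<theta>(1) LX] idh[OF LX] _ D.E.RA_cring Dsw.det_closed])
    fix a assume a: "a \<in> carrier ?RX"
    have "l\<Xi> a = \<eta> (?\<chi> a)" using fun_cong[OF n2, of a] a by (simp only: compose_eq)
    then have "\<eta> (\<theta> (l\<Xi> a)) = l\<Xi> a" using \<theta>(2) a by metis
    then show "compose (carrier L\<Xi>) \<eta> \<theta> (l\<Xi> a) = restrict (\<lambda>x. x) (carrier L\<Xi>) (l\<Xi> a)"
      using cl'[OF a] by (simp add: compose_def)
  qed
  have "bij_betw \<theta> (carrier L\<Xi>) (carrier L\<Delta>)"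
  proof (rule bij_betwI[of _ _ _ \<eta>])
    show "\<theta> \<in> carrier L\<Xi> \<rightarrow> carrier L\<Delta>" "\<eta> \<in> carrier L\<Delta> \<rightarrow> carrier L\<Xi>"
      using \<theta>(1) \<eta>(1) by (auto simp: alg_hom_def ring_hom_closed)
    show "\<eta> (\<theta> x) = x" if "x \<in> carrier L\<Xi>" for x using fun_cong[OF 2, of x] that by (simp add: compose_def)
    show "\<theta> (\<eta> x) = x" if "x \<in> carrier L\<Delta>" for x using fun_cong[OF 1, of x] that by (simp add: compose_def)
  qed
  then show ?thesis using that \<theta> by blast
qed

theorem proposition7:
  fixes k :: "'k ring"
    and n d m :: nat
    and N M P \<Delta> \<Xi> :: "expo set"
    and r c :: "nat \<Rightarrow> expo"
  assumes "cring k"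
    and "standard_set n \<Delta>" and "finite \<Delta>" and "card \<Delta> = d"
    and "standard_set n \<Xi>" and "finite \<Xi>" and "card \<Xi> = d"
    and "d \<ge> 1"
    and "standard_set n N" and "standard_set n M" and "\<Delta> \<subseteq> N" and "\<Xi> \<subseteq> M"
    and "P = N \<union> M"
    and "m = card (\<Xi> - \<Delta>)"
    and "bij_betw r {..<m} (\<Xi> - \<Delta>)" and "bij_betw c {..<m} (\<Delta> - \<Xi>)"
    and "R\<Delta> = coord_alg k n P \<Delta>" and "T = coord_entry k n P \<Delta>"
    and "R\<Xi> = coord_alg k n P \<Xi>" and "U = coord_entry k n P \<Xi>"
    and "detT\<^sub>3\<^sub>2 = block_det k n P \<Delta> m r c" and "detU\<^sub>2\<^sub>2 = block_det k n P \<Xi> m c r"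
    and "A = transition_entry k n P \<Delta> \<Xi>"
  shows
    "\<comment> \<open>(i)\<close>
     (\<forall>B :: ('k, 'b) module. algebra k B \<longrightarrow>
        bij_betw (hilbert_chart k n P \<Delta> B) (hilbert_points_on n \<Delta> B) (alg_hom k R\<Delta> B) \<and>
        hilbert_chart k n P \<Delta> B ` (hilbert_points_on n \<Delta> B \<inter> hilbert_points_on n \<Xi> B) =
          open_subscheme_points k R\<Delta> (prime_spectrum R\<Delta> - vanishing_set R\<Delta> detT\<^sub>3\<^sub>2) B) \<and>
     \<comment> \<open>(ii)\<close>
     (\<forall>B :: ('k, 'b) module. algebra k B \<longrightarrow>
        bij_betw (gluing_map k n P \<Delta> \<Xi> B)
          (open_subscheme_points k R\<Delta> (prime_spectrum R\<Delta> - vanishing_set R\<Delta> detT\<^sub>3\<^sub>2) B)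
          (open_subscheme_points k R\<Xi> (prime_spectrum R\<Xi> - vanishing_set R\<Xi> detU\<^sub>2\<^sub>2) B)) \<and>
     (\<forall>(L\<Delta> :: ('k, 'l) module) l\<Delta> (L\<Xi> :: ('k, 'q) module) l\<Xi>.
        localization_away k R\<Delta> detT\<^sub>3\<^sub>2 L\<Delta> l\<Delta> \<longrightarrow> localization_away k R\<Xi> detU\<^sub>2\<^sub>2 L\<Xi> l\<Xi> \<longrightarrow>
        (\<exists>\<theta>\<in>alg_hom k L\<Xi> L\<Delta>. \<exists>Q.
           bij_betw \<theta> (carrier L\<Xi>) (carrier L\<Delta>) \<and>
           inverse_matrix L\<Delta> \<Xi> \<Delta> (\<lambda>\<xi> \<beta>. l\<Delta> (A \<xi> \<beta>)) Q \<and>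
           (\<forall>\<theta>'\<in>alg_hom k L\<Xi> L\<Delta>.
              (\<forall>\<alpha>\<in>P \<union> border n P. \<forall>\<beta>\<in>\<Delta>.
                 l\<Delta> (T \<alpha> \<beta>) = (\<Oplus>\<^bsub>L\<Delta>\<^esub>\<xi>\<in>\<Xi>. \<theta>' (l\<Xi> (U \<alpha> \<xi>)) \<otimes>\<^bsub>L\<Delta>\<^esub> l\<Delta> (A \<xi> \<beta>))) \<longleftrightarrow> \<theta>' = \<theta>) \<and>
           (\<forall>\<theta>'\<in>alg_hom k L\<Xi> L\<Delta>.
              (\<forall>\<alpha>\<in>P \<union> border n P. \<forall>\<xi>\<in>\<Xi>.
                 \<theta>' (l\<Xi> (U \<alpha> \<xi>)) = (\<Oplus>\<^bsub>L\<Delta>\<^esub>\<beta>\<in>\<Delta>. l\<Delta> (T \<alpha> \<beta>) \<otimes>\<^bsub>L\<Delta>\<^esub> Q \<beta> \<xi>)) \<longleftrightarrow> \<theta>' = \<theta>) \<and>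
           (\<forall>B :: ('k, 'b) module. algebra k B \<longrightarrow>
              (\<forall>\<phi>\<in>alg_hom k L\<Delta> B.
                 gluing_map k n P \<Delta> \<Xi> B (compose (carrier R\<Delta>) \<phi> l\<Delta>) =
                   compose (carrier R\<Xi>) (compose (carrier L\<Xi>) \<phi> \<theta>) l\<Xi>))))"
proof -
  let ?RD = "coord_alg k n P \<Delta>" and ?RX = "coord_alg k n P \<Xi>"
  let ?dD = "block_det k n P \<Delta> m r c" and ?dX = "block_det k n P \<Xi> m c r"
  have P: "standard_set n P" using assms(9,10,13) standard_set_Un by simp
  have ne: "\<Delta> \<noteq> {}" "\<Xi> \<noteq> {}" using assms(4,7,8) by auto
  have sub: "\<Delta> \<subseteq> P" "\<Xi> \<subseteq> P" using assms(11-13) by auto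
  \<comment> \<open>Generic in the element type, as it is instantiated with \<open>B\<close> and
    with both localizations.\<close>
  have atlas: "atlas n P \<Delta> \<Xi> B k m r c" if "algebra k B" for B :: "('k, 'x) module"
    using that P ne sub assms by (intro atlas.intro chart.intro frame.intro chart_axioms.intro atlas_axioms.intro)
      (auto simp: algebra_def)
  have part1: "bij_betw (hilbert_chart k n P \<Delta> B) (hilbert_points_on n \<Delta> B) (alg_hom k ?RD B) \<and>
        hilbert_chart k n P \<Delta> B ` (hilbert_points_on n \<Delta> B \<inter> hilbert_points_on n \<Xi> B) =
          open_subscheme_points k ?RD (prime_spectrum ?RD - vanishing_set ?RD ?dD) B"
    if "algebra k B" for B :: "('k, 'b) module"
  proof -
    interpret atlas n P \<Delta> \<Xi> B k m r c by (rule atlas[OF that])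
    show ?thesis using D.chart_bij chart_image by blast
  qed
  have part2: "bij_betw (gluing_map k n P \<Delta> \<Xi> B)
          (open_subscheme_points k ?RD (prime_spectrum ?RD - vanishing_set ?RD ?dD) B)
          (open_subscheme_points k ?RX (prime_spectrum ?RX - vanishing_set ?RX ?dX) B)"
    if "algebra k B" for B :: "('k, 'b) module"
    by (rule atlas.glue_bij[OF atlas[OF that]])
  have part3: "\<exists>\<theta>\<in>alg_hom k L\<Xi> L\<Delta>. \<exists>Q.
           bij_betw \<theta> (carrier L\<Xi>) (carrier L\<Delta>) \<and>
           inverse_matrix L\<Delta> \<Xi> \<Delta> (\<lambda>\<xi> \<beta>. l\<Delta> (transition_entry k n P \<Delta> \<Xi> \<xi> \<beta>)) Q \<and>
           (\<forall>\<theta>'\<in>alg_hom k L\<Xi> L\<Delta>.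
              (\<forall>\<alpha>\<in>P \<union> border n P. \<forall>\<beta>\<in>\<Delta>.
                 l\<Delta> (coord_entry k n P \<Delta> \<alpha> \<beta>) = (\<Oplus>\<^bsub>L\<Delta>\<^esub>\<xi>\<in>\<Xi>. \<theta>' (l\<Xi> (coord_entry k n P \<Xi> \<alpha> \<xi>)) \<otimes>\<^bsub>L\<Delta>\<^esub> l\<Delta> (transition_entry k n P \<Delta> \<Xi> \<xi> \<beta>))) \<longleftrightarrow> \<theta>' = \<theta>) \<and>
           (\<forall>\<theta>'\<in>alg_hom k L\<Xi> L\<Delta>.
              (\<forall>\<alpha>\<in>P \<union> border n P. \<forall>\<xi>\<in>\<Xi>.
                 \<theta>' (l\<Xi> (coord_entry k n P \<Xi> \<alpha> \<xi>)) = (\<Oplus>\<^bsub>L\<Delta>\<^esub>\<beta>\<in>\<Delta>. l\<Delta> (coord_entry k n P \<Delta> \<alpha> \<beta>) \<otimes>\<^bsub>L\<Delta>\<^esub> Q \<beta> \<xi>)) \<longleftrightarrow> \<theta>' = \<theta>) \<and>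
           (\<forall>B :: ('k, 'b) module. algebra k B \<longrightarrow>
              (\<forall>\<phi>\<in>alg_hom k L\<Delta> B.
                 gluing_map k n P \<Delta> \<Xi> B (compose (carrier ?RD) \<phi> l\<Delta>) =
                   compose (carrier ?RX) (compose (carrier L\<Xi>) \<phi> \<theta>) l\<Xi>))"
    if locD: "localization_away k ?RD ?dD L\<Delta> l\<Delta>" and locX: "localization_away k ?RX ?dX L\<Xi> l\<Xi>"
    for L\<Delta> :: "('k, 'l) module" and l\<Delta> and L\<Xi> :: "('k, 'q) module" and l\<Xi>
  proof -
    have LD: "algebra k L\<Delta>" and LX: "algebra k L\<Xi>"
      and lD: "l\<Delta> \<in> alg_hom k ?RD L\<Delta>" "l\<Delta> ?dD \<in> Units L\<Delta>" and lX: "l\<Xi> \<in> alg_hom k ?RX L\<Xi>"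
      using locD locX unfolding localization_away_def by blast+
    interpret L: atlas n P \<Delta> \<Xi> L\<Delta> k m r c by (rule atlas[OF LD])
    interpret X: atlas n P \<Delta> \<Xi> L\<Xi> k m r c by (rule atlas[OF LX])
    have RX: "algebra k ?RX" by (rule L.E.cq.algebra_Q)
    let ?\<chi> = "gluing_map k n P \<Delta> \<Xi> L\<Delta> l\<Delta>"
    obtain \<theta> where \<theta>: "\<theta> \<in> alg_hom k L\<Xi> L\<Delta>" "bij_betw \<theta> (carrier L\<Xi>) (carrier L\<Delta>)"
      "\<And>a. a \<in> carrier ?RX \<Longrightarrow> \<theta> (l\<Xi> a) = ?\<chi> a"
      using localized_gluing[OF atlas[OF LD] atlas[OF LX] locD locX] by blast
    have oD: "l\<Delta> \<in> L.open_pts" using lD L.open_pts_iff by blast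
    note g = L.glue_props[OF oD]
    obtain Y where Y: "inverse_matrix L\<Delta> \<Xi> \<Delta> (\<lambda>\<xi> \<beta>. l\<Delta> (L.D.entry \<xi> \<beta>)) Y"
      using L.unit_iff_invertible[OF lD(1)] lD(2) by blast
    have YA: "inverse_matrix L\<Delta> \<Xi> \<Delta> (\<lambda>\<xi> \<beta>. l\<Delta> (transition_entry k n P \<Delta> \<Xi> \<xi> \<beta>)) Y"
      by (rule L.D.inverse_matrix_cong[OF _ Y]) (simp add: L.hom_transition_entry[OF lD(1)])
    have cX: "l\<Xi> a \<in> carrier L\<Xi>" if "a \<in> carrier ?RX" for a using lX that by (auto simp: alg_hom_def ring_hom_closed)
    \<comment> \<open>The formula fixes the composite with \<open>l\<Xi>\<close> on the entries,
      which generate the coordinate algebra; a homomorphism on the localization is determined by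
      this composite.\<close>
    have U: "(\<forall>\<alpha>\<in>P \<union> border n P. \<forall>\<xi>\<in>\<Xi>.
       \<theta>' (l\<Xi> (L.E.entry \<alpha> \<xi>)) = (\<Oplus>\<^bsub>L\<Delta>\<^esub>\<beta>\<in>\<Delta>. l\<Delta> (L.D.entry \<alpha> \<beta>) \<otimes>\<^bsub>L\<Delta>\<^esub> Y \<beta> \<xi>)) \<longleftrightarrow> \<theta>' = \<theta>"
      (is "?formula \<longleftrightarrow> _")
      if \<theta>': "\<theta>' \<in> alg_hom k L\<Xi> L\<Delta>" for \<theta>'
    proof
      assume "\<theta>' = \<theta>"
      then show ?formula
        using g(4)[OF Y] \<theta>(3) L.E.entry_closed by simp
    next
      assume h: ?formula
      have "compose (carrier ?RX) \<theta>' l\<Xi> = ?\<chi>"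
      proof (rule L.E.alg_hom_eqI[OF alg_hom_compose[OF \<theta>' lX RX] g(1)])
        fix \<alpha> \<xi> assume a: "\<alpha> \<in> P \<union> border n P" "\<xi> \<in> \<Xi>"
        then show "compose (carrier ?RX) \<theta>' l\<Xi> (L.E.entry \<alpha> \<xi>) = ?\<chi> (L.E.entry \<alpha> \<xi>)"
          using h g(4)[OF Y a] L.E.entry_closed[OF a] by (simp add: compose_def)
      qed
      then have "\<theta>' (l\<Xi> a) = \<theta> (l\<Xi> a)" if "a \<in> carrier ?RX" for a
        using \<theta>(3)[OF that] that by (metis compose_eq)
      then show "\<theta>' = \<theta>"
        using L.E.RA_cring atlas.det_closed[OF L.swap] by (intro localization_hom_eqI[OF locX LD \<theta>' \<theta>(1)])
    qed
    \<comment> \<open>Row by row, the two formulas are equivalent because the transition matrix is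
      invertible over \<open>L\<Delta>\<close>.\<close>
    have solve: "(\<forall>\<beta>\<in>\<Delta>. l\<Delta> (L.D.entry \<alpha> \<beta>) = (\<Oplus>\<^bsub>L\<Delta>\<^esub>\<xi>\<in>\<Xi>. \<theta>' (l\<Xi> (L.E.entry \<alpha> \<xi>)) \<otimes>\<^bsub>L\<Delta>\<^esub> l\<Delta> (transition_entry k n P \<Delta> \<Xi> \<xi> \<beta>))) \<longleftrightarrow>
      (\<forall>\<xi>\<in>\<Xi>. \<theta>' (l\<Xi> (L.E.entry \<alpha> \<xi>)) = (\<Oplus>\<^bsub>L\<Delta>\<^esub>\<beta>\<in>\<Delta>. l\<Delta> (L.D.entry \<alpha> \<beta>) \<otimes>\<^bsub>L\<Delta>\<^esub> Y \<beta> \<xi>))"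
      if \<theta>': "\<theta>' \<in> alg_hom k L\<Xi> L\<Delta>" and a: "\<alpha> \<in> P \<union> border n P" for \<theta>' \<alpha>
    proof (rule L.D.solve_inverse_matrix[OF L.E.fin L.D.fin YA])
      show "\<theta>' (l\<Xi> (L.E.entry \<alpha> \<xi>)) \<in> carrier L\<Delta>" if "\<xi> \<in> \<Xi>" for \<xi>
        using cX[OF L.E.entry_closed[OF a that]] \<theta>' by (auto simp: alg_hom_def ring_hom_closed)
      show "l\<Delta> (L.D.entry \<alpha> \<beta>) \<in> carrier L\<Delta>" if "\<beta> \<in> \<Delta>" for \<beta>
        using L.D.is_tableD(1)[OF L.D.hom_table[OF lD(1)] a that] .
    qed
    have T: "(\<forall>\<alpha>\<in>P \<union> border n P. \<forall>\<beta>\<in>\<Delta>. l\<Delta> (L.D.entry \<alpha> \<beta>) =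
        (\<Oplus>\<^bsub>L\<Delta>\<^esub>\<xi>\<in>\<Xi>. \<theta>' (l\<Xi> (L.E.entry \<alpha> \<xi>)) \<otimes>\<^bsub>L\<Delta>\<^esub> l\<Delta> (transition_entry k n P \<Delta> \<Xi> \<xi> \<beta>))) \<longleftrightarrow> \<theta>' = \<theta>"
      if \<theta>': "\<theta>' \<in> alg_hom k L\<Xi> L\<Delta>" for \<theta>'
      unfolding U[OF \<theta>', symmetric] by (intro ball_cong refl solve[OF \<theta>'])
    \<comment> \<open>By naturality, the gluing of \<open>l\<Delta>\<close>, known through
      \<open>\<theta>\<close>, determines the gluing of every point that some \<open>\<phi>\<close>
      produces from \<open>l\<Delta>\<close>.\<close>
    have glue: "gluing_map k n P \<Delta> \<Xi> B (compose (carrier ?RD) \<phi> l\<Delta>) = compose (carrier ?RX) (compose (carrier L\<Xi>) \<phi> \<theta>) l\<Xi>"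
      if B: "algebra k B" and \<phi>: "\<phi> \<in> alg_hom k L\<Delta> B" for B :: "('k, 'b) module" and \<phi>
    proof -
      have "gluing_map k n P \<Delta> \<Xi> B (compose (carrier ?RD) \<phi> l\<Delta>) = compose (carrier ?RX) \<phi> ?\<chi>"
        by (rule glue_natural(1)[OF atlas[OF LD] atlas[OF B] \<phi> lD])
      also have "\<dots> = compose (carrier ?RX) (compose (carrier L\<Xi>) \<phi> \<theta>) l\<Xi>"
        using \<theta>(3) cX by (auto simp: compose_def fun_eq_iff)
      finally show ?thesis .
    qed
    show ?thesis
      by (intro bexI[OF _ \<theta>(1)] exI[of _ Y] conjI ballI allI impI \<theta>(2) YA T U glue)
  qed
  show ?thesis
    unfolding assms(17-23) using part1 part2 part3 by blast
qed

end
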